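(* Let $G$ be a finite connected graph with $n$ vertices and $m$ edges and let $k\ge 1$ be an integer with $k\le n$. There is an algorithm that, given $G$ and $k$, runs in $O(mn^2\log n)$ time and outputs a collection $\mathcal{C}$ of $k$ isometric paths of $G$ with $\max_{v\in V(G)} d(v,\bigcup_{P\in\mathcal{C}}V(P)) \le R^*_k + 6\tau(G)+1$; i.e. it is an $O(mn^2\log n)$-time additive $(6\tau(G)+1)$-approximation algorithm for $k$-Geodesic Center on $G$.
   Context: $d$ is the shortest-path distance of $G$; an isometric path is a shortest path. For a collection $\mathcal{C}$ of isometric paths, its eccentricity is $\max_{v\in V(G)} d(v,\bigcup_{P\in\mathcal{C}}V(P))$. $R^*_k$ is the minimum eccentricity of a collection of $k$ isometric paths of $G$ ($k$-Geodesic Center optimum). Thinness: turn $G$ into a geodesic metric space $X$ by replacing each edge by a segment of length 1. For points $x,y,z$ of $X$, a geodesic triangle $\Delta(x,y,z)$ is a union of three geodesic segments $[x,y],[y,z],[x,z]$. With $\alpha_x=(y|z)_x$, $\alpha_y=(x|z)_y$, $\alpha_z=(x|y)_z$, where $(a|b)_c=\frac12(d(a,c)+d(c,b)-d(a,b))$, there is a unique map $\varphi$ from $\Delta(x,y,z)$ to a tripod (star with three legs of lengths $\alpha_x,\alpha_y,\alpha_z$) that is isometric on each side and sends $x,y,z$ to the leaves. The triangle is $\delta$-thin if $\varphi(u)=\varphi(v)$ implies $d(u,v)\le\delta$. The thinness $\tau(G)$ is the smallest integer $\delta$ such that all geodesic triangles of $X$ are $\delta$-thin. *)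

theory Defs
  imports Complex_Main
begin

section \<open>Graphs, isometric paths and the geodesic centre problem\<close>

definition simple_graph :: "'a set \<Rightarrow> 'a set set \<Rightarrow> bool" where
  "simple_graph V E \<longleftrightarrow> finite V \<and> (\<forall>e\<in>E. e \<subseteq> V \<and> card e = 2)"

definition walk :: "'a set \<Rightarrow> 'a set set \<Rightarrow> 'a list \<Rightarrow> bool" where
  "walk V E p \<longleftrightarrow> p \<noteq> [] \<and> set p \<subseteq> V \<and> successively (\<lambda>u v. {u, v} \<in> E) p"

definition connected_graph :: "'a set \<Rightarrow> 'a set set \<Rightarrow> bool" where
  "connected_graph V E \<longleftrightarrow> simple_graph V E \<and> V \<noteq> {} \<and>
     (\<forall>u\<in>V. \<forall>v\<in>V. \<exists>p. walk V E p \<and> hd p = u \<and> last p = v)"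

definition gdist :: "'a set \<Rightarrow> 'a set set \<Rightarrow> 'a \<Rightarrow> 'a \<Rightarrow> nat" where
  "gdist V E u v = (LEAST l. \<exists>p. walk V E p \<and> hd p = u \<and> last p = v \<and> length p = Suc l)"

definition isometric_path :: "'a set \<Rightarrow> 'a set set \<Rightarrow> 'a list \<Rightarrow> bool" where
  "isometric_path V E p \<longleftrightarrow> walk V E p \<and> length p = Suc (gdist V E (hd p) (last p))"

(* An isometric path is an induced subgraph, so it is determined by its vertex set.  Comparing
   vertex sets identifies a path with its reversal and makes this a collection of k different
   paths; a single vertex is an isometric path of length 0. *)
definition path_collection :: "'a set \<Rightarrow> 'a set set \<Rightarrow> nat \<Rightarrow> 'a list list \<Rightarrow> bool" where
  "path_collection V E k ps \<longleftrightarrow>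
     length ps = k \<and> distinct (map set ps) \<and> (\<forall>p\<in>set ps. isometric_path V E p)"

definition eccentricity :: "'a set \<Rightarrow> 'a set set \<Rightarrow> 'a list list \<Rightarrow> nat" where
  "eccentricity V E ps = (MAX v\<in>V. MIN u\<in>(\<Union>p\<in>set ps. set p). gdist V E v u)"

definition geodesic_center_opt :: "'a set \<Rightarrow> 'a set set \<Rightarrow> nat \<Rightarrow> nat" where
  "geodesic_center_opt V E k = (LEAST r. \<exists>ps. path_collection V E k ps \<and> eccentricity V E ps = r)"

section \<open>The metric graph\<close>

(* Points of the metric graph are given by barycentric coordinates: a vertex v is the function
   that is 1 at v and 0 elsewhere, and the points of an edge {u,v} are the convex combinations
   of u and v. *)
definition cells :: "'a set \<Rightarrow> 'a set set \<Rightarrow> 'a set set" where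
  "cells V E = E \<union> (\<lambda>v. {v}) ` V"

definition cell_points :: "'a set \<Rightarrow> ('a \<Rightarrow> real) set" where
  "cell_points e = {p. (\<forall>v. 0 \<le> p v) \<and> (\<forall>v. v \<notin> e \<longrightarrow> p v = 0) \<and> (\<Sum>v\<in>e. p v) = 1}"

definition metric_graph :: "'a set \<Rightarrow> 'a set set \<Rightarrow> ('a \<Rightarrow> real) set" where
  "metric_graph V E = (\<Union>e\<in>cells V E. cell_points e)"

(* For two points p, q of one edge {u,v} this is \<bar>p v - q v\<bar>: the edge is a segment of length 1. *)
definition segment_dist :: "'a set \<Rightarrow> ('a \<Rightarrow> real) \<Rightarrow> ('a \<Rightarrow> real) \<Rightarrow> real" where
  "segment_dist V p q = (\<Sum>v\<in>V. \<bar>p v - q v\<bar>) / 2"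

inductive pl_path :: "'a set \<Rightarrow> 'a set set \<Rightarrow> ('a \<Rightarrow> real) \<Rightarrow> ('a \<Rightarrow> real) \<Rightarrow> real \<Rightarrow> bool"
  for V E where
  pl_refl: "p \<in> metric_graph V E \<Longrightarrow> pl_path V E p p 0"
| pl_step: "pl_path V E p q l \<Longrightarrow> e \<in> cells V E \<Longrightarrow> q \<in> cell_points e \<Longrightarrow> r \<in> cell_points e
    \<Longrightarrow> pl_path V E p r (l + segment_dist V q r)"

(* The length metric: infimum of the lengths of the piecewise linear paths from p to q. *)
definition mdist :: "'a set \<Rightarrow> 'a set set \<Rightarrow> ('a \<Rightarrow> real) \<Rightarrow> ('a \<Rightarrow> real) \<Rightarrow> real" where
  "mdist V E p q = Inf {l. pl_path V E p q l}"

section \<open>Thinness\<close>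

definition geodesic_segment ::
  "'p set \<Rightarrow> ('p \<Rightarrow> 'p \<Rightarrow> real) \<Rightarrow> 'p \<Rightarrow> 'p \<Rightarrow> 'p set \<Rightarrow> bool" where
  "geodesic_segment M d x y S \<longleftrightarrow> S \<subseteq> M \<and>
     (\<exists>g. g 0 = x \<and> g (d x y) = y \<and> g ` {0..d x y} = S \<and>
          (\<forall>s\<in>{0..d x y}. \<forall>t\<in>{0..d x y}. d (g s) (g t) = \<bar>s - t\<bar>))"

definition gromov_product :: "('p \<Rightarrow> 'p \<Rightarrow> real) \<Rightarrow> 'p \<Rightarrow> 'p \<Rightarrow> 'p \<Rightarrow> real" where
  "gromov_product d a b c = (d a c + d c b - d a b) / 2"

(* The tripod with legs of lengths a, b, c lies on the coordinate axes; the l1-distance restricted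
   to it is its path metric, and the centre is the origin. *)
definition tripod :: "real \<Rightarrow> real \<Rightarrow> real \<Rightarrow> (real \<times> real \<times> real) set" where
  "tripod a b c = (\<lambda>r. (r, 0, 0)) ` {0..a} \<union> (\<lambda>r. (0, r, 0)) ` {0..b} \<union> (\<lambda>r. (0, 0, r)) ` {0..c}"

fun tripod_dist :: "real \<times> real \<times> real \<Rightarrow> real \<times> real \<times> real \<Rightarrow> real" where
  "tripod_dist (a, b, c) (a', b', c') = \<bar>a - a'\<bar> + \<bar>b - b'\<bar> + \<bar>c - c'\<bar>"

definition tripod_map :: "('p \<Rightarrow> 'p \<Rightarrow> real) \<Rightarrow> 'p \<Rightarrow> 'p \<Rightarrow> 'p \<Rightarrow> 'p set \<Rightarrow> 'p set \<Rightarrow> 'p set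
    \<Rightarrow> ('p \<Rightarrow> real \<times> real \<times> real) \<Rightarrow> bool" where
  "tripod_map d x y z A B C f \<longleftrightarrow>
     (let ax = gromov_product d y z x; ay = gromov_product d x z y; az = gromov_product d x y z in
        f ` (A \<union> B \<union> C) \<subseteq> tripod ax ay az \<and>
        f x = (ax, 0, 0) \<and> f y = (0, ay, 0) \<and> f z = (0, 0, az) \<and>
        (\<forall>S\<in>{A, B, C}. \<forall>u\<in>S. \<forall>v\<in>S. tripod_dist (f u) (f v) = d u v))"

(* The tripod map of a geodesic triangle exists and is unique on the triangle. *)
definition thin_triangle ::
  "('p \<Rightarrow> 'p \<Rightarrow> real) \<Rightarrow> 'p \<Rightarrow> 'p \<Rightarrow> 'p \<Rightarrow> 'p set \<Rightarrow> 'p set \<Rightarrow> 'p set \<Rightarrow> real \<Rightarrow> bool" where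
  "thin_triangle d x y z A B C \<delta> \<longleftrightarrow>
     (\<exists>f. tripod_map d x y z A B C f \<and>
          (\<forall>u\<in>A \<union> B \<union> C. \<forall>v\<in>A \<union> B \<union> C. f u = f v \<longrightarrow> d u v \<le> \<delta>))"

definition thin_space :: "'p set \<Rightarrow> ('p \<Rightarrow> 'p \<Rightarrow> real) \<Rightarrow> real \<Rightarrow> bool" where
  "thin_space M d \<delta> \<longleftrightarrow>
     (\<forall>x\<in>M. \<forall>y\<in>M. \<forall>z\<in>M. \<forall>A B C.
        geodesic_segment M d x y A \<and> geodesic_segment M d y z B \<and> geodesic_segment M d x z C
        \<longrightarrow> thin_triangle d x y z A B C \<delta>)"

definition thinness :: "'a set \<Rightarrow> 'a set set \<Rightarrow> nat" where
  "thinness V E = (LEAST \<delta>. thin_space (metric_graph V E) (mdist V E) (real \<delta>))"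

section \<open>Word RAM\<close>

(* Random access machine with structured control.  Machine words are the naturals up to a bound W:
   a run gets stuck as soon as an intermediate result exceeds W.  Every constant, register access,
   memory access, operation, comparison, assignment and branch takes one unit of time. *)

datatype aexp = Const nat | Reg nat | Mem aexp
  | Plus aexp aexp | Minus aexp aexp | Times aexp aexp | Divide aexp aexp

datatype bexp = Less aexp aexp | Equal aexp aexp | BNot bexp | BAnd bexp bexp

datatype com = Skip | Assign nat aexp | Store aexp aexp | Seq com com | Cond bexp com com | While bexp com

record state =
  reg :: "nat \<Rightarrow> nat"
  mem :: "nat \<Rightarrow> nat"

primrec aval :: "state \<Rightarrow> aexp \<Rightarrow> nat" where
  "aval s (Const i) = i"
| "aval s (Reg r) = reg s r"
| "aval s (Mem a) = mem s (aval s a)"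
| "aval s (Plus a b) = aval s a + aval s b"
| "aval s (Minus a b) = aval s a - aval s b"
| "aval s (Times a b) = aval s a * aval s b"
| "aval s (Divide a b) = aval s a div aval s b"

(* Contents of registers and cells need no check: see exec_word below. *)
primrec afits :: "nat \<Rightarrow> state \<Rightarrow> aexp \<Rightarrow> bool" where
  "afits W s (Const i) \<longleftrightarrow> i \<le> W"
| "afits W s (Reg r) \<longleftrightarrow> True"
| "afits W s (Mem a) \<longleftrightarrow> afits W s a"
| "afits W s (Plus a b) \<longleftrightarrow> afits W s a \<and> afits W s b \<and> aval s a + aval s b \<le> W"
| "afits W s (Minus a b) \<longleftrightarrow> afits W s a \<and> afits W s b"
| "afits W s (Times a b) \<longleftrightarrow> afits W s a \<and> afits W s b \<and> aval s a * aval s b \<le> W"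
| "afits W s (Divide a b) \<longleftrightarrow> afits W s a \<and> afits W s b"

primrec acost :: "aexp \<Rightarrow> nat" where
  "acost (Const i) = 1"
| "acost (Reg r) = 1"
| "acost (Mem a) = 1 + acost a"
| "acost (Plus a b) = 1 + acost a + acost b"
| "acost (Minus a b) = 1 + acost a + acost b"
| "acost (Times a b) = 1 + acost a + acost b"
| "acost (Divide a b) = 1 + acost a + acost b"

primrec bval :: "state \<Rightarrow> bexp \<Rightarrow> bool" where
  "bval s (Less a b) \<longleftrightarrow> aval s a < aval s b"
| "bval s (Equal a b) \<longleftrightarrow> aval s a = aval s b"
| "bval s (BNot b) \<longleftrightarrow> \<not> bval s b"
| "bval s (BAnd b c) \<longleftrightarrow> bval s b \<and> bval s c"

primrec bfits :: "nat \<Rightarrow> state \<Rightarrow> bexp \<Rightarrow> bool" where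
  "bfits W s (Less a b) \<longleftrightarrow> afits W s a \<and> afits W s b"
| "bfits W s (Equal a b) \<longleftrightarrow> afits W s a \<and> afits W s b"
| "bfits W s (BNot b) \<longleftrightarrow> bfits W s b"
| "bfits W s (BAnd b c) \<longleftrightarrow> bfits W s b \<and> bfits W s c"

primrec bcost :: "bexp \<Rightarrow> nat" where
  "bcost (Less a b) = 1 + acost a + acost b"
| "bcost (Equal a b) = 1 + acost a + acost b"
| "bcost (BNot b) = 1 + bcost b"
| "bcost (BAnd b c) = 1 + bcost b + bcost c"

(* exec W c s t s': started in s, the program c halts after t steps in s'. *)
inductive exec :: "nat \<Rightarrow> com \<Rightarrow> state \<Rightarrow> nat \<Rightarrow> state \<Rightarrow> bool" for W where
  ex_skip: "exec W Skip s 1 s"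
| ex_assign: "afits W s a
    \<Longrightarrow> exec W (Assign r a) s (1 + acost a) (s\<lparr>reg := (reg s)(r := aval s a)\<rparr>)"
| ex_store: "afits W s a \<Longrightarrow> afits W s b
    \<Longrightarrow> exec W (Store a b) s (1 + acost a + acost b) (s\<lparr>mem := (mem s)(aval s a := aval s b)\<rparr>)"
| ex_seq: "exec W c s t s' \<Longrightarrow> exec W d s' t' s'' \<Longrightarrow> exec W (Seq c d) s (t + t') s''"
| ex_cond_true: "bfits W s b \<Longrightarrow> bval s b \<Longrightarrow> exec W c s t s'
    \<Longrightarrow> exec W (Cond b c d) s (1 + bcost b + t) s'"
| ex_cond_false: "bfits W s b \<Longrightarrow> \<not> bval s b \<Longrightarrow> exec W d s t s'
    \<Longrightarrow> exec W (Cond b c d) s (1 + bcost b + t) s'"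
| ex_while_true: "bfits W s b \<Longrightarrow> bval s b \<Longrightarrow> exec W c s t s' \<Longrightarrow> exec W (While b c) s' t' s''
    \<Longrightarrow> exec W (While b c) s (1 + bcost b + t + t') s''"
| ex_while_false: "bfits W s b \<Longrightarrow> \<not> bval s b \<Longrightarrow> exec W (While b c) s (1 + bcost b) s"

inductive_cases exec_SkipE: "exec W Skip s t s'"
inductive_cases exec_AssignE: "exec W (Assign r a) s t s'"
inductive_cases exec_StoreE: "exec W (Store a b) s t s'"
inductive_cases exec_SeqE: "exec W (Seq c d) s t s'"
inductive_cases exec_CondE: "exec W (Cond b c d) s t s'"
inductive_cases exec_WhileE: "exec W (While b c) s t s'"

lemma exec_deterministic:
  "exec W c s t s' \<Longrightarrow> exec W c s u s'' \<Longrightarrow> u = t \<and> s'' = s'"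
proof (induction arbitrary: u s'' rule: exec.induct)
  case (ex_skip s)
  then show ?case by (rule exec_SkipE) simp
next
  case (ex_assign s a r)
  from ex_assign.prems show ?case by (rule exec_AssignE) simp
next
  case (ex_store s a b)
  from ex_store.prems show ?case by (rule exec_StoreE) simp
next
  case (ex_seq c s t s' d t' s1)
  from ex_seq.prems show ?case by (rule exec_SeqE) (auto dest!: ex_seq.IH)
next
  case (ex_cond_true s b c t s' d)
  from ex_cond_true.prems show ?case by (rule exec_CondE) (use ex_cond_true.hyps(2) in \<open>auto dest!: ex_cond_true.IH\<close>)
next
  case (ex_cond_false s b d t s' c)
  from ex_cond_false.prems show ?case by (rule exec_CondE) (use ex_cond_false.hyps(2) in \<open>auto dest!: ex_cond_false.IH\<close>)
next
  case (ex_while_true s b c t s' t' s1)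
  from ex_while_true.prems show ?case
    by (rule exec_WhileE) (use ex_while_true.hyps(2) in \<open>auto dest!: ex_while_true.IH\<close>)
next
  case (ex_while_false s b c)
  from ex_while_false.prems show ?case by (rule exec_WhileE) (use ex_while_false.hyps in simp_all)
qed

definition word_state :: "nat \<Rightarrow> state \<Rightarrow> bool" where
  "word_state W s \<longleftrightarrow> (\<forall>r. reg s r \<le> W) \<and> (\<forall>a. mem s a \<le> W)"

lemma aval_word: "word_state W s \<Longrightarrow> afits W s a \<Longrightarrow> aval s a \<le> W"
proof (induction a)
  case (Minus a b)
  then show ?case by (simp add: le_diff_conv)
next
  case (Divide a b)
  then have "aval s a \<le> W" by simp
  with div_le_dividend[of "aval s a" "aval s b"] show ?case unfolding aval.simps by linarith
qed (auto simp: word_state_def)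

lemma exec_word: "exec W c s t s' \<Longrightarrow> word_state W s \<Longrightarrow> word_state W s'"
proof (induction rule: exec.induct)
  case (ex_assign s a r)
  with aval_word[OF ex_assign.prems ex_assign.hyps] show ?case by (auto simp: word_state_def)
next
  case (ex_store s a b)
  with aval_word[OF ex_store.prems ex_store.hyps(2)] show ?case by (auto simp: word_state_def)
qed auto

section \<open>Input and output\<close>

definition edge_list :: "'a set set \<Rightarrow> ('a \<times> 'a) list \<Rightarrow> bool" where
  "edge_list E es \<longleftrightarrow>
     distinct (map (\<lambda>(u, v). {u, v}) es) \<and> set (map (\<lambda>(u, v). {u, v}) es) = E"

definition input_words :: "nat \<Rightarrow> (nat \<times> nat) list \<Rightarrow> nat \<Rightarrow> nat list" where
  "input_words n es k = [n, length es, k] @ concat (map (\<lambda>(u, v). [u, v]) es)"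

definition input_state :: "nat \<Rightarrow> (nat \<times> nat) list \<Rightarrow> nat \<Rightarrow> state" where
  "input_state n es k = \<lparr>reg = (\<lambda>_. 0),
     mem = (\<lambda>a. if a < length (input_words n es k) then input_words n es k ! a else 0)\<rparr>"

(* Register 0 points to the output block: each path is written as its number of vertices
   followed by its vertices. *)
definition output_words :: "nat list list \<Rightarrow> nat list" where
  "output_words ps = concat (map (\<lambda>p. length p # p) ps)"

definition outputs :: "state \<Rightarrow> nat list list \<Rightarrow> bool" where
  "outputs s ps \<longleftrightarrow> (\<forall>i < length (output_words ps). mem s (reg s 0 + i) = output_words ps ! i)"

end

theory Submission
  imports Defs
begin

text \<open>Thinness \<open>\<tau>\<close> yields the four-point condition with constant \<open>2 \<tau>\<close>, and the distance from \<open>v\<close> to a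
  geodesic from \<open>a\<close> to \<open>b\<close> is the Gromov product \<open>(a|b)\<^sub>v\<close> up to \<open>\<tau> + 1\<close>.  So it suffices to find \<open>k\<close>
  pairs such that every \<open>v\<close> has a pair with \<open>(a|b)\<^sub>v \<le> R\<^sup>* + 5 \<tau>\<close>.  Let \<open>r\<close> be an end of a diametral
  pair.  For a threshold \<open>T\<close>, choose vertices by decreasing distance from \<open>r\<close>, skipping \<open>v\<close> if
  \<open>(r|a)\<^sub>v \<le> T/2\<close> for a chosen \<open>a\<close>.  If more than \<open>2 k\<close> vertices are chosen, three of them lie within
  \<open>R\<^sup>*\<close> of one optimal path, and one of the three is almost between the other two; this contradicts the
  separation unless \<open>T/2 < R\<^sup>* + 4 \<tau>\<close>.  For the least \<open>T\<close> with at most \<open>2 k\<close> chosen vertices, these are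
  paired so that exchanging partners between two pairs never increases the total distance; by the
  four-point condition, such a pairing serves every \<open>v\<close> at an additional cost of \<open>\<tau>\<close> only.  Since
  the total distance is at most \<open>n\<^sup>2\<close>, a local search that keeps the possibly improvable pairs on a
  stack needs \<open>O(n\<^sup>3)\<close> steps.\<close>

section \<open>Graph distance and isometric paths\<close>

text \<open>The loss \<open>6 * \<tau> + 1\<close> is a sum. Among three vertices within
  \<open>R\<close> of one geodesic, one lies between the other two up to
  \<open>R + 3 * \<tau>\<close>. The greedy choice controls only products that involve
  \<open>r\<close>; passing to arbitrary triples of chosen vertices costs \<open>\<tau>\<close>.
  Triples whose middle vertex is \<open>r\<close> itself are the reason for taking \<open>r\<close>
  from a diametral pair: there the vertex farthest from \<open>r\<close> takes over the role of
  \<open>r\<close>. The pairing costs \<open>\<tau>\<close>, and passing from a Gromov product to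
  the distance from a vertex of a geodesic costs \<open>\<tau> + 1\<close>, where the 1 pays for
  rounding to a vertex. The distances come from \<open>n\<close> rounds that relax every edge for
  all sources; all other phases are at most cubic in \<open>n\<close>, and \<open>card_E_ge\<close>
  turns \<open>n^3\<close> into \<open>m n^2\<close>. The paths must differ as vertex sets, so a
  repeated pair is replaced by a single vertex. On the machine side the obstacle is the word bound
  \<open>(n + 1) ^ c\<close>: the program is written in a small array language in which a stored
  value exceeds the old contents by at most a constant per step, so that the polynomial running time
  itself bounds the words.\<close>

lemma walk_rev: "walk V E p \<Longrightarrow> walk V E (rev p)"
  unfolding walk_def by (auto simp: insert_commute)

lemma walk_append:
  assumes "walk V E p" "walk V E q" "last p = hd q"
  shows "walk V E (p @ tl q)"
proof (cases "tl q = []")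
  case False
  then obtain a b qs where q: "q = a # b # qs" by (cases q; cases "tl q") auto
  with assms show ?thesis
    unfolding walk_def by (auto simp: successively_append_iff)
qed (use assms in simp)

lemma walk_take: "walk V E p \<Longrightarrow> 0 < i \<Longrightarrow> walk V E (take i p)"
  unfolding walk_def successively_conv_nth by (auto dest: in_set_takeD)

lemma walk_drop: "walk V E p \<Longrightarrow> i < length p \<Longrightarrow> walk V E (drop i p)"
  unfolding walk_def successively_conv_nth by (auto dest: in_set_dropD)

lemma walk_sub: "walk V E p \<Longrightarrow> i \<le> j \<Longrightarrow> j < length p \<Longrightarrow> walk V E (drop i (take (Suc j) p))"
  by (intro walk_drop walk_take) auto

locale conn_graph =
  fixes V :: "'a set" and E :: "'a set set"
  assumes conn: "connected_graph V E"
begin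

abbreviation d :: "'a \<Rightarrow> 'a \<Rightarrow> nat" where "d \<equiv> gdist V E"

lemma finV: "finite V" and V_ne: "V \<noteq> {}"
  and edge_card: "e \<in> E \<Longrightarrow> card e = 2" and edge_sub: "e \<in> E \<Longrightarrow> e \<subseteq> V"
  using conn unfolding connected_graph_def simple_graph_def by auto

lemma edgeD: "{u, v} \<in> E \<Longrightarrow> u \<noteq> v \<and> u \<in> V \<and> v \<in> V"
  using edge_card[of "{u,v}"] edge_sub[of "{u,v}"] by (cases "u = v") auto

lemma edge_obtain:
  assumes "e \<in> E" obtains u v where "e = {u, v}" "u \<noteq> v" "u \<in> V" "v \<in> V"
  using edge_card[OF assms] edge_sub[OF assms] by (auto simp: card_2_iff)

lemma shortest_walk:
  assumes "u \<in> V" "v \<in> V"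
  shows "\<exists>p. walk V E p \<and> hd p = u \<and> last p = v \<and> length p = Suc (d u v)"
proof -
  obtain p where p: "walk V E p" "hd p = u" "last p = v"
    using conn assms unfolding connected_graph_def by blast
  then have "length p = Suc (length p - 1)" by (cases p) (auto simp: walk_def)
  with p have "\<exists>l p. walk V E p \<and> hd p = u \<and> last p = v \<and> length p = Suc l" by blast
  from LeastI_ex[OF this] show ?thesis unfolding gdist_def .
qed

lemma d_le_walk: "walk V E p \<Longrightarrow> d (hd p) (last p) \<le> length p - 1"
  unfolding gdist_def by (rule Least_le) (auto simp: walk_def intro!: exI[of _ p])

lemma d_self [simp]: "u \<in> V \<Longrightarrow> d u u = 0"
  using d_le_walk[of "[u]"] by (simp add: walk_def)

lemma d_eq_0: "u \<in> V \<Longrightarrow> v \<in> V \<Longrightarrow> d u v = 0 \<longleftrightarrow> u = v"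
  using shortest_walk[of u v] by (auto simp: length_Suc_conv)

lemma d_sym_le: assumes "u \<in> V" "v \<in> V" shows "d u v \<le> d v u"
proof -
  obtain p where p: "walk V E p" "hd p = v" "last p = u" "length p = Suc (d v u)"
    using shortest_walk assms by blast
  with d_le_walk[OF walk_rev[OF p(1)]] show ?thesis
    by (cases "p = []") (auto simp: hd_rev last_rev)
qed

lemma d_sym: "u \<in> V \<Longrightarrow> v \<in> V \<Longrightarrow> d u v = d v u"
  by (simp add: d_sym_le le_antisym)

lemma d_tri: assumes "u \<in> V" "v \<in> V" "w \<in> V" shows "d u w \<le> d u v + d v w"
proof -
  obtain p where p: "walk V E p" "hd p = u" "last p = v" "length p = Suc (d u v)"
    using shortest_walk assms by blast
  obtain q where q: "walk V E q" "hd q = v" "last q = w" "length q = Suc (d v w)"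
    using shortest_walk assms by blast
  have "hd (p @ tl q) = u" "last (p @ tl q) = w"
    using p q by (auto simp: length_Suc_conv split: if_splits)
  with d_le_walk[OF walk_append[OF p(1) q(1)]] p q show ?thesis by simp
qed

lemma d_edge: assumes "{u, v} \<in> E" shows "d u v = 1"
proof -
  have "u \<noteq> v" "u \<in> V" "v \<in> V" using edgeD[OF assms] by auto
  moreover from this have "d u v \<le> 1" using d_le_walk[of "[u, v]"] assms by (simp add: walk_def)
  ultimately show ?thesis using d_eq_0[of u v] by linarith
qed

text \<open>The last vertex before \<open>v\<close> on a shortest walk. This one-step descent drives
  the edge count, the paths in the metric graph, the relaxation rounds and the output of
  paths.\<close>

lemma d_pred:
  assumes "u \<in> V" "v \<in> V" "d u v = Suc l"
  obtains w where "{w, v} \<in> E" "w \<in> V" "d u w = l"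
proof -
  obtain p where p: "walk V E p" "hd p = u" "last p = v" "length p = Suc (Suc l)"
    using shortest_walk assms by metis
  define w where "w = p ! l"
  have v: "v = p ! Suc l" using p by (metis last_conv_nth length_0_conv nat.distinct(1) diff_Suc_1)
  have e: "{w, v} \<in> E" using p v unfolding walk_def w_def successively_conv_nth by auto
  then have w: "w \<in> V" using edgeD by auto
  have "hd (take (Suc l) p) = u" using p by (cases p) auto
  moreover have "last (take (Suc l) p) = w" using p by (simp add: w_def take_Suc_conv_app_nth)
  ultimately have "d u w \<le> l" using d_le_walk[OF walk_take[OF p(1), of "Suc l"]] p by simp
  moreover have "Suc l \<le> d u w + 1" using d_tri[of u w v] assms w d_edge[OF e] by simp
  ultimately show ?thesis using that e w by simp
qed

lemma d_one_edge: assumes "u \<in> V" "v \<in> V" "d u v = 1" shows "{u, v} \<in> E"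
proof -
  obtain w where "{w, v} \<in> E" "w \<in> V" "d u w = 0" using d_pred[of u v 0] assms by auto
  then show ?thesis using d_eq_0 assms by auto
qed

lemma isometric_sub:
  assumes "isometric_path V E p"
  shows "p \<noteq> []" "set p \<subseteq> V" "hd p \<in> V" "last p \<in> V"
  using assms unfolding isometric_path_def walk_def by auto

text \<open>Subwalks bound each of the three pieces of the path from above; by the triangle
  inequality the pieces add up to at least the whole length, so the bound for the middle piece is
  attained.\<close>

lemma isometric_nth_le:
  assumes p: "isometric_path V E p" and ij: "i \<le> j" "j < length p"
  shows "d (p ! i) (p ! j) = j - i"
proof -
  have w: "walk V E p" and len: "length p = Suc (d (hd p) (last p))"
    using p unfolding isometric_path_def by auto
  have up: "d (p ! i) (p ! j) \<le> j - i" if "i \<le> j" "j < length p" for i j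
  proof -
    have "hd (drop i (take (Suc j) p)) = p ! i" "last (drop i (take (Suc j) p)) = p ! j"
      using that by (auto simp: hd_drop_conv_nth) (simp add: take_Suc_conv_app_nth)
    with d_le_walk[OF walk_sub[OF w that]] that show ?thesis by simp
  qed
  have V: "p ! i \<in> V" if "i < length p" for i using isometric_sub[OF p] that by auto
  have hl: "hd p = p ! 0" "last p = p ! (length p - 1)"
    using isometric_sub(1)[OF p] by (auto simp: hd_conv_nth last_conv_nth)
  have l: "length p - 1 < length p" "0 < length p" using ij by auto
  have "length p - 1 \<le> d (p!0) (p!i) + d (p!i) (p!j) + d (p!j) (p!(length p - 1))"
    using len hl d_tri[of "p!0" "p!i" "p!j"] d_tri[of "p!0" "p!j" "p!(length p - 1)"] V ij l
    by (smt (verit) add_mono_thms_linordered_semiring(3) diff_Suc_1 le_trans linorder_not_less order_le_less_trans)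
  moreover have "d (p!0) (p!i) \<le> i" using up[of 0 i] ij by simp
  moreover have "d (p!j) (p!(length p - 1)) \<le> length p - 1 - j" using up[of j "length p - 1"] ij by simp
  ultimately have "j - i \<le> d (p!i) (p!j)" using ij by linarith
  with up[OF ij] show ?thesis by simp
qed

lemma isometric_nth:
  assumes p: "isometric_path V E p" and "i < length p" "j < length p"
  shows "real (d (p ! i) (p ! j)) = \<bar>real i - real j\<bar>"
proof (cases "i \<le> j")
  case True
  then show ?thesis using isometric_nth_le[OF p True assms(3)] by simp
next
  case False
  have "p ! i \<in> V" "p ! j \<in> V" using isometric_sub[OF p] assms by auto
  then show ?thesis using isometric_nth_le[OF p _ assms(2), of j] False d_sym by simp
qed

lemma isometric_distinct: assumes "isometric_path V E p" shows "distinct p"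
proof -
  have "p ! i \<noteq> p ! j" if "i < length p" "j < length p" "i \<noteq> j" for i j
  proof
    assume "p ! i = p ! j"
    moreover have "p ! i \<in> V" using isometric_sub[OF assms] that by auto
    ultimately show False using isometric_nth[OF assms that(1,2)] that by simp
  qed
  then show ?thesis by (simp add: distinct_conv_nth)
qed

lemma isometric_between:
  assumes p: "isometric_path V E p" and u: "u \<in> set p"
  shows "d (hd p) u + d u (last p) = d (hd p) (last p)"
proof -
  obtain i where i: "u = p ! i" "i < length p" using u by (metis in_set_conv_nth)
  have hl: "hd p = p ! 0" "last p = p ! (length p - 1)"
    using isometric_sub(1)[OF p] by (auto simp: hd_conv_nth last_conv_nth)
  show ?thesis
    using isometric_nth_le[OF p, of 0 i] isometric_nth_le[OF p, of i "length p - 1"]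
      isometric_nth_le[OF p, of 0 "length p - 1"] i hl by simp
qed

lemma ex_isometric:
  assumes "u \<in> V" "v \<in> V"
  obtains p where "isometric_path V E p" "hd p = u" "last p = v" "length p = Suc (d u v)"
  using shortest_walk[OF assms] unfolding isometric_path_def by auto

lemma d_less_card: assumes "u \<in> V" "v \<in> V" shows "d u v < card V"
proof -
  obtain p where p: "isometric_path V E p" "length p = Suc (d u v)"
    using ex_isometric[OF assms] by metis
  then have "Suc (d u v) = card (set p)" using isometric_distinct distinct_card by metis
  also have "\<dots> \<le> card V" using isometric_sub(2)[OF p(1)] finV by (intro card_mono)
  finally show ?thesis by simp
qed

text \<open>The ends are the only two vertices of the path at maximal distance.\<close>
lemma isometric_set_ends:
  assumes p: "isometric_path V E p" and q: "isometric_path V E q" and eq: "set p = set q"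
  shows "{hd p, last p} = {hd q, last q}"
proof -
  have len: "length p = length q"
    using isometric_distinct[OF p] isometric_distinct[OF q] eq by (metis distinct_card)
  have hlp: "hd p = p ! 0" "last p = p ! (length p - 1)" "p \<noteq> []"
    using isometric_sub(1)[OF p] by (auto simp: hd_conv_nth last_conv_nth)
  have hlq: "hd q = q ! 0" "last q = q ! (length q - 1)" "q \<noteq> []"
    using isometric_sub(1)[OF q] by (auto simp: hd_conv_nth last_conv_nth)
  obtain i j where ij: "hd p = q ! i" "last p = q ! j" "i < length q" "j < length q"
    using hlp eq by (metis hd_in_set last_in_set in_set_conv_nth)
  have "real (length q - 1) = \<bar>real i - real j\<bar>"
    using isometric_nth[OF q ij(3,4)] isometric_nth[OF p, of 0 "length p - 1"] ij hlp len
    by (cases p) auto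
  then have "i = 0 \<and> j = length q - 1 \<or> j = 0 \<and> i = length q - 1"
    using ij(3,4) by linarith
  then show ?thesis using ij hlq by auto
qed

text \<open>Each vertex other than \<open>r\<close> selects an edge to a vertex one step closer to
  \<open>r\<close>, as in a breadth-first tree, and different vertices select different
  edges.\<close>

lemma card_E_ge: "card V \<le> Suc (card E)"
proof -
  obtain r where r: "r \<in> V" using V_ne by auto
  have "\<exists>w. {w, v} \<in> E \<and> Suc (d r w) = d r v" if v: "v \<in> V - {r}" for v
  proof -
    obtain l where l: "d r v = Suc l" using d_eq_0[of r v] r v by (cases "d r v") auto
    then show ?thesis using d_pred[of r v l] r v by force
  qed
  then obtain w where w: "\<And>v. v \<in> V - {r} \<Longrightarrow> {w v, v} \<in> E \<and> Suc (d r (w v)) = d r v" by metis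
  have inj: "inj_on (\<lambda>v. {w v, v}) (V - {r})"
  proof (rule inj_onI)
    fix x y assume xy: "x \<in> V - {r}" "y \<in> V - {r}" "{w x, x} = {w y, y}"
    show "x = y"
    proof (rule ccontr)
      assume "x \<noteq> y"
      \<comment> \<open>Two vertices that select the same edge would each be strictly closer to
        \<open>r\<close> than the other.\<close>
      with xy(3) have "w x = y" "w y = x" by (auto simp: doubleton_eq_iff)
      with w[OF xy(1)] w[OF xy(2)] show False by simp
    qed
  qed
  have "finite E" using finV edge_sub by (meson Pow_iff finite_Pow_iff finite_subset subsetI)
  then have "card (V - {r}) \<le> card E" using inj w by (intro card_inj_on_le) auto
  then show ?thesis using r finV by simp
qed

lemma card_E_le: "card E \<le> card V * card V"
proof -
  have "E \<subseteq> (\<lambda>(u, v). {u, v}) ` (V \<times> V)" by (auto elim!: edge_obtain)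
  then have "card E \<le> card ((\<lambda>(u, v). {u, v}) ` (V \<times> V))" using finV by (intro card_mono) auto
  also have "\<dots> \<le> card (V \<times> V)" using finV by (intro card_image_le) auto
  finally show ?thesis by (simp add: card_cartesian_product)
qed

end

section \<open>Geodesics of the metric graph and thinness\<close>

lemma segment_dist_nonneg: "0 \<le> segment_dist V p q"
  unfolding segment_dist_def by (simp add: sum_nonneg)

lemma segment_dist_sym: "segment_dist V p q = segment_dist V q p"
  unfolding segment_dist_def by (simp add: abs_minus_commute)

definition vertex_point :: "'a \<Rightarrow> 'a \<Rightarrow> real" where
  "vertex_point v = (\<lambda>x. if x = v then 1 else 0)"

definition edge_point :: "'a \<Rightarrow> 'a \<Rightarrow> real \<Rightarrow> 'a \<Rightarrow> real" where
  "edge_point a b t = (\<lambda>x. if x = a then 1 - t else if x = b then t else 0)"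

lemma edge_point_0: "edge_point a b 0 = vertex_point a"
  by (auto simp: edge_point_def vertex_point_def)

lemma edge_point_1: "a \<noteq> b \<Longrightarrow> edge_point a b 1 = vertex_point b"
  by (auto simp: edge_point_def vertex_point_def)

lemma segment_dist_edge_point:
  assumes "finite V" "a \<in> V" "b \<in> V" "a \<noteq> b"
  shows "segment_dist V (edge_point a b s) (edge_point a b t) = \<bar>s - t\<bar>"
proof -
  have "(\<Sum>v\<in>V. \<bar>edge_point a b s v - edge_point a b t v\<bar>) = (\<Sum>v\<in>{a, b}. \<bar>edge_point a b s v - edge_point a b t v\<bar>)"
    using assms by (intro sum.mono_neutral_right) (auto simp: edge_point_def)
  then show ?thesis using assms by (auto simp: segment_dist_def edge_point_def)
qed

lemma cell_points_singleton: "q \<in> cell_points {v} \<Longrightarrow> q = vertex_point v"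
  by (auto simp: cell_points_def vertex_point_def)

lemma cell_points_edge:
  assumes "q \<in> cell_points {a, b}" "a \<noteq> b"
  shows "q = edge_point a b (q b)" "0 \<le> q b" "q b \<le> 1"
proof -
  have q: "q a + q b = 1" "0 \<le> q a" "0 \<le> q b" "\<And>v. v \<noteq> a \<Longrightarrow> v \<noteq> b \<Longrightarrow> q v = 0"
    using assms by (auto simp: cell_points_def)
  then show "q = edge_point a b (q b)" by (auto simp: edge_point_def fun_eq_iff)
  show "0 \<le> q b" "q b \<le> 1" using q by auto
qed

lemma edge_point_cell: "a \<noteq> b \<Longrightarrow> 0 \<le> t \<Longrightarrow> t \<le> 1 \<Longrightarrow> edge_point a b t \<in> cell_points {a, b}"
  by (auto simp: cell_points_def edge_point_def)

section \<open>The length metric of piecewise linear paths\<close>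

lemma pl_path_nonneg: "pl_path V E p q l \<Longrightarrow> 0 \<le> l"
  by (induction rule: pl_path.induct) (auto intro: add_nonneg_nonneg segment_dist_nonneg)

lemma pl_path_trans: "pl_path V E q r l' \<Longrightarrow> pl_path V E p q l \<Longrightarrow> pl_path V E p r (l + l')"
proof (induction rule: pl_path.induct)
  case (pl_step q q' l' e r)
  then show ?case using pl_path.pl_step[of V E p q' "l + l'" e r] by (simp add: add.assoc)
qed simp

lemma pl_path_single:
  assumes "e \<in> cells V E" "p \<in> cell_points e" "q \<in> cell_points e"
  shows "pl_path V E p q (segment_dist V p q)"
  using pl_step[OF pl_refl assms] assms by (auto simp: metric_graph_def)

lemma pl_path_sym: "pl_path V E p q l \<Longrightarrow> pl_path V E q p l"
proof (induction rule: pl_path.induct)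
  case (pl_step p q l e r)
  have "pl_path V E r q (segment_dist V q r)"
    using pl_path_single[of e V E r q] pl_step by (simp add: segment_dist_sym)
  from pl_path_trans[OF pl_step.IH this] show ?case by (simp add: add.commute)
qed (rule pl_refl)

lemma mdist_le: "pl_path V E p q l \<Longrightarrow> mdist V E p q \<le> l"
  unfolding mdist_def by (rule cInf_lower) (auto intro: bdd_belowI pl_path_nonneg)

text \<open>The first premise excludes the infimum of the empty set, about which nothing is
  known.\<close>

lemma mdist_ge:
  assumes "pl_path V E p q l" "\<And>l. pl_path V E p q l \<Longrightarrow> c \<le> l"
  shows "c \<le> mdist V E p q"
  unfolding mdist_def by (rule cInf_greatest) (use assms in auto)

lemma mdist_sym: "mdist V E p q = mdist V E q p"
proof -
  have "pl_path V E p q = pl_path V E q p" by (intro ext iffI) (rule pl_path_sym, assumption)+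
  then show ?thesis unfolding mdist_def by simp
qed

lemma mdist_self: "p \<in> metric_graph V E \<Longrightarrow> mdist V E p p = 0"
  using mdist_le[OF pl_refl] mdist_ge[OF pl_refl] pl_path_nonneg by (metis antisym)

text \<open>The parametrisation by arc length. At the last vertex the index
  \<open>Suc (nat \<lfloor>s\<rfloor>)\<close> is out of range, but that entry then has weight
  0.\<close>

definition path_point :: "'a list \<Rightarrow> real \<Rightarrow> 'a \<Rightarrow> real" where
  "path_point p s = edge_point (p ! nat \<lfloor>s\<rfloor>) (p ! Suc (nat \<lfloor>s\<rfloor>)) (s - real (nat \<lfloor>s\<rfloor>))"

lemma path_point_nat: "path_point p (real i) = vertex_point (p ! i)"
  unfolding path_point_def by (simp add: edge_point_0)

text \<open>At the right end of the edge the floor already belongs to the next edge; both formulas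
  give the common vertex.\<close>

lemma path_point_edge:
  assumes "real i \<le> s" "s \<le> real (Suc i)" "p ! i \<noteq> p ! Suc i"
  shows "path_point p s = edge_point (p ! i) (p ! Suc i) (s - real i)"
proof (cases "s = real (Suc i)")
  case True
  then show ?thesis using path_point_nat[of p "Suc i"] assms(3) by (simp add: edge_point_1)
next
  case False
  then have "\<lfloor>s\<rfloor> = int i" using assms by (simp add: floor_eq_iff)
  then show ?thesis by (simp add: path_point_def)
qed

context conn_graph begin

abbreviation M :: "('a \<Rightarrow> real) set" where "M \<equiv> metric_graph V E"
abbreviation md :: "('a \<Rightarrow> real) \<Rightarrow> ('a \<Rightarrow> real) \<Rightarrow> real" where "md \<equiv> mdist V E"

lemma vertex_point_in: "v \<in> e \<Longrightarrow> e \<in> cells V E \<Longrightarrow> vertex_point v \<in> cell_points e"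
proof -
  assume e: "v \<in> e" "e \<in> cells V E"
  then have "finite e" unfolding cells_def using edge_sub finV by (auto dest: finite_subset)
  then have "(\<Sum>x\<in>e. vertex_point v x) = 1" using e by (simp add: vertex_point_def)
  then show ?thesis using e by (auto simp: cell_points_def vertex_point_def)
qed

lemma vertex_point_M: "v \<in> V \<Longrightarrow> vertex_point v \<in> M"
  unfolding metric_graph_def using vertex_point_in[of v "{v}"] by (auto simp: cells_def)

lemma cell_dist_le_1:
  assumes "e \<in> cells V E" "p \<in> cell_points e" "q \<in> cell_points e"
  shows "segment_dist V p q \<le> 1"
proof -
  have e: "e \<subseteq> V" using assms(1) edge_sub unfolding cells_def by auto
  have "(\<Sum>v\<in>V. \<bar>p v - q v\<bar>) = (\<Sum>v\<in>e. \<bar>p v - q v\<bar>)"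
    using assms e finV by (intro sum.mono_neutral_right) (auto simp: cell_points_def)
  also have "\<dots> \<le> (\<Sum>v\<in>e. p v + q v)"
    using assms by (intro sum_mono) (auto simp: cell_points_def abs_if)
  also have "\<dots> = 2" using assms by (simp add: cell_points_def sum.distrib)
  finally show ?thesis by (simp add: segment_dist_def)
qed

lemma pl_path_to_vertex:
  assumes "p \<in> M" shows "\<exists>v\<in>V. \<exists>l\<le>1. pl_path V E p (vertex_point v) l"
proof -
  obtain e where e: "e \<in> cells V E" "p \<in> cell_points e" using assms by (auto simp: metric_graph_def)
  then have "e \<noteq> {}" "e \<subseteq> V" using edge_sub by (auto simp: cells_def cell_points_def)
  then obtain v where "v \<in> e" "v \<in> V" by auto
  then show ?thesis
    using pl_path_single[OF e vertex_point_in] cell_dist_le_1[OF e vertex_point_in] e by blast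
qed

lemma pl_path_vertices:
  assumes "u \<in> V" "v \<in> V" shows "pl_path V E (vertex_point u) (vertex_point v) (d u v)"
  using assms(2)
proof (induction "d u v" arbitrary: v)
  case 0
  then show ?case using d_eq_0[of u v] assms pl_refl[OF vertex_point_M[of v]] by simp
next
  case (Suc l)
  obtain w where w: "{w, v} \<in> E" "w \<in> V" "d u w = l" using d_pred[of u v l] assms Suc by metis
  have "w \<noteq> v" using edgeD[OF w(1)] by simp
  then have "segment_dist V (vertex_point w) (vertex_point v) = 1"
    using segment_dist_edge_point[OF finV w(2) Suc.prems, of 0 1] by (simp add: edge_point_0 edge_point_1)
  moreover have "{w, v} \<in> cells V E" using w by (simp add: cells_def)
  ultimately have "pl_path V E (vertex_point u) (vertex_point v) (real l + 1)"
    using pl_step[of V E "vertex_point u" "vertex_point w" l "{w, v}" "vertex_point v"] w Suc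
      vertex_point_in[of _ "{w, v}"] by auto
  moreover have "real (d u v) = real l + 1" using Suc(2) by linarith
  ultimately show ?case by simp
qed

text \<open>At most one unit at either end to reach a vertex, and a shortest path in between. The
  uniform bound is what makes \<open>thinness\<close> well defined.\<close>

lemma pl_path_ex:
  assumes "p \<in> M" "q \<in> M" shows "\<exists>l \<le> real (card V + 2). pl_path V E p q l"
proof -
  obtain u l where u: "u \<in> V" "l \<le> 1" "pl_path V E p (vertex_point u) l" using pl_path_to_vertex[OF assms(1)] by auto
  obtain v l' where v: "v \<in> V" "l' \<le> 1" "pl_path V E q (vertex_point v) l'" using pl_path_to_vertex[OF assms(2)] by auto
  have "pl_path V E p q (l + (d u v + l'))"
    using pl_path_trans[OF pl_path_trans[OF pl_path_sym[OF v(3)] pl_path_vertices[OF u(1) v(1)]] u(3)] .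
  moreover have "real (d u v) \<le> card V" using d_less_card[OF u(1) v(1)] by simp
  ultimately show ?thesis using u v by (intro exI[of _ "l + (d u v + l')"]) auto
qed

lemma mdist_bound: "p \<in> M \<Longrightarrow> q \<in> M \<Longrightarrow> md p q \<le> real (card V + 2)"
  using pl_path_ex mdist_le by fastforce

lemma mdist_nonneg: "p \<in> M \<Longrightarrow> q \<in> M \<Longrightarrow> 0 \<le> md p q"
  using pl_path_ex[of p q] mdist_ge pl_path_nonneg by metis

lemma mdist_tri:
  assumes "p \<in> M" "q \<in> M" "r \<in> M" shows "md p r \<le> md p q + md q r"
proof -
  obtain l1 l2 where l: "pl_path V E p q l1" "pl_path V E q r l2" using pl_path_ex assms by meson
  have "md p r - l1' \<le> md q r" if "pl_path V E p q l1'" for l1'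
  proof (rule mdist_ge[OF l(2)])
    fix l2' assume "pl_path V E q r l2'"
    then show "md p r - l1' \<le> l2'" using mdist_le[OF pl_path_trans[OF _ that]] by fastforce
  qed
  then have "md p r - md q r \<le> md p q" by (intro mdist_ge[OF l(1)]) (auto simp: algebra_simps)
  then show ?thesis by simp
qed

text \<open>The distance from \<open>u\<close>, extended linearly to the edges: it is 1-Lipschitz, and it grows at
  unit speed along an isometric path that starts in \<open>u\<close>.\<close>
definition lin_dist :: "'a \<Rightarrow> ('a \<Rightarrow> real) \<Rightarrow> real" where
  "lin_dist u p = (\<Sum>v\<in>V. p v * real (d u v))"

lemma lin_dist_edge_point:
  assumes "a \<in> V" "b \<in> V" "a \<noteq> b"
  shows "lin_dist u (edge_point a b t) = (1 - t) * d u a + t * d u b"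
proof -
  have "lin_dist u (edge_point a b t) = (\<Sum>v\<in>{a, b}. edge_point a b t v * real (d u v))"
    unfolding lin_dist_def using assms finV by (intro sum.mono_neutral_right) (auto simp: edge_point_def)
  then show ?thesis using assms by (auto simp: edge_point_def)
qed

lemma lin_dist_vertex_point: "a \<in> V \<Longrightarrow> lin_dist u (vertex_point a) = d u a"
  unfolding lin_dist_def vertex_point_def using finV
  by (simp add: if_distrib[of "\<lambda>x. x * _"] cong: if_cong)

text \<open>The distances from \<open>u\<close> to the two ends of an edge differ by at most 1, so
  the linear interpolation has slope at most 1.\<close>

lemma lin_dist_cell:
  assumes e: "e \<in> cells V E" and q: "q \<in> cell_points e" "r \<in> cell_points e" and u: "u \<in> V"
  shows "\<bar>lin_dist u q - lin_dist u r\<bar> \<le> segment_dist V q r"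
proof -
  consider (vertex) v where "e = {v}" | (edge) "e \<in> E" using e by (auto simp: cells_def)
  then show ?thesis
  proof cases
    case vertex
    then have "q = r" using q cell_points_singleton by metis
    then show ?thesis by (simp add: segment_dist_nonneg)
  next
    case edge
    then obtain a b where ab: "e = {a, b}" "a \<noteq> b" "a \<in> V" "b \<in> V" by (rule edge_obtain)
    define s t where "s = q b" and "t = r b"
    have q': "q = edge_point a b s" and r': "r = edge_point a b t"
      using cell_points_edge q ab unfolding s_def t_def by metis+
    have "d a b = 1" using d_edge edge ab by simp
    then have "\<bar>real (d u b) - real (d u a)\<bar> \<le> 1"
      using d_tri[of u a b] d_tri[of u b a] d_sym[of a b] ab u by linarith
    then have "\<bar>s - t\<bar> * \<bar>real (d u b) - real (d u a)\<bar> \<le> \<bar>s - t\<bar> * 1" by (intro mult_left_mono) auto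
    moreover have "lin_dist u q - lin_dist u r = (s - t) * (real (d u b) - real (d u a))"
      unfolding q' r' lin_dist_edge_point[OF ab(3,4,2)] by (simp add: algebra_simps)
    ultimately show ?thesis
      unfolding q' r' segment_dist_edge_point[OF finV ab(3,4,2)] by (simp add: abs_mult)
  qed
qed

lemma lin_dist_pl_path: "pl_path V E p q l \<Longrightarrow> u \<in> V \<Longrightarrow> \<bar>lin_dist u p - lin_dist u q\<bar> \<le> l"
proof (induction rule: pl_path.induct)
  case (pl_step p q l e r)
  then show ?case using lin_dist_cell[of e q r u] by simp
qed simp

lemma lin_dist_mdist: "p \<in> M \<Longrightarrow> q \<in> M \<Longrightarrow> u \<in> V \<Longrightarrow> \<bar>lin_dist u p - lin_dist u q\<bar> \<le> md p q"
  using pl_path_ex[of p q] mdist_ge lin_dist_pl_path by metis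

text \<open>The lower bound comes from the 1-Lipschitz function \<open>lin_dist u\<close>: no
  piecewise linear path through interiors of edges is shorter than the graph distance.\<close>

lemma mdist_vertex_point: assumes "u \<in> V" "v \<in> V" shows "md (vertex_point u) (vertex_point v) = d u v"
  using mdist_le[OF pl_path_vertices[OF assms]] lin_dist_mdist[of "vertex_point u" "vertex_point v" u] assms
  by (simp add: vertex_point_M lin_dist_vertex_point)

lemma path_edge:
  assumes "isometric_path V E p" "Suc i < length p"
  shows "{p ! i, p ! Suc i} \<in> E"
  using assms unfolding isometric_path_def walk_def successively_conv_nth by auto

lemma path_point_M:
  assumes p: "isometric_path V E p" and s: "0 \<le> s" "s \<le> real (length p - 1)"
  shows "path_point p s \<in> M"
proof (cases "s = real (length p - 1)")
  case True
  have "p ! (length p - 1) \<in> V" using isometric_sub[OF p] by (simp add: subset_iff)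
  then show ?thesis using True vertex_point_M by (simp only: path_point_nat)
next
  case False
  then have i: "Suc (nat \<lfloor>s\<rfloor>) < length p" using s by linarith
  have "edge_point (p ! nat \<lfloor>s\<rfloor>) (p ! Suc (nat \<lfloor>s\<rfloor>)) (s - real (nat \<lfloor>s\<rfloor>)) \<in> cell_points {p ! nat \<lfloor>s\<rfloor>, p ! Suc (nat \<lfloor>s\<rfloor>)}"
    using path_edge[OF p i] edgeD s by (intro edge_point_cell) (auto, linarith)
  then show ?thesis unfolding path_point_def metric_graph_def using path_edge[OF p i] by (auto simp: cells_def)
qed

lemma path_point_same_edge:
  assumes p: "isometric_path V E p" and i: "Suc i < length p"
    and s: "real i \<le> s" "s \<le> real (Suc i)" and t: "real i \<le> t" "t \<le> real (Suc i)"
  shows "md (path_point p s) (path_point p t) \<le> \<bar>s - t\<bar>"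
proof -
  have e: "{p ! i, p ! Suc i} \<in> E" using path_edge[OF p i] .
  note e' = edgeD[OF e]
  have "pl_path V E (edge_point (p ! i) (p ! Suc i) (s - i)) (edge_point (p ! i) (p ! Suc i) (t - i))
    (segment_dist V (edge_point (p ! i) (p ! Suc i) (s - i)) (edge_point (p ! i) (p ! Suc i) (t - i)))"
    using e e' s t by (intro pl_path_single[of "{p ! i, p ! Suc i}"] edge_point_cell) (auto simp: cells_def)
  from mdist_le[OF this] show ?thesis
    using e' path_point_edge[OF s, of p] path_point_edge[OF t, of p] finV
    by (simp add: segment_dist_edge_point)
qed

lemma path_point_le:
  assumes p: "isometric_path V E p"
  shows "j < length p \<Longrightarrow> 0 \<le> s \<Longrightarrow> s \<le> t \<Longrightarrow> t \<le> real j \<Longrightarrow> md (path_point p s) (path_point p t) \<le> t - s"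
proof (induction j arbitrary: t)
  case 0
  then have "t = s" by linarith
  have "path_point p s \<in> M" using 0 by (intro path_point_M[OF p]) auto
  then show ?case unfolding \<open>t = s\<close> by (simp add: mdist_self)
next
  case (Suc j)
  consider "t \<le> j" | "j < t" "j \<le> s" | "j < t" "s < j" by linarith
  then show ?case
  proof cases
    case 1
    then show ?thesis using Suc by auto
  next
    case 2
    then show ?thesis using path_point_same_edge[OF p Suc.prems(1), of s t] Suc.prems by auto
  next
    case 3
    have "md (path_point p s) (path_point p j) \<le> j - s" using Suc 3 by auto
    moreover have "md (path_point p j) (path_point p t) \<le> t - j"
      using path_point_same_edge[OF p Suc.prems(1), of j t] Suc.prems 3 by auto
    moreover have "path_point p s \<in> M" "path_point p j \<in> M" "path_point p t \<in> M"
      using 3 Suc.prems by (auto intro!: path_point_M[OF p])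
    ultimately show ?thesis using mdist_tri by fastforce
  qed
qed

lemma lin_dist_path_point:
  assumes p: "isometric_path V E p" and s: "0 \<le> s" "s \<le> real (length p - 1)"
  shows "lin_dist (hd p) (path_point p s) = s"
proof -
  have hd: "hd p = p ! 0" using isometric_sub[OF p] by (simp add: hd_conv_nth)
  have d: "d (hd p) (p ! i) = i" if "i < length p" for i using isometric_nth_le[OF p, of 0 i] that hd by simp
  show ?thesis
  proof (cases "s = real (length p - 1)")
    case True
    have "p ! (length p - 1) \<in> V" using isometric_sub[OF p] by (simp add: subset_iff)
    then show ?thesis using True path_point_nat[of p "length p - 1"] d[of "length p - 1"] isometric_sub[OF p]
      by (simp add: lin_dist_vertex_point)
  next
    case False
    then have i: "Suc (nat \<lfloor>s\<rfloor>) < length p" using s by linarith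
    show ?thesis
      using lin_dist_edge_point[of "p ! nat \<lfloor>s\<rfloor>" "p ! Suc (nat \<lfloor>s\<rfloor>)" "hd p" "s - real (nat \<lfloor>s\<rfloor>)"]
        edgeD[OF path_edge[OF p i]] d i by (simp add: path_point_def algebra_simps)
  qed
qed

text \<open>Along the path, \<open>lin_dist (hd p)\<close> is the arc length, which gives the lower
  bound; the upper bound is obtained edge by edge.\<close>

lemma path_point_dist:
  assumes p: "isometric_path V E p"
    and s: "0 \<le> s" "s \<le> real (length p - 1)" and t: "0 \<le> t" "t \<le> real (length p - 1)"
  shows "md (path_point p s) (path_point p t) = \<bar>s - t\<bar>"
proof -
  have "\<bar>s - t\<bar> \<le> md (path_point p s) (path_point p t)"
    using lin_dist_mdist[OF path_point_M[OF p s] path_point_M[OF p t], of "hd p"] isometric_sub[OF p]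
    by (simp add: lin_dist_path_point[OF p s] lin_dist_path_point[OF p t])
  moreover have "length p - 1 < length p" using isometric_sub[OF p] by simp
  then have "md (path_point p s) (path_point p t) \<le> \<bar>s - t\<bar>"
    using path_point_le[OF p, of "length p - 1" s t] path_point_le[OF p, of "length p - 1" t s] s t
      mdist_sym[of V E "path_point p s" "path_point p t"] by (cases "s \<le> t") auto
  ultimately show ?thesis by simp
qed

lemma path_point_ends:
  assumes "isometric_path V E p"
  shows "path_point p 0 = vertex_point (hd p)"
    "path_point p (real (d (hd p) (last p))) = vertex_point (last p)"
    "length p - 1 = d (hd p) (last p)"
proof -
  have "length p = Suc (d (hd p) (last p))" using assms by (simp add: isometric_path_def)
  then have l: "d (hd p) (last p) = length p - 1" by simp
  then show "length p - 1 = d (hd p) (last p)" by simp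
  show "path_point p (real (d (hd p) (last p))) = vertex_point (last p)"
    unfolding l path_point_nat using isometric_sub[OF assms] by (simp add: last_conv_nth)
  show "path_point p 0 = vertex_point (hd p)"
    using path_point_nat[of p 0] isometric_sub[OF assms] by (simp add: hd_conv_nth)
qed

lemma geodesic_path:
  assumes p: "isometric_path V E p"
  shows "geodesic_segment M md (vertex_point (hd p)) (vertex_point (last p))
    (path_point p ` {0..real (d (hd p) (last p))})"
  unfolding geodesic_segment_def mdist_vertex_point[OF isometric_sub(3,4)[OF p]]
  using path_point_M[OF p] path_point_dist[OF p] path_point_ends[OF p]
  by (intro conjI exI[of _ "path_point p"]) auto

end

section \<open>Tripod maps and thin triangles\<close>

lemma geodesic_segmentD:
  assumes "geodesic_segment M d x y S" "0 \<le> d x y"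
  shows "S \<subseteq> M" "x \<in> S" "y \<in> S" "\<And>u. u \<in> S \<Longrightarrow> d x u + d u y = d x y"
    "\<And>u v. u \<in> S \<Longrightarrow> v \<in> S \<Longrightarrow> d u v = \<bar>d x u - d x v\<bar>"
proof -
  obtain g where g: "g 0 = x" "g (d x y) = y" "g ` {0..d x y} = S" "S \<subseteq> M"
    "\<And>s t. s \<in> {0..d x y} \<Longrightarrow> t \<in> {0..d x y} \<Longrightarrow> d (g s) (g t) = \<bar>s - t\<bar>"
    using assms unfolding geodesic_segment_def by blast
  have xg: "d x (g s) = s" if "s \<in> {0..d x y}" for s using g(5)[of 0 s] g(1) that assms by simp
  have gy: "d (g s) y = d x y - s" if "s \<in> {0..d x y}" for s using g(5)[of s "d x y"] g(2) that assms by simp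
  show "S \<subseteq> M" by fact
  show "x \<in> S" "y \<in> S" using g assms(2) by (metis image_eqI atLeastAtMost_iff order_refl)+
  show "d x u + d u y = d x y" if "u \<in> S" for u using that g(3) xg gy by fastforce
  show "d u v = \<bar>d x u - d x v\<bar>" if "u \<in> S" "v \<in> S" for u v
    using that g(3) g(5) xg by (metis imageE)
qed

text \<open>\<open>thin_triangle\<close> asks for a map, so even a trivial bound on all distances
  yields thinness only once a tripod map has been constructed.\<close>

lemma tripod_map_ex:
  assumes d: "\<And>p. p \<in> M \<Longrightarrow> d p p = 0" "\<And>p q. p \<in> M \<Longrightarrow> q \<in> M \<Longrightarrow> d p q = d q p"
      "\<And>p q r. p \<in> M \<Longrightarrow> q \<in> M \<Longrightarrow> r \<in> M \<Longrightarrow> d p r \<le> d p q + d q r"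
      "\<And>p q. p \<in> M \<Longrightarrow> q \<in> M \<Longrightarrow> 0 \<le> d p q"
    and xyz: "x \<in> M" "y \<in> M" "z \<in> M"
    and geo: "geodesic_segment M d x y A" "geodesic_segment M d y z B" "geodesic_segment M d x z C"
  shows "\<exists>f. tripod_map d x y z A B C f"
proof -
  define ax ay az where "ax = gromov_product d y z x" and "ay = gromov_product d x z y"
    and "az = gromov_product d x y z"
  \<comment> \<open>Each coordinate is the part of a leg that remains from \<open>u\<close> to the
    centre, cut off at 0 once \<open>u\<close> is beyond the centre.\<close>
  define f where "f u = (max 0 (ax - d x u), max 0 (ay - d y u), max 0 (az - d z u))" for u
  have sums: "d x y = ax + ay" "d y z = ay + az" "d x z = ax + az"
    and sums': "d y x = ax + ay" "d z y = ay + az" "d z x = ax + az"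
    using d(2) xyz unfolding ax_def ay_def az_def gromov_product_def by (auto simp: field_simps)
  have pos: "0 \<le> ax" "0 \<le> ay" "0 \<le> az"
    using d(3)[of y x z] d(3)[of x y z] d(3)[of x z y] d(2) xyz sums sums' by fastforce+
  note A = geodesic_segmentD[OF geo(1) d(4)[OF xyz(1,2)]]
  note B = geodesic_segmentD[OF geo(2) d(4)[OF xyz(2,3)]]
  note C = geodesic_segmentD[OF geo(3) d(4)[OF xyz(1,3)]]
  have tri: "ax + ay \<le> d x u + d y u" "ay + az \<le> d y u + d z u" "ax + az \<le> d x u + d z u"
    and nn: "0 \<le> d x u" "0 \<le> d y u" "0 \<le> d z u" if "u \<in> M" for u
    using d(3)[of x u y] d(3)[of y u z] d(3)[of x u z] d(2)[of u y] d(2)[of u z] d(4) sums that xyz by auto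
  have inA: "d x u + d y u = ax + ay" "u \<in> M" if "u \<in> A" for u
    using A(1,4) d(2)[of y u] xyz that sums by auto
  have inB: "d y u + d z u = ay + az" "u \<in> M" if "u \<in> B" for u
    using B(1,4) d(2)[of z u] xyz that sums by auto
  have inC: "d x u + d z u = ax + az" "u \<in> M" if "u \<in> C" for u
    using C(1,4) d(2)[of z u] xyz that sums by auto
  \<comment> \<open>Adding the two triangle inequalities that involve \<open>z\<close> gives
    \<open>az \<le> d z u\<close> for \<open>u\<close> on the side from \<open>x\<close> to
    \<open>y\<close>, so the third coordinate vanishes there. The other two sides are
    symmetric.\<close>
  have fA: "f u = (max 0 (ax - d x u), max 0 (d x u - ax), 0)" "d x u \<le> ax + ay" if "u \<in> A" for u
    using inA[OF that] tri[of u] nn[of u] unfolding f_def by (auto simp: max_def)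
  have fB: "f u = (0, max 0 (ay - d y u), max 0 (d y u - ay))" "d y u \<le> ay + az" if "u \<in> B" for u
    using inB[OF that] tri[of u] nn[of u] unfolding f_def by (auto simp: max_def)
  have fC: "f u = (max 0 (ax - d x u), 0, max 0 (d x u - ax))" "d x u \<le> ax + az" if "u \<in> C" for u
    using inC[OF that] tri[of u] nn[of u] unfolding f_def by (auto simp: max_def)
  have "f u \<in> tripod ax ay az" if u: "u \<in> A \<union> B \<union> C" for u
  proof -
    have "u \<in> M" using u A(1) B(1) C(1) by auto
    note nn[OF this]
    moreover have "(r, 0, 0) \<in> tripod ax ay az" if "0 \<le> r" "r \<le> ax" for r using that by (auto simp: tripod_def)
    moreover have "(0, r, 0) \<in> tripod ax ay az" if "0 \<le> r" "r \<le> ay" for r using that by (auto simp: tripod_def)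
    moreover have "(0, 0, r) \<in> tripod ax ay az" if "0 \<le> r" "r \<le> az" for r using that by (auto simp: tripod_def)
    ultimately show ?thesis using u pos fA[of u] fB[of u] fC[of u]
      by (cases "d x u \<le> ax"; cases "d y u \<le> ay") (auto simp: max_def split: if_splits)
  qed
  moreover have "f x = (ax, 0, 0)" "f y = (0, ay, 0)" "f z = (0, 0, az)"
    using sums sums' pos d(1) xyz by (auto simp: f_def)
  moreover have "tripod_dist (f u) (f v) = d u v" if "u \<in> A" "v \<in> A" for u v
    using fA[of u] fA[of v] A(5) that by (auto simp: max_def)
  moreover have "tripod_dist (f u) (f v) = d u v" if "u \<in> B" "v \<in> B" for u v
    using fB[of u] fB[of v] B(5) that by (auto simp: max_def)
  moreover have "tripod_dist (f u) (f v) = d u v" if "u \<in> C" "v \<in> C" for u v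
    using fC[of u] fC[of v] C(5) that by (auto simp: max_def)
  ultimately have "tripod_map d x y z A B C f"
    unfolding tripod_map_def Let_def ax_def[symmetric] ay_def[symmetric] az_def[symmetric] by blast
  then show ?thesis by blast
qed

text \<open>Whichever map witnesses thinness, it sends both points to the point of the leg of
  \<open>x\<close> at distance \<open>m\<close> from its leaf: a point of another leg is farther
  from that leaf than the whole leg of \<open>x\<close>, unless it is the centre.\<close>

lemma thin_triangle_pair:
  assumes thin: "thin_triangle d x y z A B C \<delta>"
    and u: "u \<in> A" "d u x = m" and v: "v \<in> C" "d v x = m" and x: "x \<in> A" "x \<in> C"
    and m: "m \<le> gromov_product d y z x"
  shows "d u v \<le> \<delta>"
proof -
  define ax where "ax = gromov_product d y z x"
  obtain f where f: "tripod_map d x y z A B C f"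
    and le: "\<forall>u\<in>A \<union> B \<union> C. \<forall>v\<in>A \<union> B \<union> C. f u = f v \<longrightarrow> d u v \<le> \<delta>"
    using thin unfolding thin_triangle_def by blast
  have fx: "f x = (ax, 0, 0)" and S: "\<And>S u v. S \<in> {A, B, C} \<Longrightarrow> u \<in> S \<Longrightarrow> v \<in> S \<Longrightarrow> tripod_dist (f u) (f v) = d u v"
    and tr: "f ` (A \<union> B \<union> C) \<subseteq> tripod ax (gromov_product d x z y) (gromov_product d x y z)"
    using f unfolding tripod_map_def Let_def ax_def by blast+
  have leg: "f w = (ax - m, 0, 0)" if "f w \<in> tripod ax b c" "tripod_dist (f w) (f x) = m" for w b c
    using that m unfolding fx tripod_def ax_def[symmetric] by (auto simp: abs_if split: if_splits)
  have "f u = (ax - m, 0, 0)" "f v = (ax - m, 0, 0)"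
  proof -
    have "f u \<in> tripod ax (gromov_product d x z y) (gromov_product d x y z)"
      "f v \<in> tripod ax (gromov_product d x z y) (gromov_product d x y z)" using tr u v by auto
    note leg[OF this(1)] leg[OF this(2)]
    moreover have "tripod_dist (f u) (f x) = m" "tripod_dist (f v) (f x) = m" using S[of A u x] S[of C v x] u v x by auto
    ultimately show "f u = (ax - m, 0, 0)" "f v = (ax - m, 0, 0)" by simp_all
  qed
  then show ?thesis using le u v by simp
qed

context conn_graph begin

abbreviation \<tau> :: nat where "\<tau> \<equiv> thinness V E"

text \<open>The metric graph is bounded, so some natural number is a thinness constant and the least
  one is attained.\<close>

lemma thin_space_thinness: "thin_space M md (real \<tau>)"
proof -
  have "thin_space M md (real (card V + 2))"
    unfolding thin_space_def
  proof (intro ballI allI impI, elim conjE)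
    fix x y z A B C assume xyz: "x \<in> M" "y \<in> M" "z \<in> M"
      and geo: "geodesic_segment M md x y A" "geodesic_segment M md y z B" "geodesic_segment M md x z C"
    have "\<exists>f. tripod_map md x y z A B C f"
      by (rule tripod_map_ex[OF mdist_self mdist_sym mdist_tri mdist_nonneg xyz geo])
    then obtain f where "tripod_map md x y z A B C f" ..
    moreover have "A \<union> B \<union> C \<subseteq> M" using geo unfolding geodesic_segment_def by auto
    ultimately show "thin_triangle md x y z A B C (real (card V + 2))"
      unfolding thin_triangle_def by (meson mdist_bound subsetD)
  qed
  then show ?thesis unfolding thinness_def by (rule LeastI)
qed

text \<open>The last assumption says that \<open>m\<close> is at most the Gromov product of
  \<open>a\<close> and \<open>b\<close> at \<open>w\<close>; up to this time the two sides run along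
  the same leg of the tripod.\<close>

lemma thin_paths:
  assumes p: "isometric_path V E p" "hd p = w" "last p = a"
    and q: "isometric_path V E q" "hd q = w" "last q = b"
    and m: "0 \<le> m" "2 * m \<le> real (d w a) + real (d w b) - real (d a b)"
  shows "md (path_point p m) (path_point q m) \<le> \<tau>"
proof -
  have V: "w \<in> V" "a \<in> V" "b \<in> V" using isometric_sub p q by auto
  have ma: "m \<le> d w a" "m \<le> d w b" using m(2) d_tri[of w b a] d_tri[of w a b] d_sym[of a b] V by linarith+
  obtain r where r: "isometric_path V E r" "hd r = a" "last r = b" using ex_isometric[OF V(2,3)] by metis
  let ?A = "path_point p ` {0..real (d w a)}" and ?C = "path_point q ` {0..real (d w b)}"
  note gp = geodesic_path[OF p(1), unfolded p(2,3)] and gq = geodesic_path[OF q(1), unfolded q(2,3)]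
  note lp = path_point_ends[OF p(1), unfolded p(2,3)] and lq = path_point_ends[OF q(1), unfolded q(2,3)]
  have "thin_triangle md (vertex_point w) (vertex_point a) (vertex_point b) ?A (path_point r ` {0..real (d a b)}) ?C \<tau>"
    using thin_space_thinness[unfolded thin_space_def, rule_format, OF vertex_point_M vertex_point_M vertex_point_M,
        OF V conjI[OF gp conjI[OF geodesic_path[OF r(1), unfolded r(2,3)] gq]]] .
  then show ?thesis
  proof (rule thin_triangle_pair)
    show "path_point p m \<in> ?A" "path_point q m \<in> ?C" using m ma by auto
    show "vertex_point w \<in> ?A" "vertex_point w \<in> ?C" using lp lq by (auto intro!: image_eqI[of _ _ 0])
    show "md (path_point p m) (vertex_point w) = m" using path_point_dist[OF p(1), of m 0] lp m ma by simp
    show "md (path_point q m) (vertex_point w) = m" using path_point_dist[OF q(1), of m 0] lq m ma by simp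
    show "m \<le> gromov_product md (vertex_point a) (vertex_point b) (vertex_point w)"
      using m V d_sym[of a w] by (simp add: gromov_product_def mdist_vertex_point)
  qed
qed

text \<open>Walk from \<open>a\<close> towards \<open>w\<close>, jump to the geodesic from
  \<open>w\<close> to \<open>c\<close>, jump on to the one from \<open>w\<close> to
  \<open>b\<close>, and continue to \<open>b\<close>. Each jump costs \<open>\<tau>\<close>.\<close>

lemma four_point_gdist:
  assumes V: "a \<in> V" "b \<in> V" "c \<in> V" "w \<in> V"
  shows "real (d a b) + real (d c w) \<le> max (real (d a c) + real (d b w)) (real (d a w) + real (d b c)) + 2 * real \<tau>"
proof -
  obtain p where p: "isometric_path V E p" "hd p = w" "last p = a" using ex_isometric V by metis
  obtain q where q: "isometric_path V E q" "hd q = w" "last q = c" using ex_isometric V by metis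
  obtain r where r: "isometric_path V E r" "hd r = w" "last r = b" using ex_isometric V by metis
  \<comment> \<open>The smaller of the products \<open>(a|c)\<close> and \<open>(c|b)\<close> at
    \<open>w\<close>, so that both jumps are permitted at time \<open>m\<close>.\<close>
  define m where "m = min (real (d w a) + real (d w c) - real (d a c)) (real (d w c) + real (d w b) - real (d c b)) / 2"
  have sym: "d a w = d w a" "d b w = d w b" "d c w = d w c" "d c b = d b c" "d c a = d a c" "d b a = d a b" using d_sym V by auto
  have tri: "d a c \<le> d w a + d w c" "d b c \<le> d w b + d w c" "d w c \<le> d w a + d a c" "d w c \<le> d w b + d b c"
    "d w a \<le> d w c + d a c" "d w b \<le> d w c + d b c"
    using d_tri[of a w c] d_tri[of b w c] d_tri[of w a c] d_tri[of w b c] d_tri[of w c a] d_tri[of w c b] sym V by auto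
  have m: "0 \<le> m" "2 * m \<le> real (d w a) + real (d w c) - real (d a c)"
    "2 * m \<le> real (d w c) + real (d w b) - real (d c b)"
    unfolding m_def using tri sym by (auto simp: min_def)
  have le: "m \<le> d w a" "m \<le> d w b" "m \<le> d w c" using m tri sym by linarith+
  note lp = path_point_ends[OF p(1), unfolded p(2,3)] and lq = path_point_ends[OF q(1), unfolded q(2,3)]
    and lr = path_point_ends[OF r(1), unfolded r(2,3)]
  have "md (path_point p m) (path_point q m) \<le> \<tau>" using thin_paths[OF p q m(1,2)] .
  moreover have "md (path_point q m) (path_point r m) \<le> \<tau>" using thin_paths[OF q r m(1,3)] .
  moreover have "md (vertex_point a) (path_point p m) = d w a - m"
    using path_point_dist[OF p(1), of "d w a" m] lp m le by simp
  moreover have "md (path_point r m) (vertex_point b) = d w b - m"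
    using path_point_dist[OF r(1), of m "d w b"] lr m le by simp
  moreover have "vertex_point a \<in> M" "path_point p m \<in> M" "path_point q m \<in> M" "path_point r m \<in> M" "vertex_point b \<in> M"
    using vertex_point_M V path_point_M p q r lp lq lr m le by auto
  ultimately have "md (vertex_point a) (vertex_point b) \<le> (d w a - m) + \<tau> + \<tau> + (d w b - m)"
    using mdist_tri[of "vertex_point a" "path_point p m" "vertex_point b"]
      mdist_tri[of "path_point p m" "path_point q m" "vertex_point b"]
      mdist_tri[of "path_point q m" "path_point r m" "vertex_point b"] by linarith
  then have "real (d a b) \<le> d w a + d w b - 2 * m + 2 * \<tau>" using V by (simp add: mdist_vertex_point)
  then show ?thesis unfolding m_def sym by (auto simp: min_def max_def split: if_splits)
qed

lemma near_path:
  assumes p: "isometric_path V E p" "hd p = x" "last p = y" and v: "v \<in> V"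
  shows "\<exists>u\<in>set p. 2 * real (d v u) \<le> real (d x v) + real (d v y) - real (d x y) + 2 * real \<tau> + 2"
proof -
  have V: "x \<in> V" "y \<in> V" using isometric_sub p by auto
  obtain q where q: "isometric_path V E q" "hd q = x" "last q = v" using ex_isometric V v by metis
  \<comment> \<open>The product of \<open>y\<close> and \<open>v\<close> at \<open>x\<close>: the
    time at which the geodesics from \<open>x\<close> to \<open>y\<close> and to \<open>v\<close>
    part. The remaining length \<open>d x v - t\<close> is the product of \<open>x\<close> and
    \<open>y\<close> at \<open>v\<close>.\<close>
  define t where "t = (real (d x y) + real (d x v) - real (d y v)) / 2"
  have "d y v \<le> d x y + d x v" "d x v \<le> d x y + d y v" "d x y \<le> d x v + d y v"
    using d_tri[of y x v] d_tri[of x y v] d_tri[of x v y] d_sym[of x y] d_sym[of y v] V v by auto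
  then have t: "0 \<le> t" "t \<le> d x y" "t \<le> d x v" unfolding t_def by auto
  note lp = path_point_ends[OF p(1), unfolded p(2,3)] and lq = path_point_ends[OF q(1), unfolded q(2,3)]
  \<comment> \<open>Rounding down to a vertex of the path costs at most 1, which is the final 2 of
    the doubled bound.\<close>
  define i where "i = nat \<lfloor>t\<rfloor>"
  have i: "real i \<le> t" "t \<le> real i + 1" unfolding i_def using t(1) by linarith+
  have il: "i \<le> length p - 1" "i < length p" using i t lp isometric_sub[OF p(1)] by (linarith, cases p) auto
  have u: "p ! i \<in> set p" "p ! i \<in> V" using il isometric_sub[OF p(1)] by auto
  have "md (path_point p t) (path_point q t) \<le> \<tau>" by (rule thin_paths[OF p q t(1)]) (simp add: t_def)
  moreover have "md (vertex_point (p ! i)) (path_point p t) \<le> 1"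
    using path_point_dist[OF p(1), of i t] path_point_nat[of p i] i t il lp by simp
  moreover have "md (path_point q t) (vertex_point v) = d x v - t"
    using path_point_dist[OF q(1), of t "d x v"] lq t by simp
  moreover have "vertex_point (p ! i) \<in> M" "path_point p t \<in> M" "path_point q t \<in> M" "vertex_point v \<in> M"
    using vertex_point_M V v u path_point_M p q lp lq t by auto
  ultimately have "md (vertex_point (p ! i)) (vertex_point v) \<le> 1 + \<tau> + (d x v - t)"
    using mdist_tri[of "vertex_point (p ! i)" "path_point p t" "vertex_point v"]
      mdist_tri[of "path_point p t" "path_point q t" "vertex_point v"] by linarith
  then have "real (d v (p ! i)) \<le> 1 + \<tau> + (d x v - t)"
    using u v d_sym[of v "p ! i"] by (simp add: mdist_vertex_point)
  then show ?thesis using u(1) d_sym[of y v] V v unfolding t_def by (intro bexI[of _ "p ! i"]) (auto simp: field_simps)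
qed

end

section \<open>Pairs of points under the four-point condition\<close>

text \<open>The constant is written \<open>2 * \<delta>\<close> so that the equivalent inequality
  for Gromov products, \<open>gp_hyp\<close>, loses exactly \<open>\<delta>\<close>.\<close>

locale four_point =
  fixes V :: "'a set" and D :: "'a \<Rightarrow> 'a \<Rightarrow> real" and \<delta> :: real
  assumes D_self: "x \<in> V \<Longrightarrow> D x x = 0"
    and D_sym: "x \<in> V \<Longrightarrow> y \<in> V \<Longrightarrow> D x y = D y x"
    and D_tri: "x \<in> V \<Longrightarrow> y \<in> V \<Longrightarrow> z \<in> V \<Longrightarrow> D x z \<le> D x y + D y z"
    and four: "x \<in> V \<Longrightarrow> y \<in> V \<Longrightarrow> z \<in> V \<Longrightarrow> w \<in> V \<Longrightarrow>
        D x y + D z w \<le> max (D x z + D y w) (D x w + D y z) + 2 * \<delta>"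
begin

definition gp :: "'a \<Rightarrow> 'a \<Rightarrow> 'a \<Rightarrow> real" where
  "gp a b v = (D a v + D v b - D a b) / 2"

lemma gp2: "2 * gp a b v = D a v + D v b - D a b"
  unfolding gp_def by simp

lemma gp_sym: "a \<in> V \<Longrightarrow> b \<in> V \<Longrightarrow> v \<in> V \<Longrightarrow> gp a b v = gp b a v"
  unfolding gp_def by (simp add: D_sym)

lemma delta_nonneg: "x \<in> V \<Longrightarrow> 0 \<le> \<delta>"
  using four[of x x x x] by simp

text \<open>The four-point condition for \<open>a\<close>, \<open>c\<close>, \<open>b\<close>,
  \<open>v\<close>, rewritten in products based at \<open>v\<close>.\<close>

lemma gp_hyp:
  assumes "a \<in> V" "b \<in> V" "c \<in> V" "v \<in> V"
  shows "min (gp a b v) (gp b c v) - \<delta> \<le> gp a c v"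
  using four[of a c b v] D_sym[of c b] D_sym[of c v] D_sym[of b v] assms gp2[of a b v] gp2[of b c v] gp2[of a c v]
  by (auto simp: min_def max_def split: if_splits)

text \<open>Half of \<open>D a x - D b x\<close> acts as the position of \<open>x\<close> along a
  geodesic from \<open>a\<close> to \<open>b\<close>, and \<open>gp a b x\<close> as its height
  above it. Up to multiples of \<open>\<delta>\<close>, distances behave as in a tree, where the
  point with the middle position is between the other two.\<close>

lemma middle_point_sorted:
  assumes V: "a \<in> V" "b \<in> V" "x \<in> V" "y \<in> V" "z \<in> V"
    and R: "gp a b x \<le> R" "gp a b y \<le> R" "gp a b z \<le> R"
    and t: "D a x - D b x \<le> D a y - D b y" "D a y - D b y \<le> D a z - D b z"
  shows "gp x y z \<le> R + 3 * \<delta> \<or> gp y z x \<le> R + 3 * \<delta> \<or> gp x z y \<le> R + 3 * \<delta>"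
proof -
  note sym = D_sym[of x a] D_sym[of y a] D_sym[of z a] D_sym[of x b] D_sym[of y b] D_sym[of z b]
    D_sym[of x y] D_sym[of x z] D_sym[of y z]
  have d0: "0 \<le> \<delta>" using delta_nonneg V by blast
  \<comment> \<open>The order of the positions decides the maximum in the four-point condition; the
    right-hand side is the difference of the positions plus the two heights.\<close>
  have up: "2 * D p q \<le> (D a q - D b q) - (D a p - D b p) + 2 * gp a b p + 2 * gp a b q + 4 * \<delta>"
    if "p \<in> V" "q \<in> V" "D a p - D b p \<le> D a q - D b q" for p q
    using four[of a b p q] that V D_sym[of p b] D_sym[of q b] gp2[of a b p] gp2[of a b q]
    by (auto simp: max_def split: if_splits)
  have xy: "2 * D x y \<le> (D a y - D b y) - (D a x - D b x) + 2 * gp a b x + 2 * gp a b y + 4 * \<delta>"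
    and yz: "2 * D y z \<le> (D a z - D b z) - (D a y - D b y) + 2 * gp a b y + 2 * gp a b z + 4 * \<delta>"
    and xz: "2 * D x z \<le> (D a z - D b z) - (D a x - D b x) + 2 * gp a b x + 2 * gp a b z + 4 * \<delta>"
    using up[of x y] up[of y z] up[of x z] V t by auto
  \<comment> \<open>The matching lower bound for \<open>D x z\<close>, unless the maximum is the
    second term; in that case the positions of \<open>x\<close> and \<open>z\<close> nearly
    agree.\<close>
  have lo: "D a z + D b x \<le> max (D a b + D x z) (D a x + D b z) + 2 * \<delta>"
    using four[of a z b x] V sym by (auto simp: add.commute)
  show ?thesis
  proof (cases "D a z + D b x \<le> D a b + D x z + 2 * \<delta>")
    case True
    then have "2 * D x z \<ge> (D a z - D b z) - (D a x - D b x) + 2 * gp a b x + 2 * gp a b z - 4 * \<delta>"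
      using sym V gp2[of a b x] gp2[of a b z] by simp
    with xy yz have "gp x z y \<le> gp a b y + 3 * \<delta>" using gp2[of x z y] by simp
    then show ?thesis using R by simp
  next
    case False
    \<comment> \<open>All three positions are now close, so all three distances are at most
      \<open>2 * R + 3 * \<delta>\<close>. Two of the products add up to one of these distances, so
      the smaller of the two is at most half of it.\<close>
    with lo have "(D a z - D b z) - (D a x - D b x) \<le> 2 * \<delta>" by simp
    with xy yz xz R t have "D x y \<le> 2 * R + 3 * \<delta>" "D y z \<le> 2 * R + 3 * \<delta>" "D x z \<le> 2 * R + 3 * \<delta>"
      by linarith+
    then show ?thesis using d0 sym V gp2[of x y z] gp2[of x z y] gp2[of y z x] by simp argo
  qed
qed

lemma middle_point:
  assumes V: "a \<in> V" "b \<in> V" "x \<in> V" "y \<in> V" "z \<in> V"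
    and R: "gp a b x \<le> R" "gp a b y \<le> R" "gp a b z \<le> R"
  shows "gp x y z \<le> R + 3 * \<delta> \<or> gp y z x \<le> R + 3 * \<delta> \<or> gp x z y \<le> R + 3 * \<delta>"
proof -
  let ?t = "\<lambda>x. D a x - D b x"
  consider "?t x \<le> ?t y \<and> ?t y \<le> ?t z" | "?t x \<le> ?t z \<and> ?t z \<le> ?t y" | "?t y \<le> ?t x \<and> ?t x \<le> ?t z"
    | "?t y \<le> ?t z \<and> ?t z \<le> ?t x" | "?t z \<le> ?t x \<and> ?t x \<le> ?t y" | "?t z \<le> ?t y \<and> ?t y \<le> ?t x" by argo
  then show ?thesis
    using middle_point_sorted[OF V(1,2), of x y z R] middle_point_sorted[OF V(1,2), of x z y R]
      middle_point_sorted[OF V(1,2), of y x z R] middle_point_sorted[OF V(1,2), of y z x R]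
      middle_point_sorted[OF V(1,2), of z x y R] middle_point_sorted[OF V(1,2), of z y x R]
      V(3-5) R gp_sym[of y x z] gp_sym[of z y x] gp_sym[of z x y]
    by cases auto
qed

text \<open>Pigeonhole: with more than \<open>2 * k\<close> points in \<open>k\<close> classes,
  three points share a class, and \<open>middle_point\<close> contradicts a larger
  separation.\<close>

lemma separated_bound:
  fixes a b :: "nat \<Rightarrow> 'a"
  assumes S: "finite S" "S \<subseteq> V" "2 * k < card S"
    and sep: "\<And>x y m. x \<in> S \<Longrightarrow> y \<in> S \<Longrightarrow> m \<in> S \<Longrightarrow> x \<noteq> y \<Longrightarrow> x \<noteq> m \<Longrightarrow> y \<noteq> m \<Longrightarrow> X \<le> gp x y m"
    and ab: "\<And>i. i < k \<Longrightarrow> a i \<in> V \<and> b i \<in> V"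
    and cover: "\<And>v. v \<in> V \<Longrightarrow> \<exists>i<k. gp (a i) (b i) v \<le> R"
  shows "X \<le> R + 3 * \<delta>"
proof -
  define C where "C i = {v \<in> S. gp (a i) (b i) v \<le> R}" for i
  have fin: "finite (C i)" for i using S unfolding C_def by auto
  have "S \<subseteq> (\<Union>i<k. C i)" using cover S(2) unfolding C_def by blast
  then have "card S \<le> card (\<Union>i<k. C i)" using fin by (intro card_mono) auto
  also have "\<dots> \<le> (\<Sum>i<k. card (C i))" by (rule card_UN_le) simp
  finally have "2 * k < (\<Sum>i<k. card (C i))" using S(3) by simp
  then have "\<exists>i<k. 2 < card (C i)"
    using sum_bounded_above[of "{..<k}" "\<lambda>i. card (C i)" 2] by (force simp: not_less)
  then obtain i where i: "i < k" "3 \<le> card (C i)" by auto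
  then obtain T where "T \<subseteq> C i" "card T = 3" by (meson obtain_subset_with_card_n)
  then obtain x y z where xyz: "x \<in> C i" "y \<in> C i" "z \<in> C i" "x \<noteq> y" "x \<noteq> z" "y \<noteq> z"
    by (auto simp: card_3_iff)
  then have "x \<in> V" "y \<in> V" "z \<in> V" "gp (a i) (b i) x \<le> R" "gp (a i) (b i) y \<le> R" "gp (a i) (b i) z \<le> R"
    using S(2) unfolding C_def by auto
  with middle_point[of "a i" "b i" x y z R] ab[OF i(1)]
  have "gp x y z \<le> R + 3 * \<delta> \<or> gp y z x \<le> R + 3 * \<delta> \<or> gp x z y \<le> R + 3 * \<delta>" by blast
  moreover have "X \<le> gp x y z" "X \<le> gp y z x" "X \<le> gp x z y"
    using sep xyz unfolding C_def by auto
  ultimately show ?thesis by linarith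
qed

text \<open>Separation with respect to \<open>r\<close> passes to arbitrary triples by
  \<open>gp_hyp\<close> through \<open>r\<close>, at the cost of one \<open>\<delta>\<close>. This
  fails if the middle point is \<open>r\<close> itself.\<close>

lemma greedy_separated:
  assumes S: "S \<subseteq> V" "r \<in> S" "s \<in> S" "s \<noteq> r"
    and diam: "\<And>u v. u \<in> V \<Longrightarrow> v \<in> V \<Longrightarrow> D u v \<le> D r s"
    and sep: "\<And>m z. m \<in> S \<Longrightarrow> z \<in> S \<Longrightarrow> m \<noteq> r \<Longrightarrow> z \<noteq> r \<Longrightarrow> m \<noteq> z \<Longrightarrow> X \<le> gp r z m"
    and xym: "x \<in> S" "y \<in> S" "m \<in> S" "x \<noteq> y" "x \<noteq> m" "y \<noteq> m"
  shows "X - \<delta> \<le> gp x y m"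
proof -
  have V: "x \<in> V" "y \<in> V" "m \<in> V" "r \<in> V" "s \<in> V" using S xym by auto
  have d0: "0 \<le> \<delta>" using delta_nonneg V by blast
  show ?thesis
  proof (cases "m = r")
    case False
    then show ?thesis
      using gp_hyp[of x r y m] gp_sym[of x r m] sep[of m x] sep[of m y] xym V d0
      by (cases "x = r"; cases "y = r") (auto simp: min_def split: if_splits)
  next
    case True
    \<comment> \<open>With \<open>r\<close> in the middle, the other end \<open>s\<close> of the
      diametral pair replaces \<open>r\<close>: \<open>D z s \<le> D r s\<close> makes the product
      of \<open>s\<close> and \<open>z\<close> at \<open>r\<close> at least that of \<open>r\<close>
      and \<open>s\<close> at \<open>z\<close>.\<close>
    have X: "X \<le> gp s z r" if z: "z \<in> S" "z \<noteq> r" "z \<noteq> s" for z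
    proof -
      have "z \<in> V" using z S by auto
      then have "gp r s z \<le> gp s z r"
        using diam[of z s] V D_sym[of z s] D_sym[of z r] D_sym[of s r] gp2[of r s z] gp2[of s z r] by simp
      then show ?thesis using sep[of z s] z S by auto
    qed
    show ?thesis
      using gp_hyp[of x s y r] gp_sym[of x s r] X[of x] X[of y] xym V d0 True
      by (cases "x = s"; cases "y = s") (auto simp: min_def split: if_splits)
  qed
qed

text \<open>If both products exceeded \<open>X + \<delta>\<close>, the four-point condition would make both crossing products
  at most \<open>X + \<delta>\<close>, and exchanging partners would increase the total distance.\<close>
lemma exchange_bound:
  assumes V: "a \<in> V" "a' \<in> V" "b \<in> V" "b' \<in> V" "v \<in> V"
    and X: "gp a b v \<le> X"
    and opt: "D a b' + D b a' \<le> D a a' + D b b'"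
  shows "gp a a' v \<le> X + \<delta> \<or> gp b b' v \<le> X + \<delta>"
proof (rule ccontr)
  assume neg: "\<not> ?thesis"
  have "gp a' b v \<le> X + \<delta>" "gp a b' v \<le> X + \<delta>"
    using neg gp_hyp[of a a' b v] gp_hyp[of a b' b v] gp_sym[of b b' v] V X
    by (auto simp: min_def split: if_splits)
  moreover have "gp a a' v + gp b b' v \<le> gp a b' v + gp a' b v"
    using opt V D_sym[of b a'] D_sym[of b v] D_sym[of a' v]
      gp2[of a a' v] gp2[of b b' v] gp2[of a b' v] gp2[of a' b v] by linarith
  ultimately show False using neg by linarith
qed

end

section \<open>Structured programs with arrays\<close>

datatype hexp = K nat | R nat | A nat hexp | Add hexp hexp | Sub hexp hexp | Mul hexp hexp

datatype hbexp = Lt hexp hexp | Eq hexp hexp | Nt hbexp | An hbexp hbexp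

datatype hcom = HSkip | HAssign nat hexp | HStore nat hexp hexp | HRead nat hexp | HWrite hexp hexp
  | HSeq hcom hcom (infixr ";;" 60) | HIf hbexp hcom hcom | HWhile hbexp hcom

text \<open>\<open>lo\<close> is the raw memory below the arrays: it holds the input at the start
  and the contiguous output block at the end. Arrays need no bounds.\<close>

record hstate =
  rg :: "nat \<Rightarrow> nat"
  ar :: "nat \<Rightarrow> nat \<Rightarrow> nat"
  lo :: "nat \<Rightarrow> nat"

primrec hval :: "hstate \<Rightarrow> hexp \<Rightarrow> nat" where
  "hval h (K i) = i"
| "hval h (R r) = rg h r"
| "hval h (A j e) = ar h j (hval h e)"
| "hval h (Add a b) = hval h a + hval h b"
| "hval h (Sub a b) = hval h a - hval h b"
| "hval h (Mul a b) = hval h a * hval h b"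

primrec hbval :: "hstate \<Rightarrow> hbexp \<Rightarrow> bool" where
  "hbval h (Lt a b) \<longleftrightarrow> hval h a < hval h b"
| "hbval h (Eq a b) \<longleftrightarrow> hval h a = hval h b"
| "hbval h (Nt b) \<longleftrightarrow> \<not> hbval h b"
| "hbval h (An b c) \<longleftrightarrow> hbval h b \<and> hbval h c"

abbreviation set_rg :: "nat \<Rightarrow> nat \<Rightarrow> hstate \<Rightarrow> hstate" where
  "set_rg r x h \<equiv> h\<lparr>rg := (rg h)(r := x)\<rparr>"

text \<open>An elementary command counts as one step however large its expressions are; compilation
  multiplies by a constant that depends only on the program. The bound \<open>N\<close> keeps raw
  accesses out of the region of the arrays.\<close>

inductive hrun :: "nat \<Rightarrow> hcom \<Rightarrow> hstate \<Rightarrow> nat \<Rightarrow> hstate \<Rightarrow> bool" for N where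
  "hrun N HSkip h 1 h"
| "hrun N (HAssign r e) h 1 (set_rg r (hval h e) h)"
| "hrun N (HStore j e f) h 1 (h\<lparr>ar := (ar h)(j := (ar h j)(hval h e := hval h f))\<rparr>)"
| "hval h e < N \<Longrightarrow> hrun N (HRead r e) h 1 (set_rg r (lo h (hval h e)) h)"
| "hval h e < N \<Longrightarrow> hrun N (HWrite e f) h 1 (h\<lparr>lo := (lo h)(hval h e := hval h f)\<rparr>)"
| "hrun N c h t h' \<Longrightarrow> hrun N d h' t' h'' \<Longrightarrow> hrun N (c ;; d) h (t + t') h''"
| "hbval h b \<Longrightarrow> hrun N c h t h' \<Longrightarrow> hrun N (HIf b c d) h (Suc t) h'"
| "\<not> hbval h b \<Longrightarrow> hrun N d h t h' \<Longrightarrow> hrun N (HIf b c d) h (Suc t) h'"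
| "hbval h b \<Longrightarrow> hrun N c h t h' \<Longrightarrow> hrun N (HWhile b c) h' t' h'' \<Longrightarrow> hrun N (HWhile b c) h (Suc (t + t')) h''"
| "\<not> hbval h b \<Longrightarrow> hrun N (HWhile b c) h 1 h"

inductive_cases hrun_SkipE: "hrun N HSkip h t h'"
inductive_cases hrun_AssignE: "hrun N (HAssign r e) h t h'"
inductive_cases hrun_StoreE: "hrun N (HStore j e f) h t h'"
inductive_cases hrun_ReadE: "hrun N (HRead r e) h t h'"
inductive_cases hrun_WriteE: "hrun N (HWrite e f) h t h'"
inductive_cases hrun_SeqE: "hrun N (c ;; d) h t h'"
inductive_cases hrun_IfE: "hrun N (HIf b c d) h t h'"

text \<open>Array \<open>j\<close> occupies the addresses congruent to \<open>j\<close> modulo 16 from \<open>16 n\<^sup>2\<close> on, so that distinct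
  array cells never collide, whatever the indices.  Register 0 keeps the value 0 and register 1 holds \<open>n\<close>.\<close>
definition caddr :: "nat \<Rightarrow> aexp \<Rightarrow> aexp" where
  "caddr j a = Plus (Times (Const 16) (Plus a (Times (Reg 1) (Reg 1)))) (Const j)"

primrec cexp :: "hexp \<Rightarrow> aexp" where
  "cexp (K i) = Const i"
| "cexp (R r) = Reg (r + 2)"
| "cexp (A j e) = Mem (caddr j (cexp e))"
| "cexp (Add a b) = Plus (cexp a) (cexp b)"
| "cexp (Sub a b) = Minus (cexp a) (cexp b)"
| "cexp (Mul a b) = Times (cexp a) (cexp b)"

primrec cbexp :: "hbexp \<Rightarrow> bexp" where
  "cbexp (Lt a b) = Less (cexp a) (cexp b)"
| "cbexp (Eq a b) = Equal (cexp a) (cexp b)"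
| "cbexp (Nt b) = BNot (cbexp b)"
| "cbexp (An b c) = BAnd (cbexp b) (cbexp c)"

primrec ccom :: "hcom \<Rightarrow> com" where
  "ccom HSkip = Skip"
| "ccom (HAssign r e) = Assign (r + 2) (cexp e)"
| "ccom (HStore j e f) = Store (caddr j (cexp e)) (cexp f)"
| "ccom (HRead r e) = Assign (r + 2) (Mem (cexp e))"
| "ccom (HWrite e f) = Store (cexp e) (cexp f)"
| "ccom (c ;; d) = Seq (ccom c) (ccom d)"
| "ccom (HIf b c d) = Cond (cbexp b) (ccom c) (ccom d)"
| "ccom (HWhile b c) = While (cbexp b) (ccom c)"

section \<open>Sizes of expressions as bounds for cost and values\<close>

primrec asize :: "aexp \<Rightarrow> nat" where
  "asize (Const i) = Suc i"
| "asize (Reg r) = 1"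
| "asize (Mem a) = Suc (asize a)"
| "asize (Plus a b) = Suc (asize a + asize b)"
| "asize (Minus a b) = Suc (asize a + asize b)"
| "asize (Times a b) = Suc (asize a + asize b)"
| "asize (Divide a b) = Suc (asize a + asize b)"

primrec bsize :: "bexp \<Rightarrow> nat" where
  "bsize (Less a b) = Suc (asize a + asize b)"
| "bsize (Equal a b) = Suc (asize a + asize b)"
| "bsize (BNot b) = Suc (bsize b)"
| "bsize (BAnd b c) = Suc (bsize b + bsize c)"

primrec csize :: "com \<Rightarrow> nat" where
  "csize Skip = 1"
| "csize (Assign r a) = Suc (asize a)"
| "csize (Store a b) = Suc (asize a + asize b)"
| "csize (Seq c d) = csize c + csize d"
| "csize (Cond b c d) = Suc (bsize b + csize c + csize d)"
| "csize (While b c) = Suc (bsize b + csize c)"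

lemma acost_le: "acost a \<le> asize a"
  by (induction a) auto

lemma bcost_le: "bcost b \<le> bsize b"
proof (induction b)
  case (Less a b)
  then show ?case using acost_le[of a] acost_le[of b] by simp
next
  case (Equal a b)
  then show ?case using acost_le[of a] acost_le[of b] by simp
qed auto

lemma power_sum_le: "(2::nat) \<le> x \<Longrightarrow> x ^ p + x ^ q \<le> x ^ Suc (p + q)"
proof -
  assume x: "2 \<le> x"
  have "x ^ p \<le> x ^ (p + q)" "x ^ q \<le> x ^ (p + q)" using x by (auto intro!: power_increasing)
  moreover have "2 * x ^ (p + q) \<le> x * x ^ (p + q)" using x by (rule mult_le_mono1)
  ultimately show ?thesis unfolding power_Suc by linarith
qed

text \<open>\<open>Const i\<close> has size \<open>Suc i\<close> so that constants obey the bound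
  too. The base is at least 2, so one more factor absorbs the sum of two powers
  (\<open>power_sum_le\<close>).\<close>

lemma aval_le_power: "word_state U s \<Longrightarrow> aval s a \<le> (U + 2) ^ asize a"
proof (induction a)
  case (Const i)
  have "i \<le> 2 ^ Suc i" using less_exp[of "Suc i"] by simp
  also have "\<dots> \<le> (U + 2) ^ Suc i" by (intro power_mono) auto
  finally show ?case by simp
next
  case (Mem a)
  then have "aval s (Mem a) \<le> (U + 2) ^ 1" by (simp add: word_state_def le_SucI)
  also have "\<dots> \<le> (U + 2) ^ asize (Mem a)" by (intro power_increasing) auto
  finally show ?case .
next
  case (Plus a b)
  then have "aval s (Plus a b) \<le> (U + 2) ^ asize a + (U + 2) ^ asize b" by auto
  also have "\<dots> \<le> (U + 2) ^ asize (Plus a b)" using power_sum_le[of "U + 2"] by simp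
  finally show ?case .
next
  case (Minus a b)
  then have "aval s (Minus a b) \<le> (U + 2) ^ asize a" by (auto intro: le_trans[OF diff_le_self])
  also have "\<dots> \<le> (U + 2) ^ asize (Minus a b)" by (intro power_increasing) auto
  finally show ?case .
next
  case (Times a b)
  then have "aval s (Times a b) \<le> (U + 2) ^ asize a * (U + 2) ^ asize b" by (auto intro: mult_le_mono)
  also have "\<dots> = (U + 2) ^ (asize a + asize b)" by (simp add: power_add)
  also have "\<dots> \<le> (U + 2) ^ asize (Times a b)" by (intro power_increasing) auto
  finally show ?case .
next
  case (Divide a b)
  then have "aval s (Divide a b) \<le> (U + 2) ^ asize a" by (auto intro: le_trans[OF div_le_dividend])
  also have "\<dots> \<le> (U + 2) ^ asize (Divide a b)" by (intro power_increasing) auto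
  finally show ?case .
qed (simp add: word_state_def le_SucI)

lemma afits_power:
  assumes s: "word_state U s" and W: "(U + 2) ^ M \<le> W"
  shows "asize a \<le> M \<Longrightarrow> afits W s a"
proof (induction a)
  have *: "asize a \<le> M \<Longrightarrow> aval s a \<le> W" for a
    using le_trans[OF aval_le_power[OF s, of a] le_trans[OF power_increasing[of "asize a" M "U + 2"] W]] by simp
  { case (Const i) then show ?case using *[of "Const i"] by simp }
  { case (Plus a b) then show ?case using *[of "Plus a b"] by simp }
  { case (Times a b) then show ?case using *[of "Times a b"] by simp }
qed auto

lemma bfits_power:
  assumes "word_state U s" "(U + 2) ^ M \<le> W"
  shows "bsize b \<le> M \<Longrightarrow> bfits W s b"
  by (induction b) (auto intro: afits_power[OF assms])

text \<open>The value of a slow expression exceeds the contents of registers and cells by at most its size;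
  hence the words stay polynomial when the running time is.\<close>
fun slow :: "hexp \<Rightarrow> bool" where
  "slow (Add a (K i)) \<longleftrightarrow> slow a"
| "slow (Add a _) \<longleftrightarrow> False"
| "slow (Mul a b) \<longleftrightarrow> False"
| "slow (Sub a b) \<longleftrightarrow> slow a"
| "slow _ \<longleftrightarrow> True"

primrec aok :: "hexp \<Rightarrow> bool" where
  "aok (K i) \<longleftrightarrow> True"
| "aok (R r) \<longleftrightarrow> True"
| "aok (A j e) \<longleftrightarrow> j < 16 \<and> aok e"
| "aok (Add a b) \<longleftrightarrow> aok a \<and> aok b"
| "aok (Sub a b) \<longleftrightarrow> aok a \<and> aok b"
| "aok (Mul a b) \<longleftrightarrow> aok a \<and> aok b"

primrec bok :: "hbexp \<Rightarrow> bool" where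
  "bok (Lt a b) \<longleftrightarrow> aok a \<and> aok b"
| "bok (Eq a b) \<longleftrightarrow> aok a \<and> aok b"
| "bok (Nt b) \<longleftrightarrow> bok b"
| "bok (An b c) \<longleftrightarrow> bok b \<and> bok c"

primrec cok :: "hcom \<Rightarrow> bool" where
  "cok HSkip \<longleftrightarrow> True"
| "cok (HAssign r e) \<longleftrightarrow> aok e \<and> slow e"
| "cok (HStore j e f) \<longleftrightarrow> j < 16 \<and> aok e \<and> aok f \<and> slow f"
| "cok (HRead r e) \<longleftrightarrow> aok e"
| "cok (HWrite e f) \<longleftrightarrow> aok e \<and> aok f \<and> slow f"
| "cok (c ;; d) \<longleftrightarrow> cok c \<and> cok d"
| "cok (HIf b c d) \<longleftrightarrow> bok b \<and> cok c \<and> cok d"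
| "cok (HWhile b c) \<longleftrightarrow> bok b \<and> cok c"

section \<open>Simulation of array programs on the word RAM\<close>

definition sim :: "nat \<Rightarrow> state \<Rightarrow> hstate \<Rightarrow> bool" where
  "sim n s h \<longleftrightarrow> reg s 0 = 0 \<and> reg s 1 = n \<and> (\<forall>r. reg s (r + 2) = rg h r) \<and>
     (\<forall>i < 16 * (n * n). mem s i = lo h i) \<and> (\<forall>j<16. \<forall>i. mem s (16 * (i + n * n) + j) = ar h j i)"

lemma aval_cexp: "sim n s h \<Longrightarrow> aok e \<Longrightarrow> aval s (cexp e) = hval h e"
  by (induction e) (auto simp: sim_def caddr_def)

lemma bval_cbexp: "sim n s h \<Longrightarrow> bok b \<Longrightarrow> bval s (cbexp b) = hbval h b"
  by (induction b) (auto simp: aval_cexp)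

lemma aval_caddr: "sim n s h \<Longrightarrow> aok e \<Longrightarrow> aval s (caddr j (cexp e)) = 16 * (hval h e + n * n) + j"
  by (auto simp: caddr_def aval_cexp) (simp add: sim_def)

lemma slow_bound: "word_state U s \<Longrightarrow> slow e \<Longrightarrow> aval s (cexp e) \<le> U + asize (cexp e)"
proof (induction e rule: slow.induct)
  case (4 a b)
  then have "aval s (cexp a) \<le> U + asize (cexp a)" by auto
  then show ?case by simp
qed (auto simp: word_state_def trans_le_add1 le_SucI)

lemma word_state_mono: "word_state U s \<Longrightarrow> U \<le> U' \<Longrightarrow> word_state U' s"
  unfolding word_state_def by (meson le_trans)

lemma sim_assign: "sim n s h \<Longrightarrow> sim n (s\<lparr>reg := (reg s)(r + 2 := x)\<rparr>) (set_rg r x h)"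
  unfolding sim_def by auto

text \<open>Used both for matrix cells in row-major order and, with 16 columns, for array
  addresses.\<close>

lemma index_eq_iff:
  assumes "v < n" "v' < n" shows "u * n + v = u' * n + v' \<longleftrightarrow> u = u' \<and> v = (v'::nat)"
proof
  assume eq: "u * n + v = u' * n + v'"
  have "(u * n + v) div n = u" "(u' * n + v') div n = u'" using assms by auto
  then show "u = u' \<and> v = v'" using eq by auto
qed simp

lemma sim_store:
  assumes "sim n s h" "j < 16"
  shows "sim n (s\<lparr>mem := (mem s)(16 * (i + n * n) + j := x)\<rparr>) (h\<lparr>ar := (ar h)(j := (ar h j)(i := x))\<rparr>)"
proof -
  have "16 * (i' + n * n) + j' = 16 * (i + n * n) + j \<longleftrightarrow> i' = i \<and> j' = j" if "j' < 16" for i' j'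
    
    using index_eq_iff[OF that assms(2), of "i' + n * n" "i + n * n"] by (simp add: mult.commute)
  then show ?thesis using assms unfolding sim_def by auto
qed

lemma sim_write: "sim n s h \<Longrightarrow> i < 16 * (n * n) \<Longrightarrow> sim n (s\<lparr>mem := (mem s)(i := x)\<rparr>) (h\<lparr>lo := (lo h)(i := x)\<rparr>)"
  unfolding sim_def by auto

lemma fits_start: "(U + M * t + 2) ^ M \<le> W \<Longrightarrow> (U + 2) ^ M \<le> (W::nat)"
  by (rule order_trans[OF power_mono]) auto

lemma exec_assign_step:
  assumes s: "word_state U s" "(U + M * 1 + 2) ^ M \<le> W" "asize a < M"
    and x: "aval s a = x" "x \<le> U + M" and h: "sim n s h"
  shows "\<exists>t s'. exec W (Assign (r + 2) a) s t s' \<and> t \<le> M * 1 \<and> sim n s' (set_rg r x h) \<and>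
    word_state (U + M * 1) s'"
proof -
  have "afits W s a" using s(3) by (intro afits_power[OF s(1) fits_start[OF s(2)]]) simp
  note ex = ex_assign[OF this, of "r + 2", unfolded x(1)]
  have "word_state (U + M * 1) (s\<lparr>reg := (reg s)(r + 2 := x)\<rparr>)"
    using s(1) x(2) unfolding word_state_def by (auto simp: trans_le_add1)
  moreover have "1 + acost a \<le> M * 1" using s(3) acost_le[of a] by simp
  ultimately show ?thesis using ex sim_assign[OF h] by blast
qed

lemma exec_store_step:
  assumes s: "word_state U s" "(U + M * 1 + 2) ^ M \<le> W" "asize a + asize b < M"
    and x: "aval s b \<le> U + M" and h: "sim n (s\<lparr>mem := (mem s)(aval s a := aval s b)\<rparr>) h"
  shows "\<exists>t s'. exec W (Store a b) s t s' \<and> t \<le> M * 1 \<and> sim n s' h \<and> word_state (U + M * 1) s'"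
proof -
  have "afits W s a" "afits W s b" using s(3) by (auto intro!: afits_power[OF s(1) fits_start[OF s(2)]])
  note ex = ex_store[OF this]
  have "word_state (U + M * 1) (s\<lparr>mem := (mem s)(aval s a := aval s b)\<rparr>)"
    using s(1) x unfolding word_state_def by (auto simp: trans_le_add1)
  moreover have "1 + acost a + acost b \<le> M * 1" using s(3) acost_le[of a] acost_le[of b] by simp
  ultimately show ?thesis using ex h by blast
qed

text \<open>By slowness, every source step raises the bound on registers and cells by at most
  \<open>M\<close>. Hence \<open>U + M * t\<close> bounds all contents during the run, and its power
  \<open>(U + M * t + 2) ^ M\<close> bounds every intermediate value of an expression of size at
  most \<open>M\<close>.\<close>

theorem compile_correct:
  assumes "hrun N c h t h'" "N = 16 * (n * n)" "cok c" "csize (ccom c) \<le> M"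
    "sim n s h" "word_state U s" "(U + M * t + 2) ^ M \<le> W"
  shows "\<exists>t' s'. exec W (ccom c) s t' s' \<and> t' \<le> M * t \<and> sim n s' h' \<and> word_state (U + M * t) s'"
  using assms
proof (induction arbitrary: s U rule: hrun.induct)
  case (1 h)
  then show ?case using ex_skip[of W s] by (auto intro!: exI elim: word_state_mono)
next
  case (2 r e h)
  then show ?case using slow_bound[OF 2(5), of e] aval_cexp[OF 2(4), of e] unfolding ccom.simps
    by (intro exec_assign_step) auto
next
  case (3 j e f h)
  have "sim n (s\<lparr>mem := (mem s)(aval s (caddr j (cexp e)) := aval s (cexp f))\<rparr>)
    (h\<lparr>ar := (ar h)(j := (ar h j)(hval h e := hval h f))\<rparr>)"
    using sim_store[OF 3(4), of j "hval h e" "hval h f"] aval_cexp[OF 3(4), of f] aval_caddr[OF 3(4), of e j] 3(2)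
    by simp
  then show ?case using 3 slow_bound[OF 3(5), of f] unfolding ccom.simps by (intro exec_store_step) auto
next
  case (4 h e r)
  have "aval s (Mem (cexp e)) = lo h (hval h e)" using 4 aval_cexp[OF 4(5), of e] unfolding sim_def by simp
  moreover have "aval s (Mem (cexp e)) \<le> U + M" using 4(6) by (simp add: word_state_def trans_le_add1)
  ultimately show ?case using 4 unfolding ccom.simps by (intro exec_assign_step) auto
next
  case (5 h e f)
  have "sim n (s\<lparr>mem := (mem s)(aval s (cexp e) := aval s (cexp f))\<rparr>) (h\<lparr>lo := (lo h)(hval h e := hval h f)\<rparr>)"
    using sim_write[OF 5(5), of "hval h e" "hval h f"] aval_cexp[OF 5(5)] 5(1,2,3) by simp
  then show ?case using 5 slow_bound[OF 5(6), of f] unfolding ccom.simps by (intro exec_store_step) auto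
next
  case (6 c h t h' d t' h'')
  have eq: "U + M * (t + t') = U + M * t + M * t'" by (simp add: algebra_simps)
  have "(U + M * t + 2) ^ M \<le> W" using 6(10) by (intro le_trans[OF power_mono 6(10)]) auto
  note W = this
  have ok: "cok c" "cok d" "csize (ccom c) \<le> M" "csize (ccom d) \<le> M" using 6(6,7) by auto
  obtain t1 s1 where 1: "exec W (ccom c) s t1 s1" "t1 \<le> M * t" "sim n s1 h'" "word_state (U + M * t) s1"
    using 6(3)[OF 6(5) ok(1,3) 6(8,9) W] by blast
  obtain t2 s2 where 2: "exec W (ccom d) s1 t2 s2" "t2 \<le> M * t'" "sim n s2 h''" "word_state (U + M * t + M * t') s2"
    using 6(4)[OF 6(5) ok(2,4) 1(3,4) 6(10)[unfolded eq]] by blast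
  show ?case using ex_seq[OF 1(1) 2(1)] 1(2) 2 unfolding ccom.simps eq
    by (intro exI conjI) (assumption | simp add: algebra_simps)+
next
  case (7 h b c t h' d)
  have W: "(U + 2) ^ M \<le> W" "(U + M * t + 2) ^ M \<le> W" using 7(9) by (auto intro!: le_trans[OF power_mono 7(9)])
  have fits: "bfits W s (cbexp b)" using 7 by (intro bfits_power[OF 7(8) W(1)]) auto
  have bv: "bval s (cbexp b)" using bval_cbexp[OF 7(7), of b] 7 by simp
  obtain t1 s1 where 1: "exec W (ccom c) s t1 s1" "t1 \<le> M * t" "sim n s1 h'" "word_state (U + M * t) s1"
    using 7(3)[OF 7(4) _ _ 7(7,8) W(2)] 7(5) 7(1) 7 by auto
  have "1 + bcost (cbexp b) \<le> M" using 7 bcost_le[of "cbexp b"] by simp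
  then show ?case using ex_cond_true[OF fits bv 1(1), of "ccom d"] 1(2,3) word_state_mono[OF 1(4), of "U + M * Suc t"]
    unfolding ccom.simps by (intro exI conjI) (assumption | simp)+
next
  case (8 h b d t h' c)
  have W: "(U + 2) ^ M \<le> W" "(U + M * t + 2) ^ M \<le> W" using 8(9) by (auto intro!: le_trans[OF power_mono 8(9)])
  have fits: "bfits W s (cbexp b)" using 8 by (intro bfits_power[OF 8(8) W(1)]) auto
  have bv: "\<not> bval s (cbexp b)" using bval_cbexp[OF 8(7), of b] 8 by simp
  obtain t1 s1 where 1: "exec W (ccom d) s t1 s1" "t1 \<le> M * t" "sim n s1 h'" "word_state (U + M * t) s1"
    using 8(3)[OF 8(4) _ _ 8(7,8) W(2)] 8(5) 8(1) 8 by auto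
  have "1 + bcost (cbexp b) \<le> M" using 8 bcost_le[of "cbexp b"] by simp
  then show ?case using ex_cond_false[OF fits bv 1(1), of "ccom c"] 1(2,3) word_state_mono[OF 1(4), of "U + M * Suc t"]
    unfolding ccom.simps by (intro exI conjI) (assumption | simp)+
next
  case (9 h b c t h' t' h'')
  have W: "(U + 2) ^ M \<le> W" "(U + M * t + 2) ^ M \<le> W" "(U + M * t + M * t' + 2) ^ M \<le> W"
    using 9(11) by (auto intro!: le_trans[OF power_mono 9(11)] simp: algebra_simps)
  have fits: "bfits W s (cbexp b)" using 9 by (intro bfits_power[OF 9(10) W(1)]) auto
  have bv: "bval s (cbexp b)" using bval_cbexp[OF 9(9), of b] 9 by simp
  obtain t1 s1 where 1: "exec W (ccom c) s t1 s1" "t1 \<le> M * t" "sim n s1 h'" "word_state (U + M * t) s1"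
    using 9(4)[OF 9(6) _ _ 9(9,10) W(2)] 9 by auto
  obtain t2 s2 where 2: "exec W (ccom (HWhile b c)) s1 t2 s2" "t2 \<le> M * t'" "sim n s2 h''" "word_state (U + M * t + M * t') s2"
    using 9(5)[OF 9(6,7) _ 1(3,4) W(3)] 9 by auto
  have "1 + bcost (cbexp b) \<le> M" using 9 bcost_le[of "cbexp b"] by simp
  then show ?case
    using ex_while_true[OF fits bv 1(1) 2(1)[unfolded ccom.simps]] 1(2) 2(2,3) word_state_mono[OF 2(4), of "U + M * Suc (t + t')"]
    unfolding ccom.simps by (intro exI conjI) (assumption | simp add: algebra_simps)+
next
  case (10 h b c)
  note W = fits_start[OF 10(7)]
  have fits: "bfits W s (cbexp b)" using 10 by (intro bfits_power[OF 10(6) W(1)]) auto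
  have bv: "\<not> bval s (cbexp b)" using bval_cbexp[OF 10(5), of b] 10 by simp
  show ?case using ex_while_false[OF fits bv, of "ccom c"] 10 bcost_le[of "cbexp b"] word_state_mono[OF 10(6), of "U + M * 1"]
    unfolding ccom.simps by (intro exI conjI) (assumption | simp)+
qed

section \<open>Weakest preconditions with running time\<close>

definition hwp :: "nat \<Rightarrow> hcom \<Rightarrow> (nat \<Rightarrow> hstate \<Rightarrow> bool) \<Rightarrow> hstate \<Rightarrow> bool" where
  "hwp N c Q h \<longleftrightarrow> (\<exists>t h'. hrun N c h t h' \<and> Q t h')"

lemma hwp_mono: "hwp N c Q h \<Longrightarrow> (\<And>t h'. Q t h' \<Longrightarrow> Q' t h') \<Longrightarrow> hwp N c Q' h"
  unfolding hwp_def by blast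

lemma hwp_Skip [simp]: "hwp N HSkip Q = Q 1"
  unfolding hwp_def
  by (rule ext, rule iffI, force elim: hrun_SkipE, intro exI conjI, rule hrun.intros(1), auto)

lemma hwp_Assign [simp]: "hwp N (HAssign r e) Q = (\<lambda>h. Q 1 (set_rg r (hval h e) h))"
  unfolding hwp_def
  by (rule ext, rule iffI, force elim: hrun_AssignE, intro exI conjI, rule hrun.intros(2), auto)

lemma hwp_Store [simp]:
  "hwp N (HStore j e f) Q = (\<lambda>h. Q 1 (h\<lparr>ar := (ar h)(j := (ar h j)(hval h e := hval h f))\<rparr>))"
  unfolding hwp_def
  by (rule ext, rule iffI, force elim: hrun_StoreE, intro exI conjI, rule hrun.intros(3), auto)

lemma hwp_Read [simp]:
  "hwp N (HRead r e) Q = (\<lambda>h. hval h e < N \<and> Q 1 (set_rg r (lo h (hval h e)) h))"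
  unfolding hwp_def
  by (rule ext, rule iffI, force elim: hrun_ReadE, intro exI conjI, rule hrun.intros(4), auto)

lemma hwp_Write [simp]:
  "hwp N (HWrite e f) Q = (\<lambda>h. hval h e < N \<and> Q 1 (h\<lparr>lo := (lo h)(hval h e := hval h f)\<rparr>))"
  unfolding hwp_def
  by (rule ext, rule iffI, force elim: hrun_WriteE, intro exI conjI, rule hrun.intros(5), auto)

lemma hwp_Seq [simp]: "hwp N (c ;; d) Q = hwp N c (\<lambda>t. hwp N d (\<lambda>t'. Q (t + t')))"
  unfolding hwp_def by (rule ext) (blast elim: hrun_SeqE intro: hrun.intros)

lemma hwp_If [simp]:
  "hwp N (HIf b c d) Q =
     (\<lambda>h. if hbval h b then hwp N c (\<lambda>t. Q (Suc t)) h else hwp N d (\<lambda>t. Q (Suc t)) h)"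
proof
  fix h
  show "hwp N (HIf b c d) Q h =
    (if hbval h b then hwp N c (\<lambda>t. Q (Suc t)) h else hwp N d (\<lambda>t. Q (Suc t)) h)"
    unfolding hwp_def by (cases "hbval h b") (simp, blast elim: hrun_IfE intro: hrun.intros)+
qed

primrec rmods :: "hcom \<Rightarrow> nat set" where
  "rmods HSkip = {}"
| "rmods (HAssign r e) = {r}"
| "rmods (HStore j e f) = {}"
| "rmods (HRead r e) = {r}"
| "rmods (HWrite e f) = {}"
| "rmods (c ;; d) = rmods c \<union> rmods d"
| "rmods (HIf b c d) = rmods c \<union> rmods d"
| "rmods (HWhile b c) = rmods c"

primrec amods :: "hcom \<Rightarrow> nat set" where
  "amods HSkip = {}"
| "amods (HAssign r e) = {}"
| "amods (HStore j e f) = {j}"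
| "amods (HRead r e) = {}"
| "amods (HWrite e f) = {}"
| "amods (c ;; d) = amods c \<union> amods d"
| "amods (HIf b c d) = amods c \<union> amods d"
| "amods (HWhile b c) = amods c"

primrec lmods :: "hcom \<Rightarrow> bool" where
  "lmods HSkip = False"
| "lmods (HAssign r e) = False"
| "lmods (HStore j e f) = False"
| "lmods (HRead r e) = False"
| "lmods (HWrite e f) = True"
| "lmods (c ;; d) = (lmods c \<or> lmods d)"
| "lmods (HIf b c d) = (lmods c \<or> lmods d)"
| "lmods (HWhile b c) = lmods c"

text \<open>The frame condition is read off the syntax, so loop invariants have to mention only what
  the loop changes.\<close>

definition agree :: "hcom \<Rightarrow> hstate \<Rightarrow> hstate \<Rightarrow> bool" where
  "agree c h h' \<longleftrightarrow> (\<forall>r. r \<notin> rmods c \<longrightarrow> rg h' r = rg h r) \<and> (\<forall>j. j \<notin> amods c \<longrightarrow> ar h' j = ar h j) \<and>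
     (\<not> lmods c \<longrightarrow> lo h' = lo h)"

lemma agree_refl: "agree c h h"
  by (simp add: agree_def)

lemma agree_trans: "agree c h h' \<Longrightarrow> agree c h' h'' \<Longrightarrow> agree c h h''"
  by (simp add: agree_def)

lemma hrun_agree: "hrun N c h t h' \<Longrightarrow> agree c h h'"
  by (induction rule: hrun.induct) (auto simp: agree_def)

lemma hwp_frame:
  assumes "hwp N c Q h" "\<And>t h'. Q t h' \<Longrightarrow> agree c h h' \<Longrightarrow> Q' t h'"
  shows "hwp N c Q' h"
  using assms hrun_agree unfolding hwp_def by blast

text \<open>The measure needs to drop by only 1 per iteration but may drop faster, which permits
  amortised bounds. The frame relative to the initial state is available in every iteration.\<close>

lemma hwp_while:
  assumes init: "I h0"
    and step: "\<And>h. I h \<Longrightarrow> hbval h b \<Longrightarrow> agree c h0 h \<Longrightarrow> hwp N c (\<lambda>t h'. t \<le> T \<and> I h' \<and> \<mu> h' < \<mu> h) h"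
    and final: "\<And>h t. I h \<Longrightarrow> \<not> hbval h b \<Longrightarrow> agree c h0 h \<Longrightarrow> t \<le> Suc (\<mu> h0 * Suc T) \<Longrightarrow> Q t h"
  shows "hwp N (HWhile b c) Q h0"
proof -
  have "\<exists>t h'. hrun N (HWhile b c) h t h' \<and> t \<le> Suc (\<mu> h * Suc T) \<and> I h' \<and> \<not> hbval h' b \<and> agree c h0 h'"
    if "I h" "agree c h0 h" for h
    using that
  proof (induction "\<mu> h" arbitrary: h rule: less_induct)
    case less
    show ?case
    proof (cases "hbval h b")
      case True
      obtain t h1 where 1: "hrun N c h t h1" "t \<le> T" "I h1" "\<mu> h1 < \<mu> h"
        using step[OF less(2) True less(3)] unfolding hwp_def by blast
      have "agree c h0 h1" using agree_trans less(3) hrun_agree 1(1) by blast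
      then obtain t' h2 where 2: "hrun N (HWhile b c) h1 t' h2" "t' \<le> Suc (\<mu> h1 * Suc T)"
        "I h2" "\<not> hbval h2 b" "agree c h0 h2" using less(1)[OF 1(4,3)] by blast
      have "Suc (\<mu> h1) * Suc T \<le> \<mu> h * Suc T" using 1(4) by (intro mult_le_mono1) simp
      then have "Suc (t + t') \<le> Suc (\<mu> h * Suc T)" using 1(2) 2(2) by simp
      then show ?thesis using 2 hrun.intros(9)[OF True 1(1) 2(1)] by blast
    next
      case False
      then show ?thesis using hrun.intros(10)[OF False, of N c] less by fastforce
    qed
  qed
  from this[OF init agree_refl] show ?thesis using final unfolding hwp_def by blast
qed

definition HFor :: "nat \<Rightarrow> hexp \<Rightarrow> hcom \<Rightarrow> hcom" where
  "HFor r e c = HAssign r (K 0) ;; HWhile (Lt (R r) e) (c ;; HAssign r (Add (R r) (K 1)))"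

lemma HFor_simps [simp]:
  "rmods (HFor r e c) = insert r (rmods c)" "amods (HFor r e c) = amods c" "lmods (HFor r e c) = lmods c"
  "cok (HFor r e c) \<longleftrightarrow> aok e \<and> cok c"
  by (auto simp: HFor_def)

text \<open>Premise \<open>stable\<close> says that the invariant ignores the loop register, so the
  increment preserves it. In the bound, the \<open>T + 2\<close> adds the test and the increment to
  the body.\<close>

lemma hwp_for:
  assumes r: "r \<notin> rmods c"
    and lim: "\<And>h. agree (HFor r e c) h0 h \<Longrightarrow> hval h e = L"
    and stable: "\<And>i x h. I i (set_rg r x h) \<longleftrightarrow> I i h"
    and init: "I 0 h0"
    and step: "\<And>h. I (rg h r) h \<Longrightarrow> rg h r < L \<Longrightarrow> agree (HFor r e c) h0 h \<Longrightarrow>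
      hwp N c (\<lambda>t h'. t \<le> T \<and> I (Suc (rg h r)) h') h"
    and final: "\<And>h t. I L h \<Longrightarrow> agree (HFor r e c) h0 h \<Longrightarrow> t \<le> 2 + L * (T + 2) \<Longrightarrow> Q t h"
  shows "hwp N (HFor r e c) Q h0"
proof -
  let ?b = "Lt (R r) e" and ?c = "c ;; HAssign r (Add (R r) (K 1))" and ?s = "set_rg r 0 h0"
  have ag: "agree (HFor r e c) h0 h" if "agree ?c ?s h" for h
    using that unfolding agree_def by auto
  have "hwp N (HWhile ?b ?c) (\<lambda>t. Q (1 + t)) ?s"
  proof (rule hwp_while[where I = "\<lambda>h. I (rg h r) h \<and> rg h r \<le> L" and T = "T + 1" and \<mu> = "\<lambda>h. L - rg h r"])
    show "I (rg ?s r) ?s \<and> rg ?s r \<le> L" using init by (simp add: stable)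
  next
    fix h assume I: "I (rg h r) h \<and> rg h r \<le> L" and b: "hbval h ?b" and a: "agree ?c ?s h"
    have l: "rg h r < L" using b lim[OF ag[OF a]] by simp
    show "hwp N ?c (\<lambda>t h'. t \<le> T + 1 \<and> (I (rg h' r) h' \<and> rg h' r \<le> L) \<and> L - rg h' r < L - rg h r) h"
      unfolding hwp_Seq hwp_Assign
    proof (rule hwp_frame[OF step[OF _ l ag[OF a]]], goal_cases)
      case 1
      then show ?case using I by simp
    next
      case (2 t h')
      then have "rg h' r = rg h r" using r unfolding agree_def by blast
      then show ?case using 2 l by (simp add: stable)
    qed
  next
    fix h t assume I: "I (rg h r) h \<and> rg h r \<le> L" and b: "\<not> hbval h ?b" and a: "agree ?c ?s h"
      and t: "t \<le> Suc ((L - rg ?s r) * Suc (T + 1))"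
    have "rg h r = L" using I b lim[OF ag[OF a]] by simp
    then show "Q (1 + t) h" using final I ag[OF a] t by simp
  qed
  then show ?thesis unfolding HFor_def by simp
qed

section \<open>All-pairs distances\<close>

text \<open>Arrays: 0 distances, 1 flags of the vertices that may still be chosen, 2 chosen vertices,
  3 and 4 first and second points of the pairs, 5 stack of pairs, 6 flags of the pairs already
  output, 7 output words.\<close>

abbreviation (input) "rN \<equiv> 0::nat"
abbreviation (input) "rM \<equiv> 1::nat"
abbreviation (input) "rK \<equiv> 2::nat"
abbreviation (input) "rI \<equiv> 3::nat"
abbreviation (input) "rJ \<equiv> 4::nat"
abbreviation (input) "rU \<equiv> 5::nat"
abbreviation (input) "rV \<equiv> 6::nat"
abbreviation (input) "rA \<equiv> 7::nat"
abbreviation (input) "rB \<equiv> 8::nat"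
abbreviation (input) "rBest \<equiv> 9::nat"
abbreviation (input) "rRoot \<equiv> 10::nat"
abbreviation (input) "rT \<equiv> 11::nat"
abbreviation (input) "rDone \<equiv> 12::nat"
abbreviation (input) "rCnt \<equiv> 13::nat"
abbreviation (input) "rCur \<equiv> 14::nat"
abbreviation (input) "rNxt \<equiv> 15::nat"
abbreviation (input) "rSp \<equiv> 16::nat"
abbreviation (input) "rP \<equiv> 17::nat"
abbreviation (input) "rX \<equiv> 18::nat"
abbreviation (input) "rY \<equiv> 19::nat"
abbreviation (input) "rF \<equiv> 20::nat"
abbreviation (input) "rOp \<equiv> 21::nat"
abbreviation (input) "rW \<equiv> 22::nat"

abbreviation ix :: "nat \<Rightarrow> nat \<Rightarrow> hexp" where
  "ix a b \<equiv> Add (Mul (R a) (R rN)) (R b)"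

abbreviation dist_at :: "nat \<Rightarrow> nat \<Rightarrow> hexp" where
  "dist_at a b \<equiv> A 0 (ix a b)"

text \<open>Every distance is below \<open>n\<close>, so \<open>n\<close> serves as infinity off the
  diagonal.\<close>

definition c_init :: hcom where
  "c_init = HFor rU (Mul (R rN) (R rN)) (HStore 0 (R rU) (R rN)) ;; HFor rU (R rN) (HStore 0 (ix rU rU) (K 0))"

text \<open>One edge, in both directions, for all sources \<open>u\<close>: Bellman-Ford run from
  all sources at once.\<close>

definition c_relax :: hcom where
  "c_relax = HFor rU (R rN)
     (HIf (Lt (Add (dist_at rU rA) (K 1)) (dist_at rU rB)) (HStore 0 (ix rU rB) (Add (dist_at rU rA) (K 1))) HSkip ;;
      HIf (Lt (Add (dist_at rU rB) (K 1)) (dist_at rU rA)) (HStore 0 (ix rU rA) (Add (dist_at rU rB) (K 1))) HSkip)"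

definition c_round :: hcom where
  "c_round = HFor rJ (R rM)
     (HRead rA (Add (K 3) (Add (R rJ) (R rJ))) ;; HRead rB (Add (K 4) (Add (R rJ) (R rJ))) ;; c_relax)"

definition c_dist :: hcom where
  "c_dist = c_init ;; HFor rI (R rN) c_round"

definition c_diam :: hcom where
  "c_diam = HAssign rBest (K 0) ;; HAssign rRoot (K 0) ;; HFor rU (R rN) (HFor rV (R rN)
     (HIf (Lt (R rBest) (dist_at rU rV)) (HAssign rBest (dist_at rU rV) ;; HAssign rRoot (R rU)) HSkip))"

lemma index_less: "u < n \<Longrightarrow> v < n \<Longrightarrow> u * n + v < n * (n::nat)"
  using mult_le_mono1[of "Suc u" n n] by simp

locale instance_graph = conn_graph "{..<n}" E for n :: nat and E :: "nat set set" +
  fixes es :: "(nat \<times> nat) list" and k :: nat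
  assumes edges: "edge_list E es" and k: "1 \<le> k" "k \<le> n"
begin

abbreviation "N \<equiv> 16 * (n * n)"

definition params :: "hstate \<Rightarrow> bool" where
  "params h \<longleftrightarrow> rg h rN = n \<and> rg h rM = length es \<and> rg h rK = k"

definition input_ok :: "hstate \<Rightarrow> bool" where
  "input_ok h \<longleftrightarrow> (\<forall>j<length es. lo h (3 + (j + j)) = fst (es ! j) \<and> lo h (4 + (j + j)) = snd (es ! j))"

definition dist_ok :: "hstate \<Rightarrow> bool" where
  "dist_ok h \<longleftrightarrow> (\<forall>u<n. \<forall>v<n. ar h 0 (u * n + v) = d u v)"

lemma d_less: "u < n \<Longrightarrow> v < n \<Longrightarrow> d u v < n"
  using d_less_card[of u v] by simp

lemma es_edge: "j < length es \<Longrightarrow> {fst (es ! j), snd (es ! j)} \<in> E"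
proof -
  assume "j < length es"
  then have "(\<lambda>(u, v). {u, v}) (es ! j) \<in> set (map (\<lambda>(u, v). {u, v}) es)" by auto
  then show ?thesis using edges unfolding edge_list_def by (auto simp: split_def)
qed

lemma edge_es: "{u, v} \<in> E \<Longrightarrow> \<exists>j<length es. es ! j = (u, v) \<or> es ! j = (v, u)"
proof -
  assume "{u, v} \<in> E"
  then have "{u, v} \<in> (\<lambda>(u, v). {u, v}) ` set es" using edges unfolding edge_list_def by auto
  then show ?thesis by (auto simp: in_set_conv_nth doubleton_eq_iff)
qed

lemma length_es: "length es = card E"
  using edges unfolding edge_list_def by (metis distinct_card length_map)

lemma n_pos: "0 < n"
  using k by simp

lemma length_es_le: "length es \<le> n * n" and n_le: "n \<le> Suc (length es)"
  using card_E_le card_E_ge by (simp_all add: length_es)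

definition sound :: "hstate \<Rightarrow> bool" where
  "sound h \<longleftrightarrow> (\<forall>u<n. \<forall>v<n. d u v \<le> ar h 0 (u * n + v))"

definition tight :: "nat \<Rightarrow> hstate \<Rightarrow> bool" where
  "tight i h \<longleftrightarrow> (\<forall>u<n. \<forall>v<n. d u v \<le> i \<longrightarrow> ar h 0 (u * n + v) \<le> d u v)"

text \<open>The bound compares with true distances instead of with other cells, so it survives any
  further decrease of the matrix; this is what permits updates in place.\<close>

definition relaxed :: "nat \<Rightarrow> nat \<Rightarrow> nat \<Rightarrow> nat \<Rightarrow> hstate \<Rightarrow> bool" where
  "relaxed i a b u h \<longleftrightarrow> (d u a \<le> i \<longrightarrow> ar h 0 (u * n + b) \<le> Suc (d u a)) \<and>
     (d u b \<le> i \<longrightarrow> ar h 0 (u * n + a) \<le> Suc (d u b))"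

definition below :: "hstate \<Rightarrow> hstate \<Rightarrow> bool" where
  "below h' h \<longleftrightarrow> (\<forall>u<n. \<forall>v<n. ar h' 0 (u * n + v) \<le> ar h 0 (u * n + v))"

lemma tight_below: "below h' h \<Longrightarrow> tight i h \<Longrightarrow> tight i h'"
  unfolding below_def tight_def by (meson le_trans)

lemma relaxed_below: "below h' h \<Longrightarrow> relaxed i a b u h \<Longrightarrow> u < n \<Longrightarrow> a < n \<Longrightarrow> b < n \<Longrightarrow> relaxed i a b u h'"
  unfolding below_def relaxed_def by (meson le_trans)

lemma relax_step:
  assumes s: "sound h" and e: "{a, b} \<in> E" and u: "u < n" and l: "ar h 0 (u * n + a) + 1 < ar h 0 (u * n + b)"
  shows "sound (h\<lparr>ar := (ar h)(0 := (ar h 0)(u * n + b := ar h 0 (u * n + a) + 1))\<rparr>)"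
    "below (h\<lparr>ar := (ar h)(0 := (ar h 0)(u * n + b := ar h 0 (u * n + a) + 1))\<rparr>) h"
proof -
  have ab: "a < n" "b < n" using edgeD[OF e] by auto
  have "d u b \<le> d u a + 1" using d_tri[of u a b] d_edge[OF e] ab u by simp
  also have "\<dots> \<le> ar h 0 (u * n + a) + 1" using s ab u unfolding sound_def by simp
  finally show "sound (h\<lparr>ar := (ar h)(0 := (ar h 0)(u * n + b := ar h 0 (u * n + a) + 1))\<rparr>)"
    using s ab unfolding sound_def by (auto simp: index_eq_iff)
  show "below (h\<lparr>ar := (ar h)(0 := (ar h 0)(u * n + b := ar h 0 (u * n + a) + 1))\<rparr>) h"
    using l ab unfolding below_def by (auto simp: index_eq_iff)
qed

lemma below_refl: "below h h"
  by (simp add: below_def)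

lemma below_trans: "below h'' h' \<Longrightarrow> below h' h \<Longrightarrow> below h'' h"
  unfolding below_def by (meson le_trans)

lemma half_relax:
  assumes "sound h" "{rg h a, rg h b} \<in> E" "rg h rU < n" "rg h rN = n"
  shows "hwp N (HIf (Lt (Add (dist_at rU a) (K 1)) (dist_at rU b)) (HStore 0 (ix rU b) (Add (dist_at rU a) (K 1))) HSkip)
    (\<lambda>t h'. t \<le> 2 \<and> rg h' = rg h \<and> sound h' \<and> below h' h \<and>
       ar h' 0 (rg h rU * n + rg h b) \<le> ar h 0 (rg h rU * n + rg h a) + 1) h"
  using relax_step[OF assms(1-3)] assms by (auto simp: below_refl)

lemma relax_body:
  assumes a: "sound h" "tight i h" and e: "{rg h rA, rg h rB} \<in> E" and u: "rg h rU < n" "rg h rN = n"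
  shows "hwp N
     (HIf (Lt (Add (dist_at rU rA) (K 1)) (dist_at rU rB)) (HStore 0 (ix rU rB) (Add (dist_at rU rA) (K 1))) HSkip ;;
      HIf (Lt (Add (dist_at rU rB) (K 1)) (dist_at rU rA)) (HStore 0 (ix rU rA) (Add (dist_at rU rB) (K 1))) HSkip)
    (\<lambda>t h'. t \<le> 4 \<and> rg h' = rg h \<and> sound h' \<and> below h' h \<and> relaxed i (rg h rA) (rg h rB) (rg h rU) h') h"
  unfolding hwp_Seq
proof (rule hwp_mono[OF half_relax[OF a(1) e u]], elim conjE)
  let ?u = "rg h rU" and ?a = "rg h rA" and ?b = "rg h rB"
  have ab: "?a < n" "?b < n" using edgeD[OF e] by auto
  fix t :: nat and h1 assume 1: "t \<le> 2" "rg h1 = rg h" "sound h1" "below h1 h"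
    "ar h1 0 (?u * n + ?b) \<le> ar h 0 (?u * n + ?a) + 1"
  have e': "{rg h1 rB, rg h1 rA} \<in> E" using e 1 by (simp add: insert_commute)
  have u': "rg h1 rU < n" "rg h1 rN = n" using u 1 by auto
  show "hwp N (HIf (Lt (Add (dist_at rU rB) (K 1)) (dist_at rU rA)) (HStore 0 (ix rU rA) (Add (dist_at rU rB) (K 1))) HSkip)
    (\<lambda>t' h'. t + t' \<le> 4 \<and> rg h' = rg h \<and> sound h' \<and> below h' h \<and> relaxed i ?a ?b ?u h') h1"
  proof (rule hwp_mono[OF half_relax[OF 1(3) e' u']], elim conjE)
    fix t' :: nat and h2 assume 2: "t' \<le> 2" "rg h2 = rg h1" "sound h2" "below h2 h1"
      "ar h2 0 (rg h1 rU * n + rg h1 rA) \<le> ar h1 0 (rg h1 rU * n + rg h1 rB) + 1"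
    have "ar h2 0 (?u * n + ?b) \<le> ar h1 0 (?u * n + ?b)" "ar h1 0 (?u * n + ?b) \<le> ar h 0 (?u * n + ?b)"
      using 1(4) 2(4) u ab unfolding below_def by auto
    then have "relaxed i ?a ?b ?u h2"
      using 1(2,5) 2(5) a(2) u ab unfolding relaxed_def tight_def by fastforce
    then show "t + t' \<le> 4 \<and> rg h2 = rg h \<and> sound h2 \<and> below h2 h \<and> relaxed i ?a ?b ?u h2"
      using 1 2 below_trans by auto
  qed
qed

lemma sound_set_rg [simp]: "sound (h\<lparr>rg := f\<rparr>) = sound h"
  and tight_set_rg [simp]: "tight i (h\<lparr>rg := f\<rparr>) = tight i h"
  and relaxed_set_rg [simp]: "relaxed i a b u (h\<lparr>rg := f\<rparr>) = relaxed i a b u h"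
  and below_set_rg [simp]: "below (h\<lparr>rg := f\<rparr>) h' = below h h'"
  by (simp_all add: sound_def tight_def relaxed_def below_def)

lemma relax_correct:
  assumes a: "sound h" "tight i h" and e: "{rg h rA, rg h rB} \<in> E" and n: "rg h rN = n"
  shows "hwp N c_relax (\<lambda>t h'. t \<le> 2 + n * 6 \<and> sound h' \<and> below h' h \<and>
    (\<forall>u<n. relaxed i (rg h rA) (rg h rB) u h')) h"
  unfolding c_relax_def
proof (rule hwp_for[where L = n and T = 4 and I = "\<lambda>u h'. sound h' \<and> below h' h \<and>
    (\<forall>u'<u. u' < n \<longrightarrow> relaxed i (rg h rA) (rg h rB) u' h')"], goal_cases)
  case (5 h')
  have r: "rg h' rA = rg h rA" "rg h' rB = rg h rB" "rg h' rN = n" using 5(3) n by (auto simp: agree_def)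
  have ab: "rg h rA < n" "rg h rB < n" using edgeD[OF e] by auto
  have t: "tight i h'" using 5(1) a(2) tight_below by blast
  show ?case
  proof (rule hwp_mono[OF relax_body[of h' i]], goal_cases)
    case (6 t h2)
    then have "relaxed i (rg h rA) (rg h rB) u' h2" if "u' < Suc (rg h' rU)" "u' < n" for u'
      using that 5(1) ab r relaxed_below[of h2 h' i "rg h rA" "rg h rB" u'] by (cases "u' = rg h' rU") auto
    then show ?case using 6 5(1) below_trans by blast
  qed (use 5 r e t in auto)
qed (use a n in \<open>auto simp: agree_def below_refl\<close>)

lemma round_correct:
  assumes a: "sound h" "tight i h" and p: "params h" "input_ok h"
  shows "hwp N c_round (\<lambda>t h'. t \<le> 2 + length es * (n * 6 + 6) \<and> sound h' \<and> tight (Suc i) h') h"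
  unfolding c_round_def
proof (rule hwp_for[where L = "length es" and T = "4 + n * 6" and I = "\<lambda>j h'. sound h' \<and> below h' h \<and>
    (\<forall>j'<j. \<forall>u<n. j' < length es \<longrightarrow> relaxed i (fst (es ! j')) (snd (es ! j')) u h')"], goal_cases)
  case (5 h')
  let ?j = "rg h' rJ"
  have r: "rg h' rN = n" "lo h' = lo h" using 5(3) p by (auto simp: agree_def c_relax_def params_def)
  have es: "lo h (3 + (?j + ?j)) = fst (es ! ?j)" "lo h (4 + (?j + ?j)) = snd (es ! ?j)"
    using p(2) 5(2) by (auto simp: input_ok_def)
  \<comment> \<open>The bound of \<open>length es\<close> by the square of \<open>n\<close> keeps
    the whole edge list inside the raw memory.\<close>
  have "4 + (?j + ?j) < 4 + 2 * (n * n)" using 5(2) length_es_le by linarith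
  also have "1 \<le> n * n" using n_pos by (cases n) auto
  then have "4 + 2 * (n * n) \<le> N" by linarith
  finally have N: "4 + (?j + ?j) < N" .
  have t: "tight i h'" using 5(1) a(2) tight_below by blast
  let ?h = "set_rg rB (snd (es ! ?j)) (set_rg rA (fst (es ! ?j)) h')"
  have "hwp N c_relax (\<lambda>t h2. 1 + (1 + t) \<le> 4 + n * 6 \<and> sound h2 \<and> below h2 h \<and>
    (\<forall>j'<Suc ?j. \<forall>u<n. j' < length es \<longrightarrow> relaxed i (fst (es ! j')) (snd (es ! j')) u h2)) ?h"
  proof (rule hwp_mono[OF relax_correct[of ?h i]], goal_cases)
    case (5 t h2)
    then have b: "below h2 h'" by (simp add: below_def)
    have "relaxed i (fst (es ! j')) (snd (es ! j')) u h2" if "j' < Suc ?j" "u < n" "j' < length es" for j' u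
      using that 5 \<open>sound h' \<and> _\<close> relaxed_below[OF b] edgeD[OF es_edge[OF that(3)]] by (cases "j' = ?j") auto
    then show ?case using 5 b \<open>sound h' \<and> _\<close> below_trans by auto
  qed (use 5(1) t r es_edge[OF 5(2)] in simp_all)
  then show ?case using N r es by simp
next
  case (6 h' t)
  have "tight (Suc i) h'" unfolding tight_def
  proof (intro allI impI)
    fix u v assume uv: "u < n" "v < n" "d u v \<le> Suc i"
    show "ar h' 0 (u * n + v) \<le> d u v"
    proof (cases "d u v = Suc i")
      case True
      \<comment> \<open>The edge from the predecessor \<open>w\<close> has been relaxed in this
        round, and the distance to \<open>w\<close> was exact before it.\<close>
      then obtain w where w: "{w, v} \<in> E" "d u w = i" using d_pred[of u v i] uv by auto
      obtain j where "j < length es" "es ! j = (w, v) \<or> es ! j = (v, w)" using edge_es[OF w(1)] by blast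
      with 6(1) uv(1) w(2) True show ?thesis unfolding relaxed_def by fastforce
    next
      case False
      then show ?thesis using uv tight_below[OF _ a(2)] 6(1) unfolding tight_def by auto
    qed
  qed
  then show ?case using 6 by (simp add: algebra_simps)
qed (use a p in \<open>auto simp: agree_def below_refl params_def c_relax_def\<close>)

lemma init_correct:
  assumes p: "params h"
  shows "hwp N c_init (\<lambda>t h'. t \<le> 4 + n * n * 3 + n * 3 \<and> sound h' \<and> tight 0 h') h"
  unfolding c_init_def hwp_Seq
proof (rule hwp_for[where L = "n * n" and T = 1 and I = "\<lambda>i h'. \<forall>c<i. ar h' 0 c = n"], goal_cases)
  case (5 h1)
  then have "rg h1 rN = n" using p by (auto simp: agree_def params_def)
  then show ?case using 5(1) by (auto simp: less_Suc_eq)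
next
  case (6 h1 t1)
  then have n: "rg h1 rN = n" using p by (auto simp: agree_def params_def)
  show ?case
  proof (rule hwp_for[where L = n and T = 1 and I = "\<lambda>i h'. \<forall>u<n. \<forall>v<n. ar h' 0 (u * n + v) = (if u = v \<and> u < i then 0 else n)"], goal_cases)
    case (5 h2)
    have "rg h2 rN = n" using 5(3) n by (auto simp: agree_def)
    then show ?case using 5(1,2) by (auto simp: index_eq_iff)
  next
    case (6 h2 t)
    have "sound h2" unfolding sound_def using 6(1) d_less by (auto simp: less_imp_le)
    moreover have "tight 0 h2" unfolding tight_def using 6(1) d_eq_0 by auto
    ultimately show ?case using 6(3) \<open>t1 \<le> _\<close> by (simp add: algebra_simps)
  qed (use 6(1) n in \<open>auto simp: agree_def index_less\<close>)
qed (use p in \<open>auto simp: agree_def params_def\<close>)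

lemma dist_correct:
  assumes p: "params h" "input_ok h"
  shows "hwp N c_dist (\<lambda>t h'. t \<le> 6 + n * n * 3 + n * 3 + n * (length es * (n * 6 + 6) + 4) \<and> dist_ok h') h"
  unfolding c_dist_def hwp_Seq
proof (rule hwp_frame[OF init_correct[OF p(1)]], elim conjE)
  fix t1 :: nat and h1 assume 1: "t1 \<le> 4 + n * n * 3 + n * 3" "sound h1" "tight 0 h1" "agree c_init h h1"
  have p1: "params h1" "input_ok h1" using 1(4) p by (auto simp: agree_def c_init_def params_def input_ok_def)
  show "hwp N (HFor rI (R rN) c_round) (\<lambda>t h'. t1 + t \<le> 6 + n * n * 3 + n * 3 + n * (length es * (n * 6 + 6) + 4) \<and> dist_ok h') h1"
  proof (rule hwp_for[where L = n and T = "2 + length es * (n * 6 + 6)" and I = "\<lambda>i h'. sound h' \<and> tight i h'"], goal_cases)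
    case (5 h2)
    have "params h2" "input_ok h2" using 5(3) p1 by (auto simp: agree_def c_round_def c_relax_def params_def input_ok_def)
    then show ?case using 5(1) by (intro round_correct) auto
  next
    case (6 h2 t)
    \<comment> \<open>After \<open>n\<close> rounds all distances up to \<open>n\<close> are exact,
      hence all distances.\<close>
    have "dist_ok h2" unfolding dist_ok_def
      using 6(1) d_less unfolding sound_def tight_def by (simp add: order_antisym less_imp_le)
    then show ?case using 6(3) 1(1) by (simp add: algebra_simps)
  qed (use 1 p1 in \<open>auto simp: agree_def params_def c_round_def c_relax_def\<close>)
qed

lemma diam_correct:
  assumes p: "params h" "dist_ok h"
  shows "hwp N c_diam (\<lambda>t h'. t \<le> 4 + n * (n * 5 + 4) \<and> rg h' rRoot < n \<and>
    (\<exists>q<n. \<forall>u<n. \<forall>v<n. d u v \<le> d (rg h' rRoot) q)) h"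
  unfolding c_diam_def hwp_Seq hwp_Assign
proof (rule hwp_for[where L = n and T = "2 + n * 5" and I = "\<lambda>i h'. rg h' rRoot < n \<and>
    (\<exists>q<n. rg h' rBest = d (rg h' rRoot) q) \<and> (\<forall>u<i. u < n \<longrightarrow> (\<forall>v<n. d u v \<le> rg h' rBest))"], goal_cases)
  case (5 h1)
  show ?case
  proof (rule hwp_for[where L = n and T = 3 and I = "\<lambda>i h'. rg h' rRoot < n \<and>
    (\<exists>q<n. rg h' rBest = d (rg h' rRoot) q) \<and> (\<forall>u<rg h1 rU. u < n \<longrightarrow> (\<forall>v<n. d u v \<le> rg h' rBest)) \<and>
    (\<forall>v<i. v < n \<longrightarrow> d (rg h1 rU) v \<le> rg h' rBest)"], goal_cases)
    case (5 h2)
    have e: "rg h2 rN = n" "rg h2 rU = rg h1 rU" "ar h2 0 = ar h 0"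
      using 5(3) \<open>agree _ _ h1\<close> p by (auto simp: agree_def params_def)
    have D: "ar h 0 (rg h1 rU * n + rg h2 rV) = d (rg h1 rU) (rg h2 rV)"
      using p(2) 5(2) \<open>rg h1 rU < n\<close> by (simp add: dist_ok_def)
    show ?case using 5(1,2) \<open>rg h1 rU < n\<close> by (auto simp: e D less_Suc_eq) (meson less_imp_le le_trans)+
  next
    case (6 h2 t)
    then show ?case by (auto simp: less_Suc_eq)
  qed (use 5 p in \<open>auto simp: agree_def params_def\<close>)
next
  case 4
  \<comment> \<open>The initial best value 0 is attained by vertex 0 paired with itself.\<close>
  show ?case using n_pos by (auto intro!: exI[of _ 0])
next
  case (6 h1 t)
  then show ?case by (auto simp: algebra_simps)
qed (use p n_pos in \<open>auto simp: agree_def params_def\<close>)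

end

section \<open>Greedy choice of a separated set\<close>

definition c_kill :: hcom where
  "c_kill = HFor rV (R rN) (HIf (Lt (Add (R rT) (dist_at rRoot rCur)) (Add (dist_at rRoot rV) (dist_at rCur rV)))
     HSkip (HStore 1 (R rV) (K 0)))"

text \<open>The value \<open>n\<close> in \<open>rNxt\<close> stands for no candidate. The weak
  comparison lets the first candidate replace the initial best value 0.\<close>

definition c_next :: hcom where
  "c_next = HAssign rNxt (R rN) ;; HAssign rBest (K 0) ;; HFor rV (R rN)
     (HIf (An (Eq (A 1 (R rV)) (K 1)) (Nt (Lt (dist_at rRoot rV) (R rBest))))
       (HAssign rNxt (R rV) ;; HAssign rBest (dist_at rRoot rV)) HSkip)"

definition c_pick :: hcom where
  "c_pick = HStore 2 (R rCnt) (R rCur) ;; HAssign rCnt (Add (R rCnt) (K 1)) ;; c_kill ;; c_next ;; HAssign rCur (R rNxt)"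

definition c_greedy :: hcom where
  "c_greedy = HFor rV (R rN) (HStore 1 (R rV) (K 1)) ;; HAssign rCnt (K 0) ;; HAssign rCur (R rRoot) ;;
     HWhile (Lt (R rCur) (R rN)) c_pick"

text \<open>Thresholds are tried one by one from 0. At most about \<open>2 * n\<close> of them occur
  and each greedy run is quadratic in \<open>n\<close>, so linear search stays within the cubic
  budget.\<close>

definition c_search :: hcom where
  "c_search = HAssign rT (K 0) ;; HAssign rDone (K 0) ;; HWhile (Eq (R rDone) (K 0))
     (c_greedy ;; HIf (Lt (Add (R rK) (R rK)) (R rCnt)) (HAssign rT (Add (R rT) (K 1))) (HAssign rDone (K 1)))"

definition c_pad :: hcom where
  "c_pad = HWhile (Lt (R rCnt) (Add (R rK) (R rK))) (HStore 2 (R rCnt) (R rRoot) ;; HAssign rCnt (Add (R rCnt) (K 1)))"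

context instance_graph begin

definition base :: "nat \<Rightarrow> hstate \<Rightarrow> bool" where
  "base r h \<longleftrightarrow> params h \<and> dist_ok h \<and> rg h rRoot = r \<and> r < n"

lemma base_agree:
  assumes "base r h" "agree c h h'" "rN \<notin> rmods c" "rM \<notin> rmods c" "rK \<notin> rmods c" "rRoot \<notin> rmods c" "0 \<notin> amods c"
  shows "base r h'"
  using assms by (simp add: base_def params_def dist_ok_def agree_def)

lemma base_upd [simp]:
  "f rN = rg h rN \<Longrightarrow> f (Suc 0) = rg h rM \<Longrightarrow> f rK = rg h rK \<Longrightarrow> f rRoot = rg h rRoot \<Longrightarrow>
    base r (h\<lparr>rg := f\<rparr>) = base r h"
  "g 0 = ar h 0 \<Longrightarrow> base r (h\<lparr>ar := g\<rparr>) = base r h"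
  by (simp_all add: base_def params_def dist_ok_def)

lemma baseD:
  assumes "base r h"
  shows "rg h rN = n" "rg h rK = k" "rg h rRoot = r" "r < n"
    "\<And>u v. u < n \<Longrightarrow> v < n \<Longrightarrow> ar h 0 (u * n + v) = d u v"
  using assms by (auto simp: base_def params_def dist_ok_def)

text \<open>Equivalent to \<open>T / 2 < gp r a v\<close>, doubled and rearranged to stay within the
  naturals.\<close>

definition far :: "nat \<Rightarrow> nat \<Rightarrow> nat \<Rightarrow> nat \<Rightarrow> bool" where
  "far r T v a \<longleftrightarrow> T + d r a < d r v + d a v"

text \<open>\<open>s\<close> lists the \<open>c\<close> chosen vertices, \<open>al\<close> flags the
  candidates, \<open>cur\<close> is the next choice. As \<open>r\<close> is chosen first although
  its distance is 0, monotonicity of the distances is required only from index 1 on. The clause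
  about \<open>s 1\<close> ranges over all vertices: it provides the far end of the diametral
  pair.\<close>

definition ginv :: "nat \<Rightarrow> nat \<Rightarrow> (nat \<Rightarrow> nat) \<Rightarrow> nat \<Rightarrow> (nat \<Rightarrow> nat) \<Rightarrow> nat \<Rightarrow> bool" where
  "ginv r T s c al cur \<longleftrightarrow> (\<forall>i<c. s i < n) \<and>
     (\<forall>v<n. al v = (if \<forall>i<c. far r T v (s i) then 1 else 0)) \<and>
     (0 < c \<longrightarrow> s 0 = r) \<and> (c = 0 \<longrightarrow> cur = r) \<and>
     (\<forall>j<c. \<forall>i<j. far r T (s j) (s i)) \<and>
     (\<forall>j<c. \<forall>i<j. 1 \<le> i \<longrightarrow> d r (s j) \<le> d r (s i)) \<and>
     (1 < c \<longrightarrow> (\<forall>v<n. d r v \<le> d r (s 1))) \<and>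
     (cur < n \<longrightarrow> al cur = 1) \<and>
     (0 < c \<longrightarrow> (\<forall>v<n. al v = 1 \<longrightarrow> cur < n \<and> d r v \<le> d r cur)) \<and>
     (\<forall>i<c. 1 \<le> i \<longrightarrow> (\<forall>v<n. al v = 1 \<longrightarrow> d r v \<le> d r (s i)))"

lemmas ginvD =
  ginv_def[THEN iffD1, THEN conjunct1]
  ginv_def[THEN iffD1, THEN conjunct2, THEN conjunct1]
  ginv_def[THEN iffD1, THEN conjunct2, THEN conjunct2, THEN conjunct1]
  ginv_def[THEN iffD1, THEN conjunct2, THEN conjunct2, THEN conjunct2, THEN conjunct1]
  ginv_def[THEN iffD1, THEN conjunct2, THEN conjunct2, THEN conjunct2, THEN conjunct2, THEN conjunct1]
  ginv_def[THEN iffD1, THEN conjunct2, THEN conjunct2, THEN conjunct2, THEN conjunct2, THEN conjunct2, THEN conjunct1]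
  ginv_def[THEN iffD1, THEN conjunct2, THEN conjunct2, THEN conjunct2, THEN conjunct2, THEN conjunct2, THEN conjunct2, THEN conjunct1]
  ginv_def[THEN iffD1, THEN conjunct2, THEN conjunct2, THEN conjunct2, THEN conjunct2, THEN conjunct2, THEN conjunct2, THEN conjunct2, THEN conjunct1]
  ginv_def[THEN iffD1, THEN conjunct2, THEN conjunct2, THEN conjunct2, THEN conjunct2, THEN conjunct2, THEN conjunct2, THEN conjunct2, THEN conjunct2, THEN conjunct1]
  ginv_def[THEN iffD1, THEN conjunct2, THEN conjunct2, THEN conjunct2, THEN conjunct2, THEN conjunct2, THEN conjunct2, THEN conjunct2, THEN conjunct2, THEN conjunct2]

lemma ginv_step:
  assumes g: "ginv r T s c al cur" and cur: "cur < n" and r: "r < n"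
    and al': "\<And>v. v < n \<Longrightarrow> al' v = (if far r T v cur then al v else 0)"
    and nxt: "nxt < n \<longrightarrow> al' nxt = 1" "\<forall>v<n. al' v = 1 \<longrightarrow> nxt < n \<and> d r v \<le> d r nxt"
  shows "ginv r T (s(c := cur)) (Suc c) al' nxt"
proof -
  note g1 = ginvD(1)[OF g] and g2 = ginvD(2)[OF g, rule_format] and g3 = ginvD(3,4)[OF g] and g4 = ginvD(5)[OF g]
    and g5 = ginvD(6)[OF g] and g6 = ginvD(7)[OF g] and g7 = mp[OF ginvD(8)[OF g] cur] and g9 = ginvD(10)[OF g]
  have g8: "0 < c \<longrightarrow> (\<forall>v<n. al v = 1 \<longrightarrow> d r v \<le> d r cur)" using ginvD(9)[OF g] by blast
  have a': "al' v = 1 \<Longrightarrow> al v = 1" if "v < n" for v using al'[OF that] by (auto split: if_splits)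
  have cur_far: "far r T cur (s i)" if "i < c" for i 
  proof (rule ccontr)
    assume "\<not> ?thesis"
    then have "\<not> (\<forall>i<c. far r T cur (s i))" using that by blast
    then have "al cur = 0" using g2[OF cur] by (simp only: if_False)
    with g7 show False by simp
  qed
  have "\<forall>v<n. al' v = (if \<forall>i<Suc c. far r T v ((s(c := cur)) i) then 1 else 0)"
  proof (intro allI impI)
    fix v assume v: "v < n"
    have "(\<forall>i<Suc c. far r T v ((s(c := cur)) i)) \<longleftrightarrow> (\<forall>i<c. far r T v (s i)) \<and> far r T v cur"
      by (auto simp: less_Suc_eq)
    then show "al' v = (if \<forall>i<Suc c. far r T v ((s(c := cur)) i) then 1 else 0)"
      using g2[OF v] al'[OF v] by simp
  qed
  moreover have "\<forall>j<Suc c. \<forall>i<j. far r T ((s(c := cur)) j) ((s(c := cur)) i)"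
    using g4 cur_far by (auto simp: less_Suc_eq)
  moreover have "\<forall>j<Suc c. \<forall>i<j. 1 \<le> i \<longrightarrow> d r ((s(c := cur)) j) \<le> d r ((s(c := cur)) i)"
    using g5 g9 g7 cur by (auto simp: less_Suc_eq)
  moreover have "\<forall>v<n. d r v \<le> d r ((s(c := cur)) 1)" if "1 < Suc c"
  proof (cases "c = 1")
    case True
    have "d r v \<le> d r cur" if v: "v < n" for v
    proof (cases "al v = 1")
      case False
      \<comment> \<open>A vertex discarded because of \<open>r\<close> is within
        \<open>T / 2\<close> of \<open>r\<close>, whereas \<open>cur\<close> is not; so
        \<open>cur\<close> is farthest from \<open>r\<close> among all vertices and not only among
        the candidates.\<close>
      then have "\<not> far r T v r" using g2[OF v] True g3 by (auto split: if_splits)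
      moreover have "far r T cur r" using cur_far[of 0] True g3 by simp
      ultimately show ?thesis unfolding far_def using r by simp
    qed (use g8 True v in auto)
    then show ?thesis using True by simp
  qed (use g6 that in auto)
  moreover have "\<forall>i<Suc c. 1 \<le> i \<longrightarrow> (\<forall>v<n. al' v = 1 \<longrightarrow> d r v \<le> d r ((s(c := cur)) i))"
    using g9 g8 a' by (auto simp: less_Suc_eq)
  ultimately show ?thesis using g1 g3 nxt cur unfolding ginv_def by (auto simp: less_Suc_eq)
qed

lemma kill_correct:
  assumes b: "base r h" and cur: "rg h rCur < n"
  shows "hwp N c_kill (\<lambda>t h'. t \<le> 2 + n * 4 \<and>
    (\<forall>v<n. ar h' 1 v = (if far r (rg h rT) v (rg h rCur) then ar h 1 v else 0))) h"
  unfolding c_kill_def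
proof (rule hwp_for[where L = n and T = 2 and I = "\<lambda>i h'. \<forall>v<n. ar h' 1 v =
    (if v < i \<and> \<not> far r (rg h rT) v (rg h rCur) then 0 else ar h 1 v)"], goal_cases)
  case (5 h')
  have e: "rg h' rN = n" "rg h' rRoot = r" "rg h' rCur = rg h rCur" "rg h' rT = rg h rT" "ar h' 0 = ar h 0"
    using 5(3) baseD[OF b] by (auto simp: agree_def)
  show ?case using 5(1,2) cur baseD[OF b] by (auto simp: e far_def less_Suc_eq)
qed (use baseD[OF b] in \<open>auto simp: agree_def\<close>)

lemma next_correct:
  assumes b: "base r h"
  shows "hwp N c_next (\<lambda>t h'. t \<le> 4 + n * 5 \<and> (rg h' rNxt < n \<longrightarrow> ar h 1 (rg h' rNxt) = 1) \<and>
    (\<forall>v<n. ar h 1 v = 1 \<longrightarrow> rg h' rNxt < n \<and> d r v \<le> d r (rg h' rNxt))) h"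
  unfolding c_next_def hwp_Seq hwp_Assign
proof (rule hwp_for[where L = n and T = 3 and I = "\<lambda>i h'.
    (rg h' rNxt < n \<and> ar h 1 (rg h' rNxt) = 1 \<and> rg h' rBest = d r (rg h' rNxt) \<or> rg h' rNxt = n \<and> rg h' rBest = 0) \<and>
    (\<forall>v<i. v < n \<longrightarrow> ar h 1 v = 1 \<longrightarrow> rg h' rNxt < n \<and> d r v \<le> rg h' rBest)"], goal_cases)
  case (5 h')
  have e: "rg h' rN = n" "rg h' rRoot = r" "ar h' 0 = ar h 0" "ar h' (Suc 0) = ar h (Suc 0)"
    using 5(3) baseD[OF b] by (auto simp: agree_def)
  have D: "ar h 0 (r * n + rg h' rV) = d r (rg h' rV)" using baseD[OF b] 5(2) by simp
  have c: "hbval h' (An (Eq (A 1 (R rV)) (K 1)) (Nt (Lt (dist_at rRoot rV) (R rBest)))) \<longleftrightarrow>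
    ar h 1 (rg h' rV) = 1 \<and> rg h' rBest \<le> d r (rg h' rV)"
    by (auto simp: e D)
  show ?case unfolding hwp_If c using 5(1,2) by (auto simp: e D less_Suc_eq)
qed (use baseD[OF b] in \<open>auto simp: agree_def\<close>)

definition gstate :: "nat \<Rightarrow> nat \<Rightarrow> hstate \<Rightarrow> bool" where
  "gstate r T h \<longleftrightarrow> base r h \<and> rg h rT = T \<and> ginv r T (ar h 2) (rg h rCnt) (ar h 1) (rg h rCur)"

lemma pick_correct:
  assumes g: "gstate r T h" and cur: "rg h rCur < n"
  shows "hwp N c_pick (\<lambda>t h'. t \<le> 9 + n * 9 \<and> gstate r T h' \<and>
    (\<forall>v<n. ar h' 1 v = (if far r T v (rg h rCur) then ar h 1 v else 0))) h"
proof -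
  let ?c = "rg h rCnt" and ?cur = "rg h rCur"
  let ?h = "set_rg rCnt (?c + 1) (h\<lparr>ar := (ar h)(2 := (ar h 2)(?c := ?cur))\<rparr>)"
  have b: "base r ?h" and T: "rg ?h rT = T" using g by (simp_all add: gstate_def)
  have "hwp N c_kill (\<lambda>t1. hwp N c_next (\<lambda>t2 h'. 1 + (1 + (t1 + (t2 + 1))) \<le> 9 + n * 9 \<and> gstate r T (set_rg rCur (rg h' rNxt) h') \<and>
    (\<forall>v<n. ar h' 1 v = (if far r T v ?cur then ar h 1 v else 0)))) ?h"
  proof (rule hwp_frame[OF kill_correct[OF b]], goal_cases)
    case (2 t1 h1)
    have b1: "base r h1" by (rule base_agree[OF b 2(2)]) (simp_all add: c_kill_def)
    have e1: "rg h1 rT = T" "rg h1 rCnt = ?c + 1" "ar h1 2 = (ar h 2)(?c := ?cur)"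
      using 2(2) T by (auto simp: agree_def c_kill_def)
    have al: "ar h1 1 v = (if far r T v ?cur then ar h 1 v else 0)" if "v < n" for v
      using 2(1) that T by simp
    show ?case
    proof (rule hwp_frame[OF next_correct[OF b1]], goal_cases)
      case (1 t2 h2)
      have b2: "base r h2" by (rule base_agree[OF b1 1(2)]) (simp_all add: c_next_def)
      have e2: "rg h2 rT = T" "rg h2 rCnt = ?c + 1" "ar h2 2 = (ar h 2)(?c := ?cur)" "ar h2 1 = ar h1 1"
        using 1(2) e1 by (auto simp: agree_def c_next_def)
      have "ginv r T ((ar h 2)(?c := ?cur)) (Suc ?c) (ar h1 1) (rg h2 rNxt)"
        using g baseD(4)[OF b] al 1(1) by (intro ginv_step[OF _ cur]) (simp_all add: gstate_def)
      then show ?case using 2(1) 1(1) b2 e2 al by (simp add: gstate_def)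
    qed
  qed (use cur in simp)
  then show ?thesis unfolding c_pick_def by (simp add: gstate_def)
qed

lemma greedy_correct:
  assumes b: "base r h"
  shows "hwp N c_greedy (\<lambda>t h'. t \<le> 5 + n * (13 + n * 9) \<and> gstate r (rg h rT) h' \<and> n \<le> rg h' rCur) h"
  unfolding c_greedy_def hwp_Seq
proof (rule hwp_for[where L = n and T = 1 and I = "\<lambda>i h'. \<forall>v<i. ar h' 1 v = 1"], goal_cases)
  case (6 h1 t1)
  have b1: "base r h1" by (rule base_agree[OF b 6(2)]) simp_all
  have T1: "rg h1 rT = rg h rT" using 6(2) by (simp add: agree_def)
  let ?h = "set_rg rCur r (set_rg rCnt 0 h1)"
  have "hwp N (HWhile (Lt (R rCur) (R rN)) c_pick) (\<lambda>t h'. t1 + (1 + (1 + t)) \<le> 5 + n * (13 + n * 9) \<and> gstate r (rg h rT) h' \<and> n \<le> rg h' rCur) ?h"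
  proof (rule hwp_while[where I = "gstate r (rg h rT)" and T = "9 + n * 9" and \<mu> = "\<lambda>h. card {v \<in> {..<n}. ar h 1 v = 1}"], goal_cases)
    case 1
    show ?case using b1 T1 6(1) by (simp add: gstate_def ginv_def)
  next
    case (2 h2)
    have cur: "rg h2 rCur < n" and b2: "base r h2" using 2(1,2) baseD(1)[of r h2] by (auto simp: gstate_def)
    show ?case
    proof (rule hwp_mono[OF pick_correct[OF 2(1) cur]], goal_cases)
      case (1 t h3)
      have al: "ar h3 1 v = (if far r (rg h rT) v (rg h2 rCur) then ar h2 1 v else 0)" if "v < n" for v
        using 1 that by blast
      have "ginv r (rg h rT) (ar h2 2) (rg h2 rCnt) (ar h2 1) (rg h2 rCur)" using 2(1) unfolding gstate_def by blast
      then have "ar h2 1 (rg h2 rCur) = 1" using ginvD(8) cur by blast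
      \<comment> \<open>A chosen vertex removes its own flag, so the number of flags drops in each
        iteration.\<close>
      moreover have "\<not> far r (rg h rT) (rg h2 rCur) (rg h2 rCur)" using cur by (simp add: far_def)
      then have "ar h3 1 (rg h2 rCur) = 0" using al[OF cur] by simp
      moreover have "{v \<in> {..<n}. ar h3 1 v = 1} \<subseteq> {v \<in> {..<n}. ar h2 1 v = 1}"
      proof (intro subsetI)
        fix x assume "x \<in> {v \<in> {..<n}. ar h3 1 v = 1}"
        then show "x \<in> {v \<in> {..<n}. ar h2 1 v = 1}" using al[of x] by (cases "far r (rg h rT) x (rg h2 rCur)") auto
      qed
      ultimately have "{v \<in> {..<n}. ar h3 1 v = 1} \<subset> {v \<in> {..<n}. ar h2 1 v = 1}"
        using cur by (metis (mono_tags, lifting) lessThan_iff mem_Collect_eq psubsetI zero_neq_one)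
      then show ?case using 1 by (simp add: psubset_card_mono)
    qed
  next
    case (3 h2 t)
    have "card {v \<in> {..<n}. ar ?h 1 v = 1} \<le> n" using card_mono[of "{..<n}" "{v \<in> {..<n}. ar ?h 1 v = 1}"] by auto
    then have "card {v \<in> {..<n}. ar ?h 1 v = 1} * Suc (9 + n * 9) \<le> n * Suc (9 + n * 9)" by (rule mult_le_mono1)
    then have "t \<le> Suc (n * Suc (9 + n * 9))" using 3(4) by linarith
    then show ?case using 3(1,2) 6(3) baseD(1)[of r h2] by (simp add: gstate_def algebra_simps)
  qed
  then show ?case using baseD(3)[OF b1] by simp
qed (use baseD[OF b] in \<open>auto simp: agree_def less_Suc_eq\<close>)

text \<open>The last clause is \<open>T / 2 < gp r z m\<close> for both orders of \<open>m\<close>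
  and \<open>z\<close>. The vertex \<open>s\<close> will serve as the other end of the diametral
  pair in \<open>greedy_separated\<close>.\<close>

definition separated :: "nat \<Rightarrow> nat \<Rightarrow> bool" where
  "separated r T \<longleftrightarrow> (\<exists>S. S \<subseteq> {..<n} \<and> r \<in> S \<and> 2 * k < card S \<and>
     (\<exists>s\<in>S. s \<noteq> r \<and> (\<forall>v<n. d r v \<le> d r s)) \<and>
     (\<forall>m\<in>S. \<forall>z\<in>S. m \<noteq> r \<longrightarrow> z \<noteq> r \<longrightarrow> m \<noteq> z \<longrightarrow> T + d r z < d r m + d z m))"

definition covering :: "nat \<Rightarrow> nat \<Rightarrow> nat set \<Rightarrow> bool" where
  "covering r T S \<longleftrightarrow> S \<subseteq> {..<n} \<and> r \<in> S \<and> (\<forall>v<n. \<exists>a\<in>S. d r v + d a v \<le> T + d r a)"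

lemma ginv_far:
  assumes "ginv r T s c al cur" "i < c" "j < c" "i \<noteq> j"
  shows "s i \<noteq> s j"
proof -
  have "\<not> far r T x x" if "x < n" for x using that by (simp add: far_def)
  moreover have "far r T (s i) (s j) \<or> far r T (s j) (s i)" "s i < n"
    using ginvD(1,5)[OF assms(1)] assms(2-4) by (metis linorder_neqE_nat)+
  ultimately show ?thesis by auto
qed

text \<open>The invariant separates later choices from earlier ones only; decreasing distance from
  \<open>r\<close> supplies the other order. The bound on \<open>T\<close> comes from
  \<open>s 1\<close> being far from \<open>r\<close>, and it ends the search.\<close>

lemma ginv_separated:
  assumes g: "ginv r T s c al cur" and c: "2 * k < c" and r: "r < n"
  shows "separated r T" "T < 2 * n"
proof -
  have c1: "1 < c" using c k by linarith
  have inj: "inj_on s {..<c}" using ginv_far[OF g] by (auto simp: inj_on_def)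
  have c0: "0 < c" using c1 by linarith
  note lt = ginvD(1)[OF g, rule_format] and s0 = mp[OF ginvD(3)[OF g] c0] and s1 = mp[OF ginvD(7)[OF g] c1]
    and fr = ginvD(5)[OF g, rule_format] and dp = ginvD(6)[OF g, rule_format]
  have "T + d r (s j) < d r (s i) + d (s j) (s i)" if ij: "i < c" "j < c" "s i \<noteq> r" "s j \<noteq> r" "i \<noteq> j" for i j
  proof -
    have pos: "1 \<le> i" "1 \<le> j" using ij s0 by (metis less_one not_le)+
    consider "i < j" | "j < i" using ij by linarith
    then show ?thesis
    proof cases
      case 1
      \<comment> \<open>Here \<open>s i\<close> was chosen before \<open>s j\<close>, so
        \<open>d r (s j) \<le> d r (s i)\<close>; exchanging the two terms only weakens the
        separation of \<open>s j\<close> from \<open>s i\<close>.\<close>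
      then show ?thesis using fr[of j i] dp[of j i] ij pos d_sym[of "s i" "s j"] lt unfolding far_def by simp
    next
      case 2
      then show ?thesis using fr[of i j] ij unfolding far_def by simp
    qed
  qed
  then have sep: "\<forall>m\<in>s ` {..<c}. \<forall>z\<in>s ` {..<c}. m \<noteq> r \<longrightarrow> z \<noteq> r \<longrightarrow> m \<noteq> z \<longrightarrow> T + d r z < d r m + d z m"
    by blast
  moreover have "s 1 \<noteq> r" using ginv_far[OF g, of 1 0] s0 c1 c0 by simp
  moreover have "card (s ` {..<c}) = c" using inj by (simp add: card_image)
  moreover have "s ` {..<c} \<subseteq> {..<n}" "r \<in> s ` {..<c}" "s 1 \<in> s ` {..<c}" using lt s0 c1 by (auto intro!: image_eqI[of _ s 0])
  ultimately show "separated r T" unfolding separated_def using c s1 by (intro exI[of _ "s ` {..<c}"]) auto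
  have "far r T (s 1) r" using fr[of 1 0] c1 s0 by simp
  then show "T < 2 * n" using d_less[of r "s 1"] r lt[OF c1] unfolding far_def by simp
qed

lemma ginv_covering:
  assumes g: "ginv r T s c al cur" and cur: "n \<le> cur" and r: "r < n"
  shows "covering r T (s ` {..<c})"
proof -
  have c: "0 < c" using ginvD(4)[OF g] cur r by (cases c) auto
  have "\<exists>i<c. \<not> far r T v (s i)" if v: "v < n" for v
  proof (rule ccontr)
    assume "\<not> ?thesis"
    then have "al v = 1" using ginvD(2)[OF g] v by simp
    then show False using ginvD(9)[OF g] v cur c by auto
  qed
  then have "\<forall>v<n. \<exists>a\<in>s ` {..<c}. d r v + d a v \<le> T + d r a" unfolding far_def not_less by auto
  moreover have "s ` {..<c} \<subseteq> {..<n}" "s 0 = r" using ginvD(1,3)[OF g] c by auto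
  ultimately show ?thesis using c unfolding covering_def by (auto intro!: image_eqI[of _ s 0])
qed

text \<open>The invariant retains the failure of the previous threshold as
  \<open>separated r (T - 1)\<close>. The final \<open>T\<close> thus comes with both a covering and
  a witness that it is not much too large.\<close>

lemma search_correct:
  assumes b: "base r h"
  shows "hwp N c_search (\<lambda>t h'. t \<le> 3 + (2 * n + 1) * (8 + n * (13 + n * 9)) \<and> base r h' \<and>
    (rg h' rT = 0 \<or> separated r (rg h' rT - 1)) \<and> rg h' rCnt \<le> 2 * k \<and>
    covering r (rg h' rT) (ar h' 2 ` {..<rg h' rCnt})) h"
proof -
  let ?h = "set_rg rDone 0 (set_rg rT 0 h)"
  let ?P = "\<lambda>h'. rg h' rCnt \<le> 2 * k \<and> covering r (rg h' rT) (ar h' 2 ` {..<rg h' rCnt})"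
  let ?c = "c_greedy ;; HIf (Lt (Add (R rK) (R rK)) (R rCnt)) (HAssign rT (Add (R rT) (K 1))) (HAssign rDone (K 1))"
  have "hwp N (HWhile (Eq (R rDone) (K 0)) ?c) (\<lambda>t h'. 1 + (1 + t) \<le> 3 + (2 * n + 1) * (8 + n * (13 + n * 9)) \<and> base r h' \<and>
    (rg h' rT = 0 \<or> separated r (rg h' rT - 1)) \<and> ?P h') ?h"
  proof (rule hwp_while[where T = "7 + n * (13 + n * 9)"
        and I = "\<lambda>h'. base r h' \<and> (rg h' rT = 0 \<or> separated r (rg h' rT - 1)) \<and> rg h' rT \<le> 2 * n \<and> (rg h' rDone \<noteq> 0 \<longrightarrow> ?P h')"
        and \<mu> = "\<lambda>h'. (2 * n - rg h' rT) + (if rg h' rDone = 0 then 1 else 0)"], goal_cases)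
    case (2 h1)
    have dn: "rg h1 rDone = 0" using 2(2) by simp
    have "base r h1" using 2(1) by blast
    then show ?case unfolding hwp_Seq
    proof (rule hwp_frame[OF greedy_correct], goal_cases)
      case (1 t h2)
      have b2: "base r h2" and T2: "rg h2 rT = rg h1 rT" and r: "r < n"
        and g: "ginv r (rg h1 rT) (ar h2 2) (rg h2 rCnt) (ar h2 1) (rg h2 rCur)"
        using 1(1) baseD(4)[of r h2] by (auto simp: gstate_def)
      have D2: "rg h2 rDone = 0" using 1(2) dn by (simp add: agree_def c_greedy_def c_pick_def c_kill_def c_next_def)
      note K2 = baseD(2)[OF b2]
      show ?case
      proof (cases "2 * k < rg h2 rCnt")
        case True
        then show ?thesis using ginv_separated[OF g _ r] b2 T2 D2 K2 1(1) dn by simp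
      next
        case False
        then show ?thesis using ginv_covering[OF g _ r] b2 T2 D2 K2 1(1) 2(1) dn by simp
      qed
    qed
  next
    case (3 h1 t)
    then show ?case by (simp add: algebra_simps)
  qed (use b in simp)
  then show ?thesis unfolding c_search_def by simp
qed

text \<open>Exactly \<open>2 * k\<close> entries are needed to form \<open>k\<close> pairs;
  repeating \<open>r\<close> leaves the set of chosen vertices unchanged, as it contains
  \<open>r\<close> already.\<close>

lemma pad_correct:
  assumes b: "base r h" and c: "rg h rCnt \<le> 2 * k" and cov: "covering r T (ar h 2 ` {..<rg h rCnt})"
  shows "hwp N c_pad (\<lambda>t h'. t \<le> 1 + n * 6 \<and> covering r T (ar h' 2 ` {..<2 * k})) h"
  unfolding c_pad_def
proof (rule hwp_while[where T = 2 and I = "\<lambda>h'. base r h' \<and> rg h' rCnt \<le> 2 * k \<and> covering r T (ar h' 2 ` {..<rg h' rCnt})"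
      and \<mu> = "\<lambda>h'. 2 * k - rg h' rCnt"], goal_cases)
  case (2 h1)
  then have b1: "base r h1" and c1: "rg h1 rCnt < 2 * k" using baseD(2)[of r h1] by auto
  have "((ar h1 2)(rg h1 rCnt := r)) ` {..<Suc (rg h1 rCnt)} = insert r (ar h1 2 ` {..<rg h1 rCnt})"
    by (auto simp: lessThan_Suc)
  then have "covering r T (((ar h1 2)(rg h1 rCnt := r)) ` {..<Suc (rg h1 rCnt)})"
    using 2(1) unfolding covering_def by auto
  then show ?case using b1 c1 baseD(3)[OF b1] by simp
next
  case (3 h1 t)
  then have "rg h1 rCnt = 2 * k" using baseD(2)[of r h1] by auto
  moreover have "t \<le> 1 + n * 6" using 3(4) k by simp
  ultimately show ?case using 3 by simp
qed (use b c cov in simp)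

end

section \<open>Pairing by local search\<close>

definition c_pairs :: hcom where
  "c_pairs = HFor rI (R rK) (HStore 3 (R rI) (A 2 (Add (R rI) (R rI))) ;;
     HStore 4 (R rI) (A 2 (Add (Add (R rI) (R rI)) (K 1))) ;; HStore 5 (R rI) (R rI)) ;; HAssign rSp (R rK)"

text \<open>\<open>rF\<close> encodes an improving reconnection with pair \<open>rU\<close>: 1
  exchanges the second points, 2 joins the two first points and the two second points.\<close>

definition c_scan :: hcom where
  "c_scan = HAssign rF (K 0) ;; HFor rJ (R rK) (HAssign rA (A 3 (R rJ)) ;; HAssign rB (A 4 (R rJ)) ;;
     HIf (Lt (Add (dist_at rX rY) (dist_at rA rB)) (Add (dist_at rX rB) (dist_at rA rY)))
       (HAssign rF (K 1) ;; HAssign rU (R rJ))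
       (HIf (Lt (Add (dist_at rX rY) (dist_at rA rB)) (Add (dist_at rX rA) (dist_at rY rB)))
         (HAssign rF (K 2) ;; HAssign rU (R rJ)) HSkip))"

definition c_swap :: hcom where
  "c_swap = HAssign rA (A 3 (R rU)) ;; HAssign rB (A 4 (R rU)) ;;
     HIf (Eq (R rF) (K 1)) (HStore 4 (R rP) (R rB) ;; HStore 4 (R rU) (R rY))
       (HStore 4 (R rP) (R rA) ;; HStore 3 (R rU) (R rY)) ;;
     HStore 5 (R rSp) (R rP) ;; HStore 5 (Add (R rSp) (K 1)) (R rU) ;; HAssign rSp (Add (R rSp) (K 2))"

definition c_opt :: hcom where
  "c_opt = HWhile (Lt (K 0) (R rSp)) (HAssign rSp (Sub (R rSp) (K 1)) ;; HAssign rP (A 5 (R rSp)) ;;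
     HAssign rX (A 3 (R rP)) ;; HAssign rY (A 4 (R rP)) ;; c_scan ;; HIf (Eq (R rF) (K 0)) HSkip c_swap)"

context instance_graph begin

definition settled :: "(nat \<Rightarrow> nat) \<Rightarrow> (nat \<Rightarrow> nat) \<Rightarrow> nat \<Rightarrow> nat \<Rightarrow> bool" where
  "settled X Y i j \<longleftrightarrow> d (X i) (Y j) + d (X j) (Y i) \<le> d (X i) (Y i) + d (X j) (Y j) \<and>
     d (X i) (X j) + d (Y i) (Y j) \<le> d (X i) (Y i) + d (X j) (Y j)"

definition pairs_ok :: "nat set \<Rightarrow> (nat \<Rightarrow> nat) \<Rightarrow> (nat \<Rightarrow> nat) \<Rightarrow> bool" where
  "pairs_ok S X Y \<longleftrightarrow> (\<forall>i<k. X i < n \<and> Y i < n) \<and> (\<forall>q\<in>S. \<exists>i<k. X i = q \<or> Y i = q)"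

text \<open>An unsettled couple of pairs has at least one member on the stack. Entries may repeat;
  only the set of stacked indices matters.\<close>

definition stack_ok :: "(nat \<Rightarrow> nat) \<Rightarrow> (nat \<Rightarrow> nat) \<Rightarrow> (nat \<Rightarrow> nat) \<Rightarrow> nat \<Rightarrow> bool" where
  "stack_ok X Y st sp \<longleftrightarrow> (\<forall>p<sp. st p < k) \<and>
     (\<forall>i<k. \<forall>j<k. i \<notin> st ` {..<sp} \<longrightarrow> j \<notin> st ` {..<sp} \<longrightarrow> settled X Y i j)"

definition weight :: "(nat \<Rightarrow> nat) \<Rightarrow> (nat \<Rightarrow> nat) \<Rightarrow> nat" where
  "weight X Y = (\<Sum>i<k. d (X i) (Y i))"

lemma settled_sym:
  assumes "pairs_ok S X Y" "i < k" "j < k" "settled X Y i j" shows "settled X Y j i"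
  using assms d_sym[of "X i" "X j"] d_sym[of "Y i" "Y j"] unfolding pairs_ok_def settled_def
  by (simp add: add.commute)

text \<open>The popped pair was compared with all pairs, including those still on the stack, so it
  can leave the stack for good until it is changed.\<close>

lemma stack_pop:
  assumes p: "pairs_ok S X Y" and s: "stack_ok X Y st (Suc sp)" and ok: "\<forall>j<k. settled X Y (st sp) j"
  shows "stack_ok X Y st sp"
  unfolding stack_ok_def
proof (intro conjI allI impI)
  fix i j assume ij: "i < k" "j < k" "i \<notin> st ` {..<sp}" "j \<notin> st ` {..<sp}"
  have "st sp < k" using s unfolding stack_ok_def by simp
  then have "i = st sp \<Longrightarrow> settled X Y i j" "j = st sp \<Longrightarrow> settled X Y i j"
    using ok ij settled_sym[OF p, of "st sp" i] by blast+
  moreover have "settled X Y i j" if "i \<noteq> st sp" "j \<noteq> st sp"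
  proof -
    have "i \<notin> st ` {..<Suc sp}" "j \<notin> st ` {..<Suc sp}" using that ij by (auto simp: lessThan_Suc)
    then show ?thesis using s ij unfolding stack_ok_def by blast
  qed
  ultimately show "settled X Y i j" by blast
qed (use s in \<open>simp add: stack_ok_def\<close>)

lemma weight_le: "pairs_ok S X Y \<Longrightarrow> weight X Y \<le> k * n"
  unfolding weight_def pairs_ok_def
  using sum_bounded_above[of "{..<k}" "\<lambda>i. d (X i) (Y i)" n] d_less by (simp add: less_imp_le)

lemma weight_swap:
  assumes PU: "P < k" "U < k" "P \<noteq> U" and same: "\<And>i. i \<noteq> P \<Longrightarrow> i \<noteq> U \<Longrightarrow> X' i = X i \<and> Y' i = Y i"
    and lt: "d (X P) (Y P) + d (X U) (Y U) < d (X' P) (Y' P) + d (X' U) (Y' U)"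
  shows "weight X Y < weight X' Y'"
proof -
  have split: "(\<Sum>i<k. f i) = f P + (f U + (\<Sum>i\<in>{..<k} - {P} - {U}. f i))" for f :: "nat \<Rightarrow> nat"
    using PU by (simp add: sum.remove[of "{..<k}" P] sum.remove[of "{..<k} - {P}" U])
  have "(\<Sum>i\<in>{..<k} - {P} - {U}. d (X' i) (Y' i)) = (\<Sum>i\<in>{..<k} - {P} - {U}. d (X i) (Y i))"
    using same by (intro sum.cong) auto
  then show ?thesis using lt unfolding weight_def split by simp
qed

text \<open>Only the pairs \<open>P\<close> and \<open>U\<close> change, and both are pushed; pairs
  off the stack keep their values. Since the four end points stay the same as a set, the pairs still
  meet all of \<open>S\<close>.\<close>

lemma swap_ok:
  assumes p: "pairs_ok S X Y" and s: "stack_ok X Y st (Suc sp)"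
    and PU: "st sp = P" "U < k" "P \<noteq> U" and same: "\<And>i. i \<noteq> P \<Longrightarrow> i \<noteq> U \<Longrightarrow> X' i = X i \<and> Y' i = Y i"
    and vals: "{X' P, Y' P, X' U, Y' U} = {X P, Y P, X U, Y U}"
  shows "pairs_ok S X' Y'" "stack_ok X' Y' (st(sp := P, Suc sp := U)) (Suc (Suc sp))"
proof -
  have P: "P < k" using s PU unfolding stack_ok_def by auto
  have lt: "X P < n" "Y P < n" "X U < n" "Y U < n" using p P PU unfolding pairs_ok_def by auto
  have "X' i < n \<and> Y' i < n" if "i < k" for i
  proof (cases "i = P \<or> i = U")
    case True
    then have "{X' i, Y' i} \<subseteq> {X P, Y P, X U, Y U}" unfolding vals[symmetric] by auto
    then show ?thesis using lt by auto
  next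
    case False
    then show ?thesis using same[of i] p that unfolding pairs_ok_def by auto
  qed
  moreover have "\<exists>i<k. X' i = q \<or> Y' i = q" if q: "q \<in> S" for q
  proof -
    obtain i where i: "i < k" "X i = q \<or> Y i = q" using p q unfolding pairs_ok_def by blast
    show ?thesis
    proof (cases "i = P \<or> i = U")
      case True
      then have "q \<in> {X' P, Y' P, X' U, Y' U}" using i unfolding vals by auto
      then show ?thesis using P PU by auto
    next
      case False
      then show ?thesis using same[of i] i by auto
    qed
  qed
  ultimately show "pairs_ok S X' Y'" unfolding pairs_ok_def by blast
  have img: "(st(sp := P, Suc sp := U)) ` {..<Suc (Suc sp)} = insert P (insert U (st ` {..<sp}))"
    by (auto simp: lessThan_Suc)
  show "stack_ok X' Y' (st(sp := P, Suc sp := U)) (Suc (Suc sp))"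
    unfolding stack_ok_def img
  proof (intro conjI allI impI)
    fix i j assume ij: "i < k" "j < k" "i \<notin> insert P (insert U (st ` {..<sp}))" "j \<notin> insert P (insert U (st ` {..<sp}))"
    then have "i \<notin> st ` {..<Suc sp}" "j \<notin> st ` {..<Suc sp}" using PU by (auto simp: lessThan_Suc)
    then have "settled X Y i j" using s ij unfolding stack_ok_def by blast
    then show "settled X' Y' i j" using same[of i] same[of j] ij unfolding settled_def by simp
  next
    fix p assume "p < Suc (Suc sp)"
    then show "(st(sp := P, Suc sp := U)) p < k" using s P PU unfolding stack_ok_def by (auto simp: less_Suc_eq)
  qed
qed

lemma pairs_correct:
  assumes b: "base r h" and S: "ar h 2 ` {..<2 * k} \<subseteq> {..<n}"
  shows "hwp N c_pairs (\<lambda>t h'. t \<le> 3 + n * 5 \<and> pairs_ok (ar h 2 ` {..<2 * k}) (ar h' 3) (ar h' 4) \<and>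
    rg h' rSp \<le> n \<and> stack_ok (ar h' 3) (ar h' 4) (ar h' 5) (rg h' rSp)) h"
  unfolding c_pairs_def hwp_Seq
proof (rule hwp_for[where L = k and T = 3 and I = "\<lambda>i h'. \<forall>j<i. ar h' 3 j = ar h 2 (2 * j) \<and>
    ar h' 4 j = ar h 2 (2 * j + 1) \<and> ar h' 5 j = j"], goal_cases)
  case (5 h1)
  then have "ar h1 2 = ar h 2" by (simp add: agree_def)
  then show ?case using 5(1) by (auto simp: less_Suc_eq mult_2)
next
  case (6 h1 t)
  have K: "rg h1 rK = k" using 6(2) baseD[OF b] by (simp add: agree_def)
  have lt: "ar h 2 i < n" if "i < 2 * k" for i using S that by auto
  have "\<exists>i<k. ar h1 3 i = q \<or> ar h1 4 i = q" if q: "q \<in> ar h 2 ` {..<2 * k}" for q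
  proof -
    obtain j where j: "j < 2 * k" "q = ar h 2 j" using q by auto
    have "j = 2 * (j div 2) \<or> j = 2 * (j div 2) + 1" "j div 2 < k" using j by auto
    then show ?thesis using 6(1) j by metis
  qed
  then have "pairs_ok (ar h 2 ` {..<2 * k}) (ar h1 3) (ar h1 4)"
    using 6(1) lt unfolding pairs_ok_def by auto
  moreover have "stack_ok (ar h1 3) (ar h1 4) (ar h1 5) k" using 6(1) unfolding stack_ok_def by force
  moreover have "t + 1 \<le> 3 + n * 5" using 6(3) mult_le_mono1[OF k(2), of 5] by simp
  ultimately show ?case using K k by simp
qed (use baseD[OF b] in \<open>auto simp: agree_def\<close>)

lemma scan_correct:
  assumes b: "base r h" and p: "pairs_ok S X Y" and P: "P < k"
    and XY: "ar h 3 = X" "ar h 4 = Y" "rg h rX = X P" "rg h rY = Y P"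
  shows "hwp N c_scan (\<lambda>t h'. t \<le> 3 + n * 8 \<and> (rg h' rF = 0 \<and> (\<forall>j<k. settled X Y P j) \<or>
    rg h' rF = 1 \<and> rg h' rU < k \<and>
      d (X P) (Y P) + d (X (rg h' rU)) (Y (rg h' rU)) < d (X P) (Y (rg h' rU)) + d (X (rg h' rU)) (Y P) \<or>
    rg h' rF = 2 \<and> rg h' rU < k \<and>
      d (X P) (Y P) + d (X (rg h' rU)) (Y (rg h' rU)) < d (X P) (X (rg h' rU)) + d (Y P) (Y (rg h' rU)))) h"
    (is "hwp N c_scan (\<lambda>t h'. t \<le> _ \<and> (_ \<or> ?R h')) h")
proof -
  have XYn: "X j < n" "Y j < n" if "j < k" for j using p that unfolding pairs_ok_def by auto
  show ?thesis
    unfolding c_scan_def hwp_Seq hwp_Assign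
  proof (rule hwp_for[where L = k and T = 6 and I = "\<lambda>i h'. rg h' rF = 0 \<and> (\<forall>j<i. settled X Y P j) \<or> ?R h'"], goal_cases)
    case (5 h1)
    define j where "j = rg h1 rJ"
    have jk: "j < k" using 5(2) j_def by simp
    have e: "rg h1 rN = n" "rg h1 rX = X P" "rg h1 rY = Y P" "ar h1 0 = ar h 0" "ar h1 3 = X" "ar h1 4 = Y"
      using 5(3) baseD[OF b] XY by (simp_all add: agree_def)
    let ?h = "set_rg rB (Y j) (set_rg rA (X j) h1)"
    have D: "ar h 0 (X P * n + Y P) = d (X P) (Y P)" "ar h 0 (X j * n + Y j) = d (X j) (Y j)"
      "ar h 0 (X P * n + Y j) = d (X P) (Y j)" "ar h 0 (X j * n + Y P) = d (X j) (Y P)"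
      "ar h 0 (X P * n + X j) = d (X P) (X j)" "ar h 0 (Y P * n + Y j) = d (Y P) (Y j)"
      using baseD(5)[OF b] XYn[OF jk] XYn[OF P] by auto
    have R: "rg h1 rF = 0 \<and> (\<forall>i<j. settled X Y P i) \<or> ?R h1" using 5(1) unfolding j_def .
    have "settled X Y P j \<longleftrightarrow> \<not> d (X P) (Y P) + d (X j) (Y j) < d (X P) (Y j) + d (X j) (Y P) \<and>
      \<not> d (X P) (Y P) + d (X j) (Y j) < d (X P) (X j) + d (Y P) (Y j)"
      unfolding settled_def by (simp add: not_less)
    then show ?case using R jk by (auto simp: e D j_def[symmetric] less_Suc_eq)
  next
    case (6 h1 t)
    have "1 + t \<le> 3 + n * 8" using 6(3) mult_le_mono1[OF k(2), of 8] by simp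
    then show ?case using 6(1) by blast
  qed (use baseD[OF b] in \<open>auto simp: agree_def\<close>)
qed

text \<open>The potential \<open>sp + 3 * (k * n - weight)\<close> pays for the stack: a pop without
  exchange lowers it by 1; an exchange lengthens the stack by 1 net but raises the integral weight
  by at least 1. The number of scans is therefore quadratic in \<open>n\<close>, and each scan is
  linear.\<close>

lemma opt_correct:
  assumes b: "base r h" and p: "pairs_ok S (ar h 3) (ar h 4)" and sp: "rg h rSp \<le> n"
    and s: "stack_ok (ar h 3) (ar h 4) (ar h 5) (rg h rSp)"
  shows "hwp N c_opt (\<lambda>t h'. t \<le> 1 + (n + 3 * (n * n)) * (17 + n * 8) \<and> pairs_ok S (ar h' 3) (ar h' 4) \<and>
    (\<forall>i<k. \<forall>j<k. settled (ar h' 3) (ar h' 4) i j)) h"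
  unfolding c_opt_def
proof (rule hwp_while[where T = "16 + n * 8" and \<mu> = "\<lambda>h'. rg h' rSp + 3 * (k * n - weight (ar h' 3) (ar h' 4))"
      and I = "\<lambda>h'. base r h' \<and> pairs_ok S (ar h' 3) (ar h' 4) \<and> stack_ok (ar h' 3) (ar h' 4) (ar h' 5) (rg h' rSp)"], goal_cases)
  case (2 h1)
  define X Y st sp where "X = ar h1 3" and "Y = ar h1 4" and "st = ar h1 5" and "sp = rg h1 rSp - 1"
  have sp: "rg h1 rSp = Suc sp" using 2(2) sp_def by simp
  have b1: "base r h1" and p1: "pairs_ok S X Y" and s1: "stack_ok X Y st (Suc sp)"
    using 2(1) sp unfolding X_def Y_def st_def by auto
  define P where "P = st sp"
  have Pk: "P < k" using s1 unfolding stack_ok_def P_def by simp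
  let ?h = "set_rg rY (Y P) (set_rg rX (X P) (set_rg rP P (set_rg rSp sp h1)))"
  have b': "base r ?h" using b1 by simp
  have w: "weight X Y \<le> k * n" using weight_le[OF p1] .
  have fin: "hwp N c_scan (\<lambda>t h2. hwp N (HIf (Eq (R rF) (K 0)) HSkip c_swap)
     (\<lambda>t' h3. 1 + (1 + (1 + (1 + (t + t')))) \<le> 16 + n * 8 \<and> (base r h3 \<and> pairs_ok S (ar h3 3) (ar h3 4) \<and>
       stack_ok (ar h3 3) (ar h3 4) (ar h3 5) (rg h3 rSp)) \<and>
       rg h3 rSp + 3 * (k * n - weight (ar h3 3) (ar h3 4)) < Suc sp + 3 * (k * n - weight X Y)) h2) ?h"
  proof (rule hwp_frame[OF scan_correct[OF b' p1 Pk]], goal_cases)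
    case (5 t h2)
    have b2: "base r h2" by (rule base_agree[OF b' 5(2)]) (simp_all add: c_scan_def)
    define U where "U = rg h2 rU"
    have e: "ar h2 3 = X" "ar h2 4 = Y" "ar h2 5 = st" "rg h2 rX = X P" "rg h2 rY = Y P" "rg h2 rP = P" "rg h2 rSp = sp"
      using 5(2) by (simp_all add: agree_def c_scan_def X_def Y_def st_def)
    have post: "t \<le> 3 + n * 8" "rg h2 rF = 0 \<and> (\<forall>j<k. settled X Y P j) \<or>
      rg h2 rF = 1 \<and> U < k \<and> d (X P) (Y P) + d (X U) (Y U) < d (X P) (Y U) + d (X U) (Y P) \<or>
      rg h2 rF = 2 \<and> U < k \<and> d (X P) (Y P) + d (X U) (Y U) < d (X P) (X U) + d (Y P) (Y U)"
      using 5(1) by (simp_all add: X_def Y_def U_def)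
    have lt: "X P < n" "Y P < n" using p1 Pk unfolding pairs_ok_def by auto
    from post(2) show ?case
    proof (elim disjE conjE)
      assume 0: "rg h2 rF = 0" "\<forall>j<k. settled X Y P j"
      have "stack_ok X Y st sp" using stack_pop[OF p1 s1] 0(2) P_def by blast
      then show ?thesis using 0(1) post(1) b2 p1 by (simp add: e)
    next
      assume 1: "rg h2 rF = 1" "U < k" "d (X P) (Y P) + d (X U) (Y U) < d (X P) (Y U) + d (X U) (Y P)"
      have PU: "P \<noteq> U" using 1 by auto
      have same: "\<And>i. i \<noteq> P \<Longrightarrow> i \<noteq> U \<Longrightarrow> X i = X i \<and> (Y(P := Y U, U := Y P)) i = Y i" by simp
      have vals: "{X P, (Y(P := Y U, U := Y P)) P, X U, (Y(P := Y U, U := Y P)) U} = {X P, Y P, X U, Y U}" using PU by auto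
      have gain: "d (X P) (Y P) + d (X U) (Y U) < d (X P) ((Y(P := Y U, U := Y P)) P) + d (X U) ((Y(P := Y U, U := Y P)) U)"
        using 1 PU by simp
      note sw = swap_ok[where X' = "X" and Y' = "Y(P := Y U, U := Y P)", OF p1 s1 P_def[symmetric] 1(2) PU same vals]
      note wt = weight_swap[where X' = "X" and Y' = "Y(P := Y U, U := Y P)", OF Pk 1(2) PU same gain]
      have "Suc (Suc sp) + 3 * (k * n - weight X (Y(P := Y U, U := Y P))) < Suc sp + 3 * (k * n - weight X Y)"
        using wt weight_le[OF sw(1)] by linarith
      then show ?thesis using 1(1) post(1) b2 sw by (simp add: e c_swap_def U_def[symmetric])
    next
      assume 2: "rg h2 rF = 2" "U < k" "d (X P) (Y P) + d (X U) (Y U) < d (X P) (X U) + d (Y P) (Y U)"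
      \<comment> \<open>For \<open>P = U\<close> the right-hand side of the gain would be a sum of
        two distances of a vertex to itself.\<close>
      have PU: "P \<noteq> U" using 2 lt by auto
      have same: "\<And>i. i \<noteq> P \<Longrightarrow> i \<noteq> U \<Longrightarrow> (X(U := Y P)) i = X i \<and> (Y(P := X U)) i = Y i" by simp
      have vals: "{(X(U := Y P)) P, (Y(P := X U)) P, (X(U := Y P)) U, (Y(P := X U)) U} = {X P, Y P, X U, Y U}" using PU by auto
      have gain: "d (X P) (Y P) + d (X U) (Y U) < d ((X(U := Y P)) P) ((Y(P := X U)) P) + d ((X(U := Y P)) U) ((Y(P := X U)) U)"
        using 2 PU by simp
      note sw = swap_ok[where X' = "X(U := Y P)" and Y' = "Y(P := X U)", OF p1 s1 P_def[symmetric] 2(2) PU same vals]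
      note wt = weight_swap[where X' = "X(U := Y P)" and Y' = "Y(P := X U)", OF Pk 2(2) PU same gain]
      have "Suc (Suc sp) + 3 * (k * n - weight (X(U := Y P)) (Y(P := X U))) < Suc sp + 3 * (k * n - weight X Y)"
        using wt weight_le[OF sw(1)] by linarith
      then show ?thesis using 2(1) post(1) b2 sw by (simp add: e c_swap_def U_def[symmetric])
    qed
  qed (use p1 Pk in \<open>simp_all add: X_def Y_def\<close>)
  show ?case using fin unfolding hwp_Seq hwp_Assign
    by (simp add: sp X_def[symmetric] Y_def[symmetric] st_def[symmetric] P_def[symmetric])
next
  case (3 h1 t)
  have "k * n \<le> n * n" using k by simp
  then have "rg h rSp + 3 * (k * n - weight (ar h 3) (ar h 4)) \<le> n + 3 * (n * n)" using sp by linarith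
  then have "(rg h rSp + 3 * (k * n - weight (ar h 3) (ar h 4))) * Suc (16 + n * 8) \<le> (n + 3 * (n * n)) * Suc (16 + n * 8)"
    by (rule mult_le_mono1)
  then have "t \<le> Suc ((n + 3 * (n * n)) * Suc (16 + n * 8))" using 3(4) by linarith
  then have "t \<le> 1 + (n + 3 * (n * n)) * (17 + n * 8)" by simp
  then show ?case using 3(1,2) by (simp add: stack_ok_def)
qed (use b p s in simp)

end

section \<open>Output of the paths\<close>

text \<open>A pair that was output before is replaced by a pair of equal vertices, whose path is a
  single vertex. The service of the repeated pair is already rendered by the earlier path.\<close>

definition c_fresh :: hcom where
  "c_fresh = HIf (Eq (A 6 (ix rX rY)) (K 1))
     (HFor rV (R rN) (HIf (Eq (A 6 (ix rV rV)) (K 0)) (HAssign rX (R rV) ;; HAssign rY (R rV)) HSkip)) HSkip"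

definition c_mark :: hcom where
  "c_mark = HStore 6 (ix rX rY) (K 1) ;; HStore 6 (ix rY rX) (K 1)"

definition c_step :: hcom where
  "c_step = HFor rV (R rN)
     (HIf (An (Eq (dist_at rX rV) (K 1)) (Eq (Add (dist_at rV rY) (K 1)) (dist_at rX rY))) (HAssign rW (R rV)) HSkip)"

definition c_path :: hcom where
  "c_path = HStore 7 (R rOp) (Add (dist_at rX rY) (K 1)) ;; HAssign rOp (Add (R rOp) (K 1)) ;;
     HStore 7 (R rOp) (R rX) ;; HAssign rOp (Add (R rOp) (K 1)) ;;
     HWhile (Nt (Eq (R rX) (R rY)))
       (c_step ;; HAssign rX (R rW) ;; HStore 7 (R rOp) (R rX) ;; HAssign rOp (Add (R rOp) (K 1)))"

definition c_emit :: hcom where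
  "c_emit = HAssign rOp (K 0) ;; HFor rI (R rK)
     (HAssign rX (A 3 (R rI)) ;; HAssign rY (A 4 (R rI)) ;; c_fresh ;; c_mark ;; c_path)"

text \<open>Array 7 is spread over every sixteenth address, whereas the output has to be contiguous.
  It goes to address 0, over the input, which is no longer read at this point.\<close>

definition c_copy :: hcom where
  "c_copy = HFor rI (R rOp) (HWrite (R rI) (A 7 (R rI)))"

definition c_main :: hcom where
  "c_main = HRead rN (K 0) ;; HRead rM (K 1) ;; HRead rK (K 2) ;; c_dist ;; c_diam ;; c_search ;; c_pad ;;
     c_pairs ;; c_opt ;; c_emit ;; c_copy"

definition out :: "hstate \<Rightarrow> nat list" where
  "out h = map (ar h 7) [0..<rg h rOp]"

lemmas emit_defs = c_fresh_def c_mark_def c_path_def c_step_def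
lemmas dist_defs = c_dist_def c_init_def c_round_def c_relax_def

abbreviation ends :: "nat list \<Rightarrow> nat set" where
  "ends p \<equiv> {hd p, last p}"

context instance_graph begin

lemma step_correct:
  assumes b: "base r h" and x: "rg h rX < n" and y: "rg h rY < n" and xy: "rg h rX \<noteq> rg h rY"
  shows "hwp N c_step (\<lambda>t h'. t \<le> 2 + n * 4 \<and> rg h' rW < n \<and> d (rg h rX) (rg h' rW) = 1 \<and>
    Suc (d (rg h' rW) (rg h rY)) = d (rg h rX) (rg h rY)) h"
proof -
  define x0 y0 where "x0 = rg h rX" and "y0 = rg h rY"
  have xy0: "x0 < n" "y0 < n" "x0 \<noteq> y0" using x y xy by (simp_all add: x0_def y0_def)
  define P where "P v \<longleftrightarrow> v < n \<and> d x0 v = 1 \<and> Suc (d v y0) = d x0 y0" for v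
  obtain l where l: "d y0 x0 = Suc l" using d_eq_0[of y0 x0] xy0 by (cases "d y0 x0") auto
  then obtain w where w: "{w, x0} \<in> E" "w < n" "d y0 w = l" using d_pred[of y0 x0 l] xy0 by auto
  have "P w" unfolding P_def
    using w l d_edge[OF w(1)] d_sym[of w x0] d_sym[of y0 w] d_sym[of y0 x0] xy0 by simp
  have "hwp N c_step (\<lambda>t h'. t \<le> 2 + n * 4 \<and> P (rg h' rW)) h"
    unfolding c_step_def
  \<comment> \<open>Once some scanned vertex satisfies \<open>P\<close>, so does \<open>rW\<close>;
    the predecessor \<open>w\<close> guarantees that such a vertex is met.\<close>
  proof (rule hwp_for[where L = n and T = 2 and I = "\<lambda>i h'. \<forall>v<i. P v \<longrightarrow> P (rg h' rW)"], goal_cases)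
    case (5 h1)
    define v where "v = rg h1 rV"
    have vn: "v < n" using 5(2) v_def by simp
    have e: "rg h1 rN = n" "rg h1 rX = x0" "rg h1 rY = y0" "ar h1 0 = ar h 0"
      using 5(3) baseD[OF b] by (simp_all add: agree_def x0_def y0_def)
    have D: "ar h 0 (x0 * n + v) = d x0 v" "ar h 0 (v * n + y0) = d v y0" "ar h 0 (x0 * n + y0) = d x0 y0"
      using baseD(5)[OF b] vn xy0 by auto
    have c: "hbval h1 (An (Eq (dist_at rX rV) (K 1)) (Eq (Add (dist_at rV rY) (K 1)) (dist_at rX rY))) \<longleftrightarrow> P v"
      using vn by (simp add: e D P_def v_def[symmetric])
    show ?case unfolding hwp_If c using 5(1) by (simp add: v_def[symmetric] less_Suc_eq)
  next
    case (6 h1 t)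
    have "w < n" using \<open>P w\<close> by (simp add: P_def)
    then show ?case using 6(1,3) \<open>P w\<close> by auto
  qed (use baseD[OF b] in \<open>simp_all add: agree_def\<close>)
  then show ?thesis by (rule hwp_mono) (simp add: P_def x0_def y0_def)
qed

text \<open>The length of the walk so far plus the remaining distance is invariant. On arrival the
  walk therefore has the length of a shortest one and is isometric.\<close>

lemma path_correct:
  assumes b: "base r h" and x: "rg h rX < n" and y: "rg h rY < n"
  shows "hwp N c_path (\<lambda>t h'. t \<le> 5 + n * (6 + n * 4) \<and> (\<exists>p. isometric_path {..<n} E p \<and> hd p = rg h rX \<and>
    last p = rg h rY \<and> out h' = out h @ length p # p)) h"
proof -
  define x0 y0 o0 where "x0 = rg h rX" and "y0 = rg h rY" and "o0 = rg h rOp"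
  have xy: "x0 < n" "y0 < n" using x y by (simp_all add: x0_def y0_def)
  let ?h = "h\<lparr>ar := (ar h)(7 := (ar h 7)(o0 := Suc (d x0 y0), Suc o0 := x0)), rg := (rg h)(rOp := Suc (Suc o0))\<rparr>"
  let ?c = "c_step ;; HAssign rX (R rW) ;; HStore 7 (R rOp) (R rX) ;; HAssign rOp (Add (R rOp) (K 1))"
  let ?I = "\<lambda>h'. base r h' \<and> rg h' rY = y0 \<and> rg h' rX < n \<and> (\<exists>q. walk {..<n} E q \<and> hd q = x0 \<and> last q = rg h' rX \<and>
      length q + d (rg h' rX) y0 = Suc (d x0 y0) \<and> out h' = out h @ Suc (d x0 y0) # q)"
  let ?Q = "\<lambda>t h'. t \<le> 5 + n * (6 + n * 4) \<and> (\<exists>p. isometric_path {..<n} E p \<and> hd p = x0 \<and>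
    last p = y0 \<and> out h' = out h @ length p # p)"
  have "hwp N (HWhile (Nt (Eq (R rX) (R rY))) ?c) (\<lambda>t. ?Q (1 + (1 + (1 + (1 + t))))) ?h"
  proof (rule hwp_while[where I = ?I and T = "5 + n * 4" and \<mu> = "\<lambda>h'. d (rg h' rX) y0"], goal_cases)
    case 1
    have "out ?h = out h @ [Suc (d x0 y0), x0]" by (simp add: out_def o0_def)
    then show ?case using b xy by (auto simp: x0_def y0_def walk_def intro!: exI[of _ "[rg h rX]"])
  next
    case (2 h1)
    then obtain q where b1: "base r h1" and Y1: "rg h1 rY = y0" and X1: "rg h1 rX < n"
      and q: "walk {..<n} E q" "hd q = x0" "last q = rg h1 rX" "length q + d (rg h1 rX) y0 = Suc (d x0 y0)"
        "out h1 = out h @ Suc (d x0 y0) # q" by blast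
    have ne: "rg h1 rX \<noteq> rg h1 rY" using 2(2) by simp
    have Yn: "rg h1 rY < n" using Y1 xy by simp
    show ?case unfolding hwp_Seq
    proof (rule hwp_frame[OF step_correct[OF b1 X1 Yn ne]], goal_cases)
      case (1 t h2)
      define w where "w = rg h2 rW"
      have w: "w < n" "d (rg h1 rX) w = 1" "Suc (d w y0) = d (rg h1 rX) y0" using 1(1) by (simp_all add: w_def Y1)
      have b2: "base r h2" by (rule base_agree[OF b1 1(2)]) (simp_all add: c_step_def)
      have e2: "ar h2 7 = ar h1 7" "rg h2 rOp = rg h1 rOp" "rg h2 rY = y0"
        using 1(2) Y1 by (simp_all add: agree_def c_step_def)
      have "{last q, w} \<in> E" using d_one_edge[of "rg h1 rX" w] w X1 q(3) by simp
      then have "walk {..<n} E (q @ [w])" using q(1) w unfolding walk_def by (auto simp: successively_append_iff)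
      moreover have "hd (q @ [w]) = x0" using q(1,2) by (simp add: walk_def)
      moreover have "out h1 @ [w] = out h @ Suc (d x0 y0) # (q @ [w])" using q(5) by simp
      moreover have "length (q @ [w]) + d w y0 = Suc (d x0 y0)" using q(4) w(3) by simp
      ultimately have ex: "\<exists>q'. walk {..<n} E q' \<and> hd q' = x0 \<and> last q' = w \<and>
        length q' + d w y0 = Suc (d x0 y0) \<and> out h1 @ [w] = out h @ Suc (d x0 y0) # q'"
        by (intro exI[of _ "q @ [w]"]) simp
      let ?h3 = "h2\<lparr>rg := (rg h2)(rX := w, rOp := Suc (rg h1 rOp)), ar := (ar h2)(7 := (ar h1 7)(rg h1 rOp := w))\<rparr>"
      have "out ?h3 = out h1 @ [w]" by (simp add: out_def)
      then show ?case using 1(1) ex b2 w by (simp add: e2 w_def[symmetric] out_def)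
    qed
  next
    case (3 h1 t)
    then obtain q where X1: "rg h1 rX = y0"
      and q: "walk {..<n} E q" "hd q = x0" "last q = rg h1 rX" "length q + d (rg h1 rX) y0 = Suc (d x0 y0)"
        "out h1 = out h @ Suc (d x0 y0) # q" by (simp only: hbval.simps hval.simps) metis
    have len: "length q = Suc (d x0 y0)" using q(4) X1 xy by simp
    have "isometric_path {..<n} E q" unfolding isometric_path_def using q X1 len by simp
    moreover have "out h1 = out h @ length q # q" using q(5) len by simp
    moreover have "d x0 y0 * Suc (5 + n * 4) \<le> n * Suc (5 + n * 4)" using d_less[OF xy] by (intro mult_le_mono1) simp
    moreover have "t \<le> Suc (d x0 y0 * Suc (5 + n * 4))" using 3(4) by (simp add: x0_def)
    ultimately have "isometric_path {..<n} E q" "out h1 = out h @ length q # q" "t \<le> Suc (n * Suc (5 + n * 4))"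
      by (blast, blast, linarith)
    then show ?case using q(2,3) X1 by auto
  qed
  moreover have "ar h 0 (x0 * n + y0) = d x0 y0" "rg h rN = n" using baseD(1,5)[OF b] xy by auto
  ultimately show ?thesis unfolding c_path_def
    by (simp add: x0_def y0_def o0_def)
qed

definition marked :: "nat set set \<Rightarrow> hstate \<Rightarrow> bool" where
  "marked Q h \<longleftrightarrow> (\<forall>u<n. \<forall>v<n. ar h 6 (u * n + v) = (if {u, v} \<in> Q then 1 else 0))"

lemma marked_insert:
  assumes "marked Q h" "x < n" "y < n"
  shows "marked (insert {x, y} Q) (h\<lparr>ar := (ar h)(6 := (ar h 6)(x * n + y := 1, y * n + x := 1))\<rparr>)"
  unfolding marked_def
proof (intro allI impI)
  fix u v assume uv: "u < n" "v < n"
  have old: "ar h 6 (u * n + v) = (if {u, v} \<in> Q then 1 else 0)" using assms(1) uv unfolding marked_def by blast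
  show "ar (h\<lparr>ar := (ar h)(6 := (ar h 6)(x * n + y := 1, y * n + x := 1))\<rparr>) 6 (u * n + v) =
      (if {u, v} \<in> insert {x, y} Q then 1 else 0)"
  proof (cases "u = x \<and> v = y \<or> u = y \<and> v = x")
    case True
    then show ?thesis by (auto simp: insert_commute)
  next
    case False
    then have "{u, v} \<noteq> {x, y}" by (simp only: doubleton_eq_iff not_False_eq_True)
    moreover have "u * n + v \<noteq> x * n + y" "u * n + v \<noteq> y * n + x"
      using False index_eq_iff[OF uv(2) assms(3), of u x] index_eq_iff[OF uv(2) assms(2), of u y] by blast+
    ultimately show ?thesis using old by simp
  qed
qed

lemma fresh_correct:
  assumes b: "base r h" and x: "rg h rX < n" and y: "rg h rY < n"
    and m: "marked Q h" and Q: "finite Q" "card Q < n"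
  shows "hwp N c_fresh (\<lambda>t h'. t \<le> 3 + n * 5 \<and> rg h' rX < n \<and> rg h' rY < n \<and> {rg h' rX, rg h' rY} \<notin> Q \<and>
    ({rg h rX, rg h rY} \<in> Q \<or> {rg h' rX, rg h' rY} = {rg h rX, rg h rY})) h"
proof -
  have mk: "ar h 6 (u * n + v) = (if {u, v} \<in> Q then 1 else 0)" if "u < n" "v < n" for u v
    using m that unfolding marked_def by blast
  have "\<exists>w<n. {w} \<notin> Q"
  proof (rule ccontr)
    assume "\<not> ?thesis"
    then have "(\<lambda>w. {w}) ` {..<n} \<subseteq> Q" by auto
    then have "card ((\<lambda>w. {w}) ` {..<n}) \<le> card Q" using Q(1) by (intro card_mono)
    then show False using Q(2) by (simp add: card_image)
  qed
  then obtain w where w: "w < n" "{w} \<notin> Q" by blast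
  have loop: "hwp N (HFor rV (R rN) (HIf (Eq (A 6 (ix rV rV)) (K 0)) (HAssign rX (R rV) ;; HAssign rY (R rV)) HSkip))
    (\<lambda>t h'. t \<le> 2 + n * 5 \<and> rg h' rX < n \<and> rg h' rY = rg h' rX \<and> {rg h' rX} \<notin> Q) h"
  proof (rule hwp_for[where L = n and T = 3 and I = "\<lambda>i h'. \<forall>v<i. v < n \<longrightarrow> {v} \<notin> Q \<longrightarrow>
      rg h' rX < n \<and> rg h' rY = rg h' rX \<and> {rg h' rX} \<notin> Q"], goal_cases)
    case (5 h1)
    define v where "v = rg h1 rV"
    have vn: "v < n" using 5(2) v_def by simp
    have e: "rg h1 rN = n" "ar h1 6 = ar h 6" using 5(3) baseD[OF b] by (simp_all add: agree_def)
    have c: "hbval h1 (Eq (A 6 (ix rV rV)) (K 0)) \<longleftrightarrow> {v} \<notin> Q" using mk[OF vn vn] by (simp add: e v_def[symmetric])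
    show ?case unfolding hwp_If c using 5(1) vn by (simp add: v_def[symmetric] less_Suc_eq)
  next
    case (6 h1 t)
    then show ?case using w by simp
  qed (use baseD[OF b] in \<open>simp_all add: agree_def\<close>)
  have c: "hbval h (Eq (A 6 (ix rX rY)) (K 1)) \<longleftrightarrow> {rg h rX, rg h rY} \<in> Q"
    using mk[OF x y] baseD(1)[OF b] by simp
  show ?thesis unfolding c_fresh_def hwp_If c
  proof (cases "{rg h rX, rg h rY} \<in> Q", goal_cases)
    case 1
    have "hwp N (HFor rV (R rN) (HIf (Eq (A 6 (ix rV rV)) (K 0)) (HAssign rX (R rV) ;; HAssign rY (R rV)) HSkip))
      (\<lambda>t h'. Suc t \<le> 3 + n * 5 \<and> rg h' rX < n \<and> rg h' rY < n \<and> {rg h' rX, rg h' rY} \<notin> Q \<and>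
        ({rg h rX, rg h rY} \<in> Q \<or> {rg h' rX, rg h' rY} = {rg h rX, rg h rY})) h"
      by (rule hwp_mono[OF loop]) (use 1 in simp)
    then show ?case using 1 by (simp only: if_True)
  next
    case 2
    then show ?case using x y by simp
  qed
qed

text \<open>The last clause only asks that a pair be the ends of some output path, which may belong
  to an earlier equal pair.\<close>

definition emitted :: "(nat \<Rightarrow> nat) \<Rightarrow> (nat \<Rightarrow> nat) \<Rightarrow> nat \<Rightarrow> nat list list \<Rightarrow> hstate \<Rightarrow> bool" where
  "emitted X Y i ps h \<longleftrightarrow> length ps = i \<and> (\<forall>p\<in>set ps. isometric_path {..<n} E p) \<and> distinct (map set ps) \<and>
     out h = output_words ps \<and> marked (ends ` set ps) h \<and> (\<forall>j<i. {X j, Y j} \<in> ends ` set ps)"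

lemma emitted_set_rg [simp]: "f rOp = rg h rOp \<Longrightarrow> emitted X Y i ps (h\<lparr>rg := f\<rparr>) = emitted X Y i ps h"
  by (simp add: emitted_def marked_def out_def)

lemma emit_correct:
  assumes b: "base r h" and XY: "\<forall>i<k. ar h 3 i < n \<and> ar h 4 i < n" and z: "\<forall>i. ar h 6 i = 0"
  shows "hwp N c_emit (\<lambda>t h'. t \<le> 3 + n * (14 + n * (11 + n * 4)) \<and> (\<exists>ps. emitted (ar h 3) (ar h 4) k ps h')) h"
  unfolding c_emit_def hwp_Seq hwp_Assign hval.simps
proof (rule hwp_for[where L = k and T = "12 + n * (11 + n * 4)" and I = "\<lambda>i h'. base r h' \<and> (\<exists>ps. emitted (ar h 3) (ar h 4) i ps h')"], goal_cases)
  case 4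
  have "emitted (ar h 3) (ar h 4) 0 [] (set_rg rOp 0 h)"
    using z by (simp add: emitted_def out_def output_words_def marked_def)
  then show ?case using b by auto
next
  case (5 h1)
  define i where "i = rg h1 rI"
  define x y where "x = ar h 3 i" and "y = ar h 4 i"
  have ik: "i < k" using 5(2) i_def by simp
  have xy: "x < n" "y < n" using XY ik x_def y_def by auto
  obtain ps where b1: "base r h1" and ps: "emitted (ar h 3) (ar h 4) i ps h1" using 5(1) i_def by blast
  have a1: "ar h1 3 = ar h 3" "ar h1 4 = ar h 4"
    using 5(3) by (simp_all add: agree_def emit_defs)
  let ?Q = "ends ` set ps"
  have "card ?Q \<le> length ps" using card_image_le[of "set ps" ends] card_length[of ps] by simp
  then have Q: "finite ?Q" "card ?Q < n" using ps ik k unfolding emitted_def by auto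
  let ?h = "set_rg rY y (set_rg rX x h1)"
  have b1': "base r ?h" using b1 by simp
  have m1: "marked ?Q ?h" using ps by (simp add: emitted_def marked_def)
  have "hwp N c_fresh (\<lambda>t1. hwp N c_mark (\<lambda>t2. hwp N c_path (\<lambda>t3 h'. 1 + (1 + (t1 + (t2 + t3))) \<le> 12 + n * (11 + n * 4) \<and>
    base r h' \<and> (\<exists>ps. emitted (ar h 3) (ar h 4) (Suc i) ps h')))) ?h"
  proof (rule hwp_frame[OF fresh_correct[OF b1' _ _ m1 Q]], goal_cases)
    case (3 t1 h2)
    define x' y' where "x' = rg h2 rX" and "y' = rg h2 rY"
    have b2: "base r h2" by (rule base_agree[OF b1' 3(2)]) (simp_all add: c_fresh_def)
    have e2: "ar h2 6 = ar h1 6" "ar h2 7 = ar h1 7" "rg h2 rOp = rg h1 rOp"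
      using 3(2) by (simp_all add: agree_def c_fresh_def)
    have xy': "x' < n" "y' < n" "{x', y'} \<notin> ?Q" "{x, y} \<in> ?Q \<or> {x', y'} = {x, y}"
      using 3(1) by (simp_all add: x'_def y'_def)
    let ?h3 = "h2\<lparr>ar := (ar h2)(6 := (ar h2 6)(x' * n + y' := 1, y' * n + x' := 1))\<rparr>"
    have b3: "base r ?h3" using b2 by simp
    have m3: "marked (insert {x', y'} ?Q) ?h3"
    proof (rule marked_insert[OF _ xy'(1,2)])
      show "marked ?Q h2" using m1 by (simp add: marked_def e2)
    qed
    have "hwp N c_path (\<lambda>t3 h'. 1 + (1 + (t1 + (2 + t3))) \<le> 12 + n * (11 + n * 4) \<and>
      base r h' \<and> (\<exists>ps. emitted (ar h 3) (ar h 4) (Suc i) ps h')) ?h3"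
    proof (rule hwp_frame[OF path_correct[OF b3]], goal_cases)
      case (3 t3 h4)
      obtain p where p: "isometric_path {..<n} E p" "hd p = x'" "last p = y'" "out h4 = out ?h3 @ length p # p"
        using 3(1) by (auto simp: x'_def y'_def)
      have "out ?h3 = out h1" by (simp add: out_def e2)
      then have o4: "out h4 = output_words (ps @ [p])" using p(4) ps by (simp add: emitted_def output_words_def)
      have b4: "base r h4" by (rule base_agree[OF b3 3(2)]) (simp_all add: c_path_def c_step_def)
      have "ar h4 6 = ar ?h3 6" using 3(2) by (simp add: agree_def c_path_def c_step_def)
      then have m4: "marked (ends ` set (ps @ [p])) h4" using m3 p(2,3) by (simp add: marked_def)
      \<comment> \<open>An isometric path is determined up to its ends by its vertex set, so new
        ends give a new vertex set.\<close>
      have "set p \<notin> set ` set ps"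
      proof
        assume "set p \<in> set ` set ps"
        then obtain p' where p': "p' \<in> set ps" "set p = set p'" by auto
        then have "ends p = ends p'" using isometric_set_ends[OF p(1)] ps unfolding emitted_def by blast
        then show False using xy'(3) p' p(2,3) by auto
      qed
      then have "distinct (map set (ps @ [p]))" using ps by (simp add: emitted_def)
      moreover have "{ar h 3 j, ar h 4 j} \<in> ends ` set (ps @ [p])" if "j < Suc i" for j
      proof (cases "j = i")
        case True
        then show ?thesis using xy'(4) p(2,3) by (auto simp: x_def y_def)
      next
        case False
        then show ?thesis using ps that unfolding emitted_def by auto
      qed
      ultimately have "emitted (ar h 3) (ar h 4) (Suc i) (ps @ [p]) h4"
        using ps p(1) o4 m4 unfolding emitted_def by auto
      then show ?case using 3(1) \<open>t1 \<le> _ \<and> _\<close> b4 by (auto simp: algebra_simps)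
    qed (use xy' in \<open>simp_all add: x'_def y'_def\<close>)
    then show ?case unfolding c_mark_def using baseD(1)[OF b2] by (simp add: x'_def y'_def)
  qed (use xy in simp_all)
  then show ?case using a1 by (simp add: i_def[symmetric] x_def y_def)
next
  case (6 h1 t)
  have "k * (14 + n * (11 + n * 4)) \<le> n * (14 + n * (11 + n * 4))" using k(2) by (rule mult_le_mono1)
  moreover have "1 + t \<le> 3 + k * (14 + n * (11 + n * 4))" using 6(3) by (simp add: algebra_simps)
  ultimately have "1 + t \<le> 3 + n * (14 + n * (11 + n * 4))" by linarith
  then show ?case using 6(1) by blast
qed (use baseD[OF b] in \<open>simp_all add: agree_def emit_defs\<close>)

lemma output_length:
  assumes "\<forall>p\<in>set ps. isometric_path {..<n} E p"
  shows "length (output_words ps) \<le> length ps * (n + 1)"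
  using assms
proof (induction ps)
  case (Cons p ps)
  have "card (set p) \<le> n" using isometric_sub(2)[of p] Cons.prems card_mono[of "{..<n}" "set p"] by auto
  then have "length p \<le> n" using isometric_distinct[of p] Cons.prems by (simp add: distinct_card)
  then show ?case using Cons by (simp add: output_words_def)
qed (simp add: output_words_def)

lemma copy_correct:
  assumes "rg h rOp \<le> N"
  shows "hwp N c_copy (\<lambda>t h'. t \<le> 2 + rg h rOp * 3 \<and> (\<forall>i < rg h rOp. lo h' i = ar h 7 i)) h"
  unfolding c_copy_def
proof (rule hwp_for[where L = "rg h rOp" and T = 1 and I = "\<lambda>i h'. \<forall>j<i. lo h' j = ar h 7 j"], goal_cases)
  case (5 h1)
  then have "ar h1 7 = ar h 7" by (simp add: agree_def)
  then show ?case using 5(1,2) assms by (simp add: less_Suc_eq)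
qed (simp_all add: agree_def)

text \<open>The interface between program and analysis: all that the approximation bound uses about
  the computed paths, free of machine states.\<close>

definition solution :: "nat list list \<Rightarrow> bool" where
  "solution ps \<longleftrightarrow> path_collection {..<n} E k ps \<and> (\<exists>r T S X Y. r < n \<and> (\<exists>q<n. \<forall>u<n. \<forall>v<n. d u v \<le> d r q) \<and>
     (T = 0 \<or> separated r (T - 1)) \<and> covering r T S \<and> pairs_ok S X Y \<and> (\<forall>i<k. \<forall>j<k. settled X Y i j) \<and>
     (\<forall>i<k. {X i, Y i} \<in> ends ` set ps))"

definition main_time :: nat where
  "main_time = 3 + (6 + n * n * 3 + n * 3 + n * (length es * (n * 6 + 6) + 4)) + (4 + n * (n * 5 + 4)) +
     (3 + (2 * n + 1) * (8 + n * (13 + n * 9))) + (1 + n * 6) + (3 + n * 5) +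
     (1 + (n + 3 * (n * n)) * (17 + n * 8)) + (3 + n * (14 + n * (11 + n * 4))) + (2 + n * (n + 1) * 3)"

lemma main_correct:
  assumes lo: "lo h 0 = n" "lo h 1 = length es" "lo h 2 = k" "input_ok h" and z: "\<forall>i. ar h 6 i = 0"
  shows "hwp N c_main (\<lambda>t h'. t \<le> main_time \<and> (\<exists>ps. solution ps \<and> length (output_words ps) \<le> N \<and>
    (\<forall>i<length (output_words ps). lo h' i = output_words ps ! i))) h"
proof -
  let ?h = "h\<lparr>rg := (rg h)(rN := n, rM := length es, rK := k)\<rparr>"
  let ?Q = "\<lambda>t h'. t \<le> main_time \<and> (\<exists>ps. solution ps \<and> length (output_words ps) \<le> N \<and>
    (\<forall>i<length (output_words ps). lo h' i = output_words ps ! i))"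
  have p0: "params ?h" "input_ok ?h" using lo by (simp_all add: params_def input_ok_def)
  have "hwp N c_dist (\<lambda>t1. hwp N c_diam (\<lambda>t2. hwp N c_search (\<lambda>t3. hwp N c_pad (\<lambda>t4. hwp N c_pairs (\<lambda>t5. hwp N c_opt
    (\<lambda>t6. hwp N c_emit (\<lambda>t7. hwp N c_copy (\<lambda>t8. ?Q (1 + (1 + (1 + (t1 + (t2 + (t3 + (t4 + (t5 + (t6 + (t7 + t8)))))))))))))))))) ?h"
  proof (rule hwp_frame[OF dist_correct[OF p0]], goal_cases)
    case (1 t1 h1)
    have p1: "params h1" using 1(2) p0(1)
      by (simp add: params_def agree_def dist_defs)
    have z1: "ar h1 6 = ar h 6" using 1(2) by (simp add: agree_def dist_defs)
    note T1 = conjunct1[OF 1(1)]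
    show ?case
    proof (rule hwp_frame[OF diam_correct[OF p1 conjunct2[OF 1(1)]]], goal_cases)
      case (1 t2 h2)
      define r where "r = rg h2 rRoot"
      have diam: "r < n" "\<exists>q<n. \<forall>u<n. \<forall>v<n. d u v \<le> d r q" and T2: "t2 \<le> 4 + n * (n * 5 + 4)"
        using 1(1) by (simp_all add: r_def)
      have b2: "base r h2" using 1(2) p1 \<open>_ \<and> dist_ok h1\<close> diam(1)
        by (simp add: base_def params_def dist_ok_def agree_def c_diam_def r_def)
      have z2: "ar h2 6 = ar h 6" using 1(2) z1 by (simp add: agree_def c_diam_def)
      show ?case
      proof (rule hwp_frame[OF search_correct[OF b2]], goal_cases)
        case (1 t3 h3)
        define T where "T = rg h3 rT"
        have b3: "base r h3" and T: "T = 0 \<or> separated r (T - 1)" and c3: "rg h3 rCnt \<le> 2 * k"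
          and cov3: "covering r T (ar h3 2 ` {..<rg h3 rCnt})" and T3: "t3 \<le> 3 + (2 * n + 1) * (8 + n * (13 + n * 9))"
          using 1(1) by (simp_all add: T_def)
        have z3: "ar h3 6 = ar h 6" using 1(2) z2
          by (simp add: agree_def c_search_def c_greedy_def c_pick_def c_kill_def c_next_def)
        show ?case
        proof (rule hwp_frame[OF pad_correct[OF b3 c3 cov3]], goal_cases)
          case (1 t4 h4)
          define S where "S = ar h4 2 ` {..<2 * k}"
          have S: "covering r T S" and T4: "t4 \<le> 1 + n * 6" using 1(1) by (simp_all add: S_def)
          have b4: "base r h4" by (rule base_agree[OF b3 1(2)]) (simp_all add: c_pad_def)
          have z4: "ar h4 6 = ar h 6" using 1(2) z3 by (simp add: agree_def c_pad_def)
          have Sn: "ar h4 2 ` {..<2 * k} \<subseteq> {..<n}" using S unfolding covering_def S_def by blast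
          show ?case
          proof (rule hwp_frame[OF pairs_correct[OF b4 Sn]], goal_cases)
            case (1 t5 h5)
            have p5: "pairs_ok S (ar h5 3) (ar h5 4)" and sp5: "rg h5 rSp \<le> n"
              and s5: "stack_ok (ar h5 3) (ar h5 4) (ar h5 5) (rg h5 rSp)" and T5: "t5 \<le> 3 + n * 5"
              using 1(1) by (simp_all add: S_def)
            have b5: "base r h5" by (rule base_agree[OF b4 1(2)]) (simp_all add: c_pairs_def)
            have z5: "ar h5 6 = ar h 6" using 1(2) z4 by (simp add: agree_def c_pairs_def)
            show ?case
            proof (rule hwp_frame[OF opt_correct[OF b5 p5 sp5 s5]], goal_cases)
              case (1 t6 h6)
              define X Y where "X = ar h6 3" and "Y = ar h6 4"
              have p6: "pairs_ok S X Y" and o6: "\<forall>i<k. \<forall>j<k. settled X Y i j"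
                and T6: "t6 \<le> 1 + (n + 3 * (n * n)) * (17 + n * 8)"
                using 1(1) by (simp_all add: X_def Y_def)
              have b6: "base r h6" by (rule base_agree[OF b5 1(2)]) (simp_all add: c_opt_def c_scan_def c_swap_def)
              have z6: "\<forall>i. ar h6 6 i = 0" using 1(2) z5 z by (simp add: agree_def c_opt_def c_scan_def c_swap_def)
              have XYn: "\<forall>i<k. ar h6 3 i < n \<and> ar h6 4 i < n" using p6 unfolding pairs_ok_def X_def Y_def by blast
              show ?case
              proof (rule hwp_frame[OF emit_correct[OF b6 XYn z6]], goal_cases)
                case (1 t7 h7)
                obtain ps where ps: "emitted X Y k ps h7" using 1(1) unfolding X_def Y_def by blast
                have T7: "t7 \<le> 3 + n * (14 + n * (11 + n * 4))" using 1(1) by simp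
                have e: "length ps = k" "\<forall>p\<in>set ps. isometric_path {..<n} E p" "distinct (map set ps)"
                  "out h7 = output_words ps" "\<forall>i<k. {X i, Y i} \<in> ends ` set ps"
                  using ps unfolding emitted_def by blast+
                have sol: "solution ps" unfolding solution_def path_collection_def
                  using e diam T S p6 o6 by blast
                have len: "length (output_words ps) = rg h7 rOp" using e(4) by (metis diff_zero length_map length_upt out_def)
                have op: "rg h7 rOp \<le> n * (n + 1)"
                  using output_length[OF e(2)] mult_le_mono1[OF k(2), of "n + 1"] e(1) len by simp
                also have "\<dots> \<le> N" using n_pos by simp
                finally have opN: "rg h7 rOp \<le> N" .
                show ?case
                proof (rule hwp_mono[OF copy_correct[OF opN]], goal_cases)
                  case (1 t8 h8)
                  have "lo h8 i = output_words ps ! i" if "i < length (output_words ps)" for i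
                    using 1 that len e(4)[symmetric] by (simp add: out_def)
                  moreover have "t8 \<le> 2 + n * (n + 1) * 3" using 1 op by linarith
                  then have "1 + (1 + (1 + (t1 + (t2 + (t3 + (t4 + (t5 + (t6 + (t7 + t8))))))))) \<le> main_time"
                    unfolding main_time_def using T1 T2 T3 T4 T5 T6 T7 by linarith
                  ultimately show ?case using sol len opN by auto
                qed
              qed
            qed
          qed
        qed
      qed
    qed
  qed
  moreover have "2 < N" using n_pos by (cases n) auto
  ultimately show ?thesis unfolding c_main_def using lo n_pos by simp
qed

text \<open>A comparison of coefficients: the relaxation rounds contribute the monomial
  \<open>n * n * length es\<close>, all other phases at most \<open>n * n * n\<close>.\<close>

lemma main_time_le: "main_time \<le> 100 * ((n + 1) * (n + 1) * (length es + n + 1))"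
  unfolding main_time_def by (simp add: algebra_simps)

end

lemma c_main_ok: "cok c_main"
  by (simp add: c_main_def dist_defs c_diam_def c_search_def c_greedy_def
      c_pick_def c_kill_def c_next_def c_pad_def c_pairs_def c_opt_def c_scan_def c_swap_def c_emit_def
      emit_defs c_copy_def)

section \<open>Approximation guarantee and running time\<close>

sublocale conn_graph \<subseteq> four_point V "\<lambda>u v. real (gdist V E u v)" "real (thinness V E)"
proof
  fix x y z w assume "x \<in> V" "y \<in> V" "z \<in> V" "w \<in> V"
  then show "real (d x y) + real (d z w) \<le> max (real (d x z) + real (d y w)) (real (d x w) + real (d y z)) + 2 * real \<tau>"
    by (rule four_point_gdist)
next
  fix x y z assume "x \<in> V" "y \<in> V" "z \<in> V"
  then have "d x z \<le> d x y + d y z" by (rule d_tri)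
  then show "real (d x z) \<le> real (d x y) + real (d y z)" by simp
qed (simp_all add: d_sym)

context instance_graph begin

lemma eccentricity_le_iff:
  assumes "path_collection {..<n} E k ps"
  shows "eccentricity {..<n} E ps \<le> e \<longleftrightarrow> (\<forall>v<n. \<exists>p\<in>set ps. \<exists>u\<in>set p. d v u \<le> e)"
proof -
  let ?U = "\<Union>p\<in>set ps. set p"
  obtain p where "p \<in> set ps" using assms k unfolding path_collection_def by (cases ps) auto
  moreover from this have "p \<noteq> []" using assms isometric_sub(1) unfolding path_collection_def by blast
  ultimately have ne: "?U \<noteq> {}" by (cases p) auto
  have "eccentricity {..<n} E ps \<le> e \<longleftrightarrow> (\<forall>v<n. (MIN u\<in>?U. d v u) \<le> e)"
    unfolding eccentricity_def using n_pos by (subst Max_le_iff) auto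
  also have "\<dots> \<longleftrightarrow> (\<forall>v<n. \<exists>u\<in>?U. d v u \<le> e)"
    using ne by (subst Min_le_iff) auto
  finally show ?thesis by auto
qed

lemma optimal_collection:
  "\<exists>ps. path_collection {..<n} E k ps \<and> eccentricity {..<n} E ps = geodesic_center_opt {..<n} E k"
proof -
  have "isometric_path {..<n} E [i]" if "i < n" for i using that by (simp add: isometric_path_def walk_def)
  then have "path_collection {..<n} E k (map (\<lambda>i. [i]) [0..<k])"
    unfolding path_collection_def using k by (auto simp: distinct_map inj_on_def)
  then have "\<exists>r ps. path_collection {..<n} E k ps \<and> eccentricity {..<n} E ps = r" by blast
  from LeastI_ex[OF this] show ?thesis unfolding geodesic_center_opt_def .
qed

text \<open>The ends of the optimal paths serve as pairs. If \<open>u\<close> lies on the geodesic,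
  two triangle inequalities through \<open>u\<close> bound the Gromov product of its ends at
  \<open>v\<close> by \<open>d v u\<close>.\<close>

lemma optimal_pairs:
  obtains a b where "\<And>i. i < k \<Longrightarrow> a i \<in> {..<n} \<and> b i \<in> {..<n}"
    "\<And>v. v \<in> {..<n} \<Longrightarrow> \<exists>i<k. gp (a i) (b i) v \<le> real (geodesic_center_opt {..<n} E k)"
proof -
  let ?R = "geodesic_center_opt {..<n} E k"
  obtain ps where ps: "path_collection {..<n} E k ps" "eccentricity {..<n} E ps \<le> ?R"
    using optimal_collection by force
  have iso: "isometric_path {..<n} E (ps ! i)" if "i < k" for i using ps(1) that unfolding path_collection_def by auto
  show ?thesis
  proof (rule that[of "\<lambda>i. hd (ps ! i)" "\<lambda>i. last (ps ! i)"])
    fix v assume v: "v \<in> {..<n}"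
    obtain p u where p: "p \<in> set ps" "u \<in> set p" "d v u \<le> ?R" using ps(2) v unfolding eccentricity_le_iff[OF ps(1)] by auto
    obtain i where i: "i < k" "p = ps ! i" using p(1) ps(1) unfolding path_collection_def by (metis in_set_conv_nth)
    note isop = iso[OF i(1), folded i(2)]
    have V: "hd p \<in> {..<n}" "last p \<in> {..<n}" "u \<in> {..<n}" using isometric_sub[OF isop] p(2) by auto
    have "d (hd p) v + d v (last p) \<le> d (hd p) (last p) + 2 * d v u"
      using isometric_between[OF isop p(2)] d_tri[OF V(1,3) v] d_tri[OF v V(3,2)] d_sym[OF V(3) v] by simp
    from of_nat_mono[where 'a = real, OF this]
    have "gp (hd p) (last p) v \<le> real (d v u)" unfolding gp_def by simp
    then show "\<exists>i<k. gp (hd (ps ! i)) (last (ps ! i)) v \<le> real ?R" using i p(3) by (intro exI[of _ i]) auto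
  qed (use isometric_sub[OF iso] in blast)
qed

text \<open>The failed threshold \<open>T - 1\<close> yields more than \<open>2 * k\<close>
  separated vertices; \<open>greedy_separated\<close> costs \<open>\<tau>\<close> and
  \<open>separated_bound\<close> costs \<open>3 * \<tau>\<close>.\<close>

lemma threshold_bound:
  assumes r: "r < n" and diam: "\<exists>q<n. \<forall>u<n. \<forall>v<n. d u v \<le> d r q" and T: "T = 0 \<or> separated r (T - 1)"
  shows "real T / 2 \<le> real (geodesic_center_opt {..<n} E k) + 4 * real \<tau>"
proof (cases "T = 0")
  case False
  then obtain S s where S: "S \<subseteq> {..<n}" "r \<in> S" "2 * k < card S" and s: "s \<in> S" "s \<noteq> r" "\<forall>v<n. d r v \<le> d r s"
    and sep: "\<forall>m\<in>S. \<forall>z\<in>S. m \<noteq> r \<longrightarrow> z \<noteq> r \<longrightarrow> m \<noteq> z \<longrightarrow> T - 1 + d r z < d r m + d z m"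
    using T unfolding separated_def by blast
  have diam': "real (d u v) \<le> real (d r s)" if "u \<in> {..<n}" "v \<in> {..<n}" for u v
    using diam s(3) that by (metis lessThan_iff of_nat_le_iff order_trans)
  have sep': "real T / 2 \<le> gp r z m" if "m \<in> S" "z \<in> S" "m \<noteq> r" "z \<noteq> r" "m \<noteq> z" for m z
  proof -
    have "T - 1 + d r z < d r m + d z m" using sep that by blast
    moreover have "d z m = d m z" using d_sym[of z m] S(1) that by auto
    \<comment> \<open>As \<open>T\<close> is positive, the strict inequality between naturals at
      \<open>T - 1\<close> is the weak one at \<open>T\<close>, so the unit step of the search loses
      nothing.\<close>
    ultimately have "T + d r z \<le> d r m + d m z" by linarith
    from of_nat_mono[where 'a = real, OF this] show ?thesis unfolding gp_def by simp
  qed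
  obtain a b where ab: "\<And>i. i < k \<Longrightarrow> a i \<in> {..<n} \<and> b i \<in> {..<n}"
    "\<And>v. v \<in> {..<n} \<Longrightarrow> \<exists>i<k. gp (a i) (b i) v \<le> real (geodesic_center_opt {..<n} E k)"
    using optimal_pairs by blast
  have "finite S" using S(1) finite_subset by blast
  from separated_bound[OF this S(1,3) greedy_separated[OF S(1,2) s(1,2) diam' sep'] ab]
  show ?thesis by simp
qed simp

text \<open>Some chosen \<open>a\<close> has a small product with \<open>r\<close> at
  \<open>v\<close>. Both \<open>r\<close> and \<open>a\<close> belong to final pairs
  \<open>i\<close> and \<open>j\<close>, possibly equal, and \<open>exchange_bound\<close> shows
  that one of these two pairs serves \<open>v\<close>.\<close>

lemma solution_eccentricity:
  assumes sol: "solution ps"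
  shows "eccentricity {..<n} E ps \<le> geodesic_center_opt {..<n} E k + 6 * \<tau> + 1"
proof -
  let ?R = "geodesic_center_opt {..<n} E k"
  obtain r T S X Y where r: "r < n" and diam: "\<exists>q<n. \<forall>u<n. \<forall>v<n. d u v \<le> d r q"
    and T: "T = 0 \<or> separated r (T - 1)" and S: "covering r T S" and XY: "pairs_ok S X Y"
    and opt: "\<forall>i<k. \<forall>j<k. settled X Y i j" and paths: "\<forall>i<k. {X i, Y i} \<in> ends ` set ps"
    and ps: "path_collection {..<n} E k ps"
    using sol unfolding solution_def by blast
  have "\<exists>p\<in>set ps. \<exists>u\<in>set p. d v u \<le> ?R + 6 * \<tau> + 1" if v: "v < n" for v
  proof -
    obtain a where a: "a \<in> S" "d r v + d a v \<le> T + d r a" using S v unfolding covering_def by blast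
    have rS: "r \<in> S" and an: "a < n" using S a(1) unfolding covering_def by auto
    have V: "r \<in> {..<n}" "a \<in> {..<n}" "v \<in> {..<n}" using r an v by auto
    have g: "gp r a v \<le> real T / 2" using of_nat_mono[where 'a = real, OF a(2)] d_sym[OF V(2,3)] unfolding gp_def by simp
    obtain i where i: "i < k" "X i = r \<or> Y i = r" using XY rS unfolding pairs_ok_def by blast
    obtain j where j: "j < k" "X j = a \<or> Y j = a" using XY a(1) unfolding pairs_ok_def by blast
    have lt: "X i \<in> {..<n}" "Y i \<in> {..<n}" "X j \<in> {..<n}" "Y j \<in> {..<n}" using XY i j unfolding pairs_ok_def by auto
    have s: "settled X Y i j" using opt i j by blast
    note sym = d_sym[OF lt(1,2)] d_sym[OF lt(1,3)] d_sym[OF lt(1,4)] d_sym[OF lt(2,3)] d_sym[OF lt(2,4)] d_sym[OF lt(3,4)]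
    \<comment> \<open>One form for each choice of which end of pair \<open>i\<close> is
      \<open>r\<close> and which end of pair \<open>j\<close> is \<open>a\<close>.\<close>
    have s': "real (d (X i) (Y j)) + real (d (X j) (Y i)) \<le> real (d (X i) (Y i)) + real (d (X j) (Y j))"
      "real (d (X i) (X j)) + real (d (Y j) (Y i)) \<le> real (d (X i) (Y i)) + real (d (Y j) (X j))"
      "real (d (Y i) (Y j)) + real (d (X j) (X i)) \<le> real (d (Y i) (X i)) + real (d (X j) (Y j))"
      "real (d (Y i) (X j)) + real (d (Y j) (X i)) \<le> real (d (Y i) (X i)) + real (d (Y j) (X j))"
      using s sym unfolding settled_def by linarith+
    have "gp (X i) (Y i) v \<le> real T / 2 + \<tau> \<or> gp (X j) (Y j) v \<le> real T / 2 + \<tau>"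
      using i(2) j(2) g exchange_bound[OF lt(1,2,3,4) V(3) _ s'(1)] exchange_bound[OF lt(1,2,4,3) V(3) _ s'(2)]
        exchange_bound[OF lt(2,1,3,4) V(3) _ s'(3)] exchange_bound[OF lt(2,1,4,3) V(3) _ s'(4)]
        gp_sym[OF lt(1,2) V(3)] gp_sym[OF lt(3,4) V(3)]
      by (elim disjE) simp_all
    then obtain l where l: "l < k" "gp (X l) (Y l) v \<le> real T / 2 + \<tau>" using i(1) j(1) by blast
    then obtain p where p: "p \<in> set ps" "{X l, Y l} = ends p" using paths by blast
    have iso: "isometric_path {..<n} E p" using ps p(1) unfolding path_collection_def by blast
    have "gp (hd p) (last p) v = gp (X l) (Y l) v"
      using p(2) gp_sym[of "hd p" "last p" v] isometric_sub[OF iso] V(3) by (auto simp: doubleton_eq_iff)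
    then have gpp: "gp (hd p) (last p) v \<le> real ?R + 5 * \<tau>"
      using l(2) threshold_bound[OF r diam T] by simp
    obtain u where u: "u \<in> set p" "2 * real (d v u) \<le> real (d (hd p) v) + real (d v (last p)) - real (d (hd p) (last p)) + 2 * real \<tau> + 2"
      using near_path[OF iso refl refl V(3)] by blast
    have "real (d v u) \<le> gp (hd p) (last p) v + \<tau> + 1" using u(2) gp2[of "hd p" "last p" v] by linarith
    then have "real (d v u) \<le> real (?R + 6 * \<tau> + 1)" using gpp by simp
    then show ?thesis using p(1) u(1) by (metis of_nat_le_iff)
  qed
  then show ?thesis unfolding eccentricity_le_iff[OF ps] by blast
qed

section \<open>Input encoding, word length and running time\<close>

lemma input_length: "length (input_words n es k) = 3 + 2 * length es"
proof -
  have "length (concat (map (\<lambda>(u, v). [u, v]) es)) = 2 * length es" by (induction es) auto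
  then show ?thesis by (simp add: input_words_def)
qed

lemma concat_pairs_nth:
  "j < length xs \<Longrightarrow> concat (map (\<lambda>(u, v). [u, v]) xs) ! (2 * j) = fst (xs ! j) \<and>
     concat (map (\<lambda>(u, v). [u, v]) xs) ! Suc (2 * j) = snd (xs ! j)"
proof (induction xs arbitrary: j)
  case (Cons x xs)
  then show ?case by (cases j) (auto simp: split_def)
qed simp

definition start :: hstate where
  "start = \<lparr>rg = (\<lambda>_. 0), ar = (\<lambda>_ _. 0), lo = mem (input_state n es k)\<rparr>"

lemma start_correct:
  "lo start 0 = n" "lo start 1 = length es" "lo start 2 = k" "input_ok start" "\<forall>i. ar start 6 i = 0"
proof -
  show "lo start 0 = n" "lo start 1 = length es" "lo start 2 = k"
    by (simp_all add: start_def input_state_def input_length) (simp_all add: input_words_def)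
  show "\<forall>i. ar start 6 i = 0" by (simp add: start_def)
  have "lo start (3 + (j + j)) = fst (es ! j) \<and> lo start (4 + (j + j)) = snd (es ! j)" if j: "j < length es" for j
  proof -
    have a: "3 + (j + j) = Suc (Suc (Suc (2 * j)))" "4 + (j + j) = Suc (Suc (Suc (Suc (2 * j))))" by auto
    have "input_words n es k ! (3 + (j + j)) = fst (es ! j)" "input_words n es k ! (4 + (j + j)) = snd (es ! j)"
      unfolding a input_words_def using concat_pairs_nth[OF j] by auto
    then show ?thesis using j by (simp add: start_def input_state_def input_length)
  qed
  then show "input_ok start" unfolding input_ok_def by blast
qed

lemma input_word_state: "word_state ((n + 1) ^ 2) (input_state n es k)"
proof -
  have "x \<le> (n + 1) ^ 2" if "x \<in> set (input_words n es k)" for x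
  proof -
    have "x = n \<or> x = length es \<or> x = k \<or> x < n"
      using that es_edge edgeD unfolding input_words_def by (fastforce simp: in_set_conv_nth)
    then have "x \<le> n + n * n" using k length_es_le by auto
    then show ?thesis by (simp add: power2_eq_square)
  qed
  then have "mem (input_state n es k) a \<le> (n + 1) ^ 2" for a by (simp add: input_state_def)
  then show ?thesis unfolding word_state_def by (simp add: input_state_def)
qed

lemma input_fits: "3 + 2 * length es \<le> N"
proof -
  have "1 \<le> n * n" using n_pos by (cases n) auto
  then show ?thesis using length_es_le by linarith
qed

text \<open>Array addresses are computed from \<open>n\<close> in register 1, which has to be loaded
  before the compiled program starts; this is the instruction put in front of it.\<close>

lemma start_sim: "sim n ((input_state n es k)\<lparr>reg := (\<lambda>_. 0)(1 := n)\<rparr>) start"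
  using input_fits by (auto simp: sim_def start_def input_state_def input_length)

lemma program_correct:
  assumes B: "B = csize (ccom c_main)" and c: "c = (100 * B + 7) * B"
  shows "\<exists>t s ps. exec ((n + 1) ^ c) (Seq (Assign 1 (Mem (Const 0))) (ccom c_main)) (input_state n es k) t s \<and>
    t \<le> 3 + B * (100 * ((n + 1) * (n + 1) * (length es + n + 1))) \<and> outputs s ps \<and> solution ps"
proof -
  let ?W = "(n + 1) ^ c" and ?T = "100 * ((n + 1) * (n + 1) * (length es + n + 1))"
  let ?s = "(input_state n es k)\<lparr>reg := (\<lambda>_. 0)(1 := n)\<rparr>"
  obtain t h ps where run: "hrun N c_main start t h" "t \<le> main_time" and sol: "solution ps"
    and out: "length (output_words ps) \<le> N" "\<forall>i<length (output_words ps). lo h i = output_words ps ! i"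
    using main_correct[OF start_correct] unfolding hwp_def by blast
  have t: "t \<le> ?T" using run(2) main_time_le by simp
  \<comment> \<open>The exponent \<open>c\<close> is chosen here: with
    \<open>b = n + 1 \<ge> 2\<close> the base is at most \<open>(100 * B + 3) * b ^ 4\<close>, hence
    at most \<open>b ^ (100 * B + 7)\<close>, and the outer power multiplies this exponent by
    \<open>B\<close>.\<close>
  have W: "((n + 1) ^ 2 + B * t + 2) ^ B \<le> ?W"
  proof -
    let ?b = "n + 1"
    have b: "2 \<le> ?b" using n_pos by simp
    have "length es + n + 1 \<le> ?b * ?b" using length_es_le by simp
    then have "?T \<le> 100 * (?b * ?b * (?b * ?b))" by (intro mult_le_mono2)
    moreover have "x * x * (x * x) = x ^ 4" for x :: nat by (simp add: eval_nat_numeral)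
    ultimately have "B * t \<le> B * (100 * ?b ^ 4)" using t by (intro mult_le_mono2) (simp only: le_trans)
    moreover have "?b ^ 2 \<le> ?b ^ 4" "1 \<le> ?b ^ 4" by (auto intro!: power_increasing)
    ultimately have "?b ^ 2 + B * t + 2 \<le> ?b ^ 4 + B * (100 * ?b ^ 4) + 2 * ?b ^ 4" by linarith
    also have "\<dots> = (100 * B + 3) * ?b ^ 4" by (simp add: algebra_simps)
    also have "100 * B + 3 \<le> 2 ^ (100 * B + 3)" using less_exp[of "100 * B + 3"] by simp
    also have "\<dots> \<le> ?b ^ (100 * B + 3)" using b by (intro power_mono) auto
    finally have "?b ^ 2 + B * t + 2 \<le> ?b ^ (100 * B + 3) * ?b ^ 4" by simp
    also have "\<dots> = ?b ^ (100 * B + 7)" by (simp add: power_add[symmetric] add.commute)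
    finally have "(?b ^ 2 + B * t + 2) ^ B \<le> (?b ^ (100 * B + 7)) ^ B" by (intro power_mono) auto
    then show ?thesis by (simp only: c power_mult)
  qed
  have "n \<le> (n + 1) ^ 2" by (simp add: power2_eq_square)
  then have ws: "word_state ((n + 1) ^ 2) ?s"
    using input_word_state unfolding word_state_def by simp
  obtain t' s' where s': "exec ?W (ccom c_main) ?s t' s'" "t' \<le> B * t" "sim n s' h"
    using compile_correct[OF run(1) refl c_main_ok eq_refl[OF B[symmetric]] start_sim ws W] by blast
  have "exec ?W (Assign 1 (Mem (Const 0))) (input_state n es k) (1 + acost (Mem (Const 0)))
    ((input_state n es k)\<lparr>reg := (reg (input_state n es k))(1 := aval (input_state n es k) (Mem (Const 0)))\<rparr>)"
    by (rule ex_assign) simp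
  moreover have "aval (input_state n es k) (Mem (Const 0)) = n" using start_correct(1) by (simp add: start_def)
  moreover have "reg (input_state n es k) = (\<lambda>_. 0)" by (simp add: input_state_def)
  ultimately have "exec ?W (Assign 1 (Mem (Const 0))) (input_state n es k) 3 ?s" by (simp add: numeral_3_eq_3)
  from ex_seq[OF this s'(1)]
  have "exec ?W (Seq (Assign 1 (Mem (Const 0))) (ccom c_main)) (input_state n es k) (3 + t') s'" .
  moreover have "3 + t' \<le> 3 + B * ?T" using s'(2) mult_le_mono2[OF t, of B] by linarith
  moreover have "outputs s' ps" unfolding outputs_def
  proof (intro allI impI)
    fix i assume i: "i < length (output_words ps)"
    have "reg s' 0 = 0" "\<forall>i<N. mem s' i = lo h i" using s'(3) unfolding sim_def by auto
    then show "mem s' (reg s' 0 + i) = output_words ps ! i" using out i by simp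
  qed
  ultimately show ?thesis using sol by blast
qed

lemma time_bound:
  assumes n: "2 \<le> n" and t: "t \<le> 3 + B * (100 * ((n + 1) * (n + 1) * (length es + n + 1)))"
  shows "real t \<le> (1600 * real B + 3) * (real (card E) * real n ^ 2 * log 2 (real n))"
proof -
  let ?m = "length es"
  \<comment> \<open>Connectedness gives \<open>n \<le> m + 1\<close>, so linear terms in
    \<open>n\<close> are absorbed by \<open>m\<close>. The constant 1600 is
    \<open>100 * 2 * 2 * 4\<close>.\<close>
  have m: "1 \<le> ?m" "?m + n + 1 \<le> 4 * ?m" using n n_le by linarith+
  have "n + 1 \<le> 2 * n" using n by simp
  then have "(n + 1) * (n + 1) * (?m + n + 1) \<le> (2 * n) * (2 * n) * (4 * ?m)" using m(2) by (intro mult_le_mono)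
  then have "B * (100 * ((n + 1) * (n + 1) * (?m + n + 1))) \<le> B * (100 * ((2 * n) * (2 * n) * (4 * ?m)))"
    by (intro mult_le_mono2)
  also have "\<dots> = 1600 * B * (?m * n ^ 2)" by (simp add: power2_eq_square)
  finally have "t \<le> 3 + 1600 * B * (?m * n ^ 2)" using t by linarith
  moreover have "1 * 1 \<le> ?m * n ^ 2" by (rule mult_le_mono[OF m(1)]) (use n in simp)
  ultimately have "t \<le> 1600 * B * (?m * n ^ 2) + 3 * (?m * n ^ 2)" by linarith
  then have "t \<le> (1600 * B + 3) * (?m * n ^ 2)" by (simp only: add_mult_distrib)
  then have "real t \<le> (1600 * real B + 3) * (real ?m * real n ^ 2)"
    using of_nat_mono[of t "(1600 * B + 3) * (?m * n ^ 2)"] by simp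
  also have "\<dots> \<le> (1600 * real B + 3) * (real ?m * real n ^ 2 * log 2 (real n))"
  proof (intro mult_left_mono)
    \<comment> \<open>The program needs no logarithmic factor; the factor in the bound is at least 1
      from \<open>n = 2\<close> on.\<close>
    have "1 \<le> log 2 (real n)" using n by (simp add: le_log_iff)
    then show "real ?m * real n ^ 2 \<le> real ?m * real n ^ 2 * log 2 (real n)"
      using mult_left_mono[of 1 "log 2 (real n)" "real ?m * real n ^ 2"] by simp
  qed simp
  finally show ?thesis by (simp add: length_es)
qed

end

theorem theorem3:
  shows "\<exists>(prog :: com) (c :: nat) (K :: real). 2 \<le> c \<and>
    (\<forall>(n :: nat) (E :: nat set set) (es :: (nat \<times> nat) list) (k :: nat).
       connected_graph {..<n} E \<and> edge_list E es \<and> 1 \<le> k \<and> k \<le> n \<longrightarrow>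
       (\<exists>t s ps. exec ((n + 1) ^ c) prog (input_state n es k) t s \<and>
          (2 \<le> n \<longrightarrow> real t \<le> K * (real (card E) * real n ^ 2 * log 2 (real n))) \<and>
          outputs s ps \<and>
          path_collection {..<n} E k ps \<and>
          eccentricity {..<n} E ps
            \<le> geodesic_center_opt {..<n} E k + 6 * thinness {..<n} E + 1))"
proof -
  define M where "M = csize (ccom c_main)"
  define c where "c = (100 * M + 7) * M"
  have "1 \<le> M" unfolding M_def by (simp add: c_main_def)
  then have "7 * 1 \<le> c" unfolding c_def by (intro mult_le_mono) auto
  then have "2 \<le> c" by simp
  moreover have "\<exists>t s ps. exec ((n + 1) ^ c) (Seq (Assign 1 (Mem (Const 0))) (ccom c_main)) (input_state n es k) t s \<and>
      (2 \<le> n \<longrightarrow> real t \<le> (1600 * real M + 3) * (real (card E) * real n ^ 2 * log 2 (real n))) \<and>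
      outputs s ps \<and> path_collection {..<n} E k ps \<and>
      eccentricity {..<n} E ps \<le> geodesic_center_opt {..<n} E k + 6 * thinness {..<n} E + 1"
    if "connected_graph {..<n} E \<and> edge_list E es \<and> 1 \<le> k \<and> k \<le> n" for n E es k
  proof -
    interpret instance_graph n E es k
      using that by unfold_locales auto
    obtain t s ps where *: "exec ((n + 1) ^ c) (Seq (Assign 1 (Mem (Const 0))) (ccom c_main)) (input_state n es k) t s"
      "t \<le> 3 + M * (100 * ((n + 1) * (n + 1) * (length es + n + 1)))" "outputs s ps" "solution ps"
      using program_correct[OF M_def c_def] by blast
    moreover have "path_collection {..<n} E k ps" using *(4) unfolding solution_def by blast
    ultimately show ?thesis using time_bound[OF _ *(2)] solution_eccentricity by blast
  qed
  ultimately show ?thesis by blast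
qed

end
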